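(* Let $N\ge1$, let $p>1$ be an integer, let $E\subset\mathfrak{LC}_p(\mathbb R^{2N},\mathbb R^N)$, let $D'\subset\mathbb R^N$ and $D\subset\mathbb R^{2N}$ be countable dense subsets, and let $(\phi_n)_{n\in\mathbb N}$ be a sequence in $\mathcal C=C([-1,0],\mathbb R^N)$ converging uniformly to $\phi\in\mathcal C$. (i) Suppose $E$ has $L^1_{loc}$-equicontinuous $m$-bounds, and let $\Theta=\{\theta^I_j\}$ be the suitable set of moduli of continuity given by the $m$-bounds of $E$, i.e. $\theta^I_j(s)=\sup_{t\in I,\,f\in E}\int_t^{t+s}m^j_f(u)\,du$. Let $\theta_0$ be a modulus of continuity shared by all the functions in $\{\phi_n:n\in\mathbb N\}\cup\{\phi\}$ and let $\overline\Theta=\{\bar\theta^I_j\}$ with $\bar\theta^I_j(s)=\max\{\theta^I_j(s),\theta_0(s)\}$. If $(f_n)_{n\in\mathbb N}$ is a sequence in $E$ converging to $f$ in $(\mathfrak{LC}_p(\mathbb R^{2N},\mathbb R^N),\mathcal T_{\Theta\overline\Theta})$, then $$\|x(\cdot,f_n,\phi_n)-x(\cdot,f,\phi)\|_{\mathcal C^{1,p}([0,T])}\xrightarrow{n\to\infty}0\qquad( * )$$ for any $[0,T]\subset I_{f,\phi}$. (ii) If $E$ has $L^1_{loc}$-equicontinuous $m$-bounds and $L^p_{loc}$-bounded $l_2$-bounds, then $( * )$ holds when the convergence of the sequence $(f_n)_{n\in\mathbb N}$ to $f$ is taken with respect to $\mathcal T_{\Theta D'}$, for the same $\Theta$ as in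 (i). (iii) If $E$ has $L^p_{loc}$-bounded $l$-bounds, then $( * )$ also holds when the convergence of the sequence $(f_n)_{n\in\mathbb N}$ to $f$ is taken with respect to $\mathcal T_D$.
   Context: $B_j$ is the closed ball of radius $j$ centered at the origin; $C(I,W)$ is the space of continuous functions $I\to W$. $L^p_{loc}$ is the set of real functions on $\mathbb R$ belonging to $L^p(I)$ for every compact interval $I$. For a compact interval $I$, $\mathcal C^{1,p}(I)$ is the Sobolev space of (absolutely) continuous functions $x:I\to\mathbb R^N$ with $\dot x\in L^p(I)$, normed by $\|x\|_{\mathcal C^{1,p}(I)}=\|x\|_{L^\infty(I)}+\|\dot x\|_{L^p(I)}$. $\mathfrak{LC}_p(\mathbb R^{2N},\mathbb R^N)$ is the set of functions $f:\mathbb R\times\mathbb R^{2N}\to\mathbb R^N$ such that: $f$ is Borel measurable; for every compact $K\subset\mathbb R^{2N}$ there are $m^K,l^K\in L^p_{loc}$ such that for a.e. $t\in\mathbb R$, $|f(t,z)|\le m^K(t)$ and $|f(t,z_1)-f(t,z_2)|\le l^K(t)|z_1-z_2|$ for all $z,z_1,z_2\in K$. Functions differing only on a negligible set are identified. Points of $\mathbb R^{2N}$ are written $(x,u)$. Optimal bounds of $f$ on $B_j\subset\mathbb R^{2N}$: $m^j_f(t)=\sup_{z\in B_j}|f(t,z)|$, $l^j_f(t)=\sup_{z_1\neq z_2\in B_j}|f(t,z_1)-f(t,z_2)|/|z_1-z_2|$, $l^j_{2,f}(t)=\sup|f(t,x,u_1)-f(t,x,u_2)|/|u_1-u_2|$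 over $(x,u_1),(x,u_2)\in B_j$, $u_1\ne u_2$. $E$ has $L^1_{loc}$-equicontinuous $m$-bounds if for every $j\in\mathbb N$, $r,\varepsilon>0$ there is $\delta>0$ with $\sup_{f\in E}\int_s^t m^j_f(u)\,du<\varepsilon$ whenever $-r\le s\le t\le r$, $t-s<\delta$. $E$ has $L^p_{loc}$-bounded $l$-bounds (resp. $l_2$-bounds) if $\sup_{f\in E}\int_{-r}^r l^j_f(t)^p\,dt<\infty$ (resp. $\sup_{f\in E}\int_{-r}^r l^j_{2,f}(t)^p\,dt<\infty$) for every $j\in\mathbb N$, $r>0$. A suitable set of moduli of continuity is a countable set $\{\theta^I_j: j\in\mathbb N,\ I=[q_1,q_2],\ q_1,q_2\in\mathbb Q\}$ of non-decreasing continuous functions $[0,\infty)\to[0,\infty)$ with $\theta^I_j(0)=0$ and $\theta^{I_1}_{j_1}\le\theta^{I_2}_{j_2}$ whenever $I_1\subseteq I_2$, $j_1\le j_2$. A modulus of continuity is a non-decreasing continuous $\theta_0:[0,\infty)\to[0,\infty)$ with $\theta_0(0)=0$. $\mathcal K^I_j$ (resp. $\overline{\mathcal K}^I_j$) is the set of $x\in C(I,B_j)$, $B_j\subset\mathbb R^N$, with $|x(t)-x(s)|\le\theta^I_j(|t-s|)$ (resp. $\bar\theta^I_j(|t-s|)$) for all $t,s\in I$. Topologies, generated by the following seminorms over all $I=[q_1,q_2]$, $q_1,q_2\in\mathbb Q$, $j\in\mathbb N$ ($I-1$ is the translate of $I$): - $\mathcal T_{\Theta\overline\Theta}$: $\sup_{x\in\mathcal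 K^I_j,\,u\in\overline{\mathcal K}^{I-1}_j}[\int_I|f(t,x(t),u(t-1))|^pdt]^{1/p}$; - $\mathcal T_{\Theta D'}$: $\sup_{x\in\mathcal K^I_j}[\int_I|f(t,x(t),u)|^pdt]^{1/p}$, $u\in D'$; - $\mathcal T_D$: $[\int_I|f(t,z)|^pdt]^{1/p}$, $z\in D$. For $f\in\mathfrak{LC}_p(\mathbb R^{2N},\mathbb R^N)$ and $\phi\in\mathcal C$, $x(\cdot,f,\phi)$ denotes the unique maximal continuous (Carathéodory) solution, with maximal interval of definition $I_{f,\phi}=[-1,b_{f,\phi})$, of $\dot x=f(t,x(t),x(t-1))$ for $t>0$, $x(t)=\phi(t)$ for $t\in[-1,0]$; if $b_{f,\phi}<\infty$ then $|x(t,f,\phi)|\to\infty$ as $t\to b_{f,\phi}$. Convergence on $[0,T]$ is understood for $n$ large enough that $[0,T]\subset I_{f_n,\phi_n}$, this being part of the assertion. *)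

theory Defs
  imports "HOL-Analysis.Analysis"
begin

section \<open>\<open>L\<^sup>p\<close> and Sobolev spaces on compact intervals\<close>

definition Lp_on :: "nat \<Rightarrow> real set \<Rightarrow> (real \<Rightarrow> 'w::euclidean_space) set" where
  "Lp_on p I = {g. set_borel_measurable lebesgue I g \<and>
                   set_integrable lebesgue I (\<lambda>t. norm (g t) ^ p)}"

definition Lp_norm :: "nat \<Rightarrow> real set \<Rightarrow> (real \<Rightarrow> 'w::euclidean_space) \<Rightarrow> real" where
  "Lp_norm p I g = root p (LINT t:I|lebesgue. norm (g t) ^ p)"

definition Lp_loc :: "nat \<Rightarrow> (real \<Rightarrow> real) set" where
  "Lp_loc p = {g. \<forall>a b. g \<in> Lp_on p {a..b}}"

text \<open>
  Absolute continuity on a compact interval \<open>{a..b}\<close>, in the usual epsilon-delta form.  The elements of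
  a division are compact intervals with pairwise disjoint interiors; \<open>S\<close> is their union.
\<close>

definition abs_continuous_on_interval ::
    "real \<Rightarrow> real \<Rightarrow> (real \<Rightarrow> 'w::euclidean_space) \<Rightarrow> bool" where
  "abs_continuous_on_interval a b x \<longleftrightarrow>
     (\<forall>\<epsilon>>0. \<exists>\<delta>>0. \<forall>\<D> S. \<D> division_of S \<and> S \<subseteq> {a..b} \<and> (\<Sum>k\<in>\<D>. Sup k - Inf k) < \<delta> \<longrightarrow>
        (\<Sum>k\<in>\<D>. norm (x (Sup k) - x (Inf k))) < \<epsilon>)"

text \<open>
  An absolutely continuous function is differentiable almost everywhere, so the values of
  \<open>vector_derivative\<close> at the other points do not matter below.  On continuous functions
  the \<open>L\<^sup>\<infinity>\<close> norm is the supremum norm.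
\<close>

definition C1p :: "nat \<Rightarrow> real \<Rightarrow> real \<Rightarrow> (real \<Rightarrow> 'w::euclidean_space) set" where
  "C1p p a b = {x. abs_continuous_on_interval a b x \<and>
                   (\<lambda>t. vector_derivative x (at t within {a..b})) \<in> Lp_on p {a..b}}"

definition C1p_norm :: "nat \<Rightarrow> real \<Rightarrow> real \<Rightarrow> (real \<Rightarrow> 'w::euclidean_space) \<Rightarrow> real" where
  "C1p_norm p a b x = (SUP t\<in>{a..b}. norm (x t)) +
                      Lp_norm p {a..b} (\<lambda>t. vector_derivative x (at t within {a..b}))"


section \<open>Lipschitz Caratheodory functions\<close>

text \<open>
  We work with representatives: functions that differ on a negligible set are not identified.
  If \<open>f\<close> and \<open>g\<close> in \<open>LC p\<close> agree almost everywhere, then \<open>f t = g t\<close> for almost every \<open>t\<close> by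
  continuity in the space variable, and all the notions below only depend on \<open>f t\<close> for
  almost every \<open>t\<close>.
\<close>

definition LC :: "nat \<Rightarrow> (real \<Rightarrow> 'z::euclidean_space \<Rightarrow> 'w::euclidean_space) set" where
  "LC p = {f. (\<lambda>(t, z). f t z) \<in> borel_measurable borel \<and>
     (\<forall>K. compact K \<longrightarrow> (\<exists>m\<in>Lp_loc p. \<exists>l\<in>Lp_loc p. AE t in lebesgue.
        (\<forall>z\<in>K. norm (f t z) \<le> m t) \<and>
        (\<forall>z1\<in>K. \<forall>z2\<in>K. norm (f t z1 - f t z2) \<le> l t * norm (z1 - z2))))}"

text \<open>
  The optimal bounds are \<open>ennreal\<close>-valued since for \<open>t\<close> in a null set the suprema may be infinite.
  They agree almost everywhere with Borel functions, hence they are Lebesgue measurable.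
\<close>

definition mbound :: "nat \<Rightarrow> (real \<Rightarrow> 'z::euclidean_space \<Rightarrow> 'w::euclidean_space) \<Rightarrow> real \<Rightarrow> ennreal"
  where "mbound j f t = (SUP z\<in>cball 0 (real j). ennreal (norm (f t z)))"

definition lbound :: "nat \<Rightarrow> (real \<Rightarrow> 'z::euclidean_space \<Rightarrow> 'w::euclidean_space) \<Rightarrow> real \<Rightarrow> ennreal"
  where "lbound j f t =
    (SUP (z1, z2)\<in>{(z1, z2). z1 \<in> cball 0 (real j) \<and> z2 \<in> cball 0 (real j) \<and> z1 \<noteq> z2}.
       ennreal (norm (f t z1 - f t z2) / norm (z1 - z2)))"

definition l2bound ::
    "nat \<Rightarrow> (real \<Rightarrow> 'x::euclidean_space \<times> 'u::euclidean_space \<Rightarrow> 'w::euclidean_space) \<Rightarrow> real \<Rightarrow> ennreal"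
  where "l2bound j f t =
    (SUP (x, u1, u2)\<in>{(x, u1, u2). (x, u1) \<in> cball 0 (real j) \<and> (x, u2) \<in> cball 0 (real j) \<and> u1 \<noteq> u2}.
       ennreal (norm (f t (x, u1) - f t (x, u2)) / norm (u1 - u2)))"

definition L1loc_equicontinuous_mbounds ::
    "(real \<Rightarrow> 'z::euclidean_space \<Rightarrow> 'w::euclidean_space) set \<Rightarrow> bool" where
  "L1loc_equicontinuous_mbounds E \<longleftrightarrow>
     (\<forall>j. \<forall>r>0. \<forall>\<epsilon>>0. \<exists>\<delta>>0. \<forall>s t. - r \<le> s \<and> s \<le> t \<and> t \<le> r \<and> t - s < \<delta> \<longrightarrow>
        (SUP f\<in>E. \<integral>\<^sup>+u\<in>{s..t}. mbound j f u \<partial>lebesgue) < ennreal \<epsilon>)"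

definition Lploc_bounded_lbounds ::
    "nat \<Rightarrow> (real \<Rightarrow> 'z::euclidean_space \<Rightarrow> 'w::euclidean_space) set \<Rightarrow> bool" where
  "Lploc_bounded_lbounds p E \<longleftrightarrow>
     (\<forall>j. \<forall>r>0. (SUP f\<in>E. \<integral>\<^sup>+t\<in>{- r..r}. lbound j f t ^ p \<partial>lebesgue) < \<infinity>)"

definition Lploc_bounded_l2bounds ::
    "nat \<Rightarrow> (real \<Rightarrow> 'x::euclidean_space \<times> 'u::euclidean_space \<Rightarrow> 'w::euclidean_space) set \<Rightarrow> bool" where
  "Lploc_bounded_l2bounds p E \<longleftrightarrow>
     (\<forall>j. \<forall>r>0. (SUP f\<in>E. \<integral>\<^sup>+t\<in>{- r..r}. l2bound j f t ^ p \<partial>lebesgue) < \<infinity>)"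


section \<open>Moduli of continuity\<close>

definition modulus_of_continuity :: "(real \<Rightarrow> real) \<Rightarrow> bool" where
  "modulus_of_continuity \<theta> \<longleftrightarrow>
     mono_on {0..} \<theta> \<and> continuous_on {0..} \<theta> \<and> (\<forall>s\<ge>0. 0 \<le> \<theta> s) \<and> \<theta> 0 = 0"

text \<open>
  For a family \<open>\<Theta>\<close> of moduli, \<open>\<Theta> j a b\<close> is the modulus with index \<open>j\<close> and \<open>I = {a..b}\<close>;
  only rational \<open>a \<le> b\<close> are used.
\<close>

type_synonym moduli = "nat \<Rightarrow> real \<Rightarrow> real \<Rightarrow> real \<Rightarrow> real"

text \<open>The supremum is finite if \<open>E\<close> has \<open>L\<^sup>1\<close>-locally equicontinuous m-bounds.\<close>

definition mbound_moduli :: "(real \<Rightarrow> 'z::euclidean_space \<Rightarrow> 'w::euclidean_space) set \<Rightarrow> moduli" where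
  "mbound_moduli E j a b s =
     enn2real (SUP (t, f)\<in>{a..b} \<times> E. \<integral>\<^sup>+u\<in>{t..t + s}. mbound j f u \<partial>lebesgue)"

definition max_moduli :: "moduli \<Rightarrow> (real \<Rightarrow> real) \<Rightarrow> moduli" where
  "max_moduli \<Theta> \<theta>0 j a b s = max (\<Theta> j a b s) (\<theta>0 s)"

definition moduli_functions :: "moduli \<Rightarrow> nat \<Rightarrow> real \<Rightarrow> real \<Rightarrow> (real \<Rightarrow> 'w::euclidean_space) set" where
  "moduli_functions \<Theta> j a b =
     {x. continuous_on {a..b} x \<and> x ` {a..b} \<subseteq> cball 0 (real j) \<and>
         (\<forall>t\<in>{a..b}. \<forall>s\<in>{a..b}. norm (x t - x s) \<le> \<Theta> j a b \<bar>t - s\<bar>)}"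


section \<open>Topologies on \<open>LC p\<close>\<close>

definition seminorm_topology :: "'v::minus set \<Rightarrow> ('v \<Rightarrow> real) set \<Rightarrow> 'v topology" where
  "seminorm_topology V P =
     topology_generated_by {{g \<in> V. \<rho> (g - f) < \<epsilon>} | f \<rho> \<epsilon>. f \<in> V \<and> \<rho> \<in> P \<and> 0 < \<epsilon>}"

text \<open>
  The suprema below are finite on \<open>LC p\<close>, because \<open>norm (f t z) \<le> m t\<close> for \<open>z\<close> in a compact set
  containing all the values involved.
\<close>

definition T_Theta_Theta ::
    "nat \<Rightarrow> moduli \<Rightarrow> moduli \<Rightarrow>
     (real \<Rightarrow> 'x::euclidean_space \<times> 'u::euclidean_space \<Rightarrow> 'w::euclidean_space) topology" where
  "T_Theta_Theta p \<Theta> \<Theta>' = seminorm_topology (LC p)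
     {\<lambda>f. (SUP (x, u)\<in>moduli_functions \<Theta> j a b \<times> moduli_functions \<Theta>' j (a - 1) (b - 1).
            Lp_norm p {a..b} (\<lambda>t. f t (x t, u (t - 1)))) | j a b. a \<in> \<rat> \<and> b \<in> \<rat> \<and> a \<le> b}"

definition T_Theta_D ::
    "nat \<Rightarrow> moduli \<Rightarrow> 'u::euclidean_space set \<Rightarrow>
     (real \<Rightarrow> 'x::euclidean_space \<times> 'u \<Rightarrow> 'w::euclidean_space) topology" where
  "T_Theta_D p \<Theta> D' = seminorm_topology (LC p)
     {\<lambda>f. (SUP x\<in>moduli_functions \<Theta> j a b. Lp_norm p {a..b} (\<lambda>t. f t (x t, u)))
      | j a b u. a \<in> \<rat> \<and> b \<in> \<rat> \<and> a \<le> b \<and> u \<in> D'}"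

definition T_D ::
    "nat \<Rightarrow> 'z::euclidean_space set \<Rightarrow> (real \<Rightarrow> 'z \<Rightarrow> 'w::euclidean_space) topology" where
  "T_D p D = seminorm_topology (LC p)
     {\<lambda>f. Lp_norm p {a..b} (\<lambda>t. f t z) | a b z. a \<in> \<rat> \<and> b \<in> \<rat> \<and> a \<le> b \<and> z \<in> D}"


section \<open>Solutions of the delay differential equation\<close>

text \<open>
  Caratheodory solutions of \<open>x' = f (t, x(t), x(t - 1))\<close> for \<open>t > 0\<close>, \<open>x = \<phi>\<close> on \<open>[-1, 0]\<close>,
  defined on \<open>[-1, b)\<close> with \<open>0 < b \<le> \<infinity>\<close>.
\<close>

definition dde_solution ::
    "(real \<Rightarrow> 'x \<times> 'x \<Rightarrow> 'x) \<Rightarrow> (real \<Rightarrow> 'x) \<Rightarrow> ereal \<Rightarrow> (real \<Rightarrow> 'x::euclidean_space) \<Rightarrow> bool" where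
  "dde_solution f \<phi> b x \<longleftrightarrow>
     0 < b \<and>
     continuous_on {t. - 1 \<le> t \<and> ereal t < b} x \<and>
     (\<forall>t\<in>{- 1..0}. x t = \<phi> t) \<and>
     (\<forall>T\<ge>0. ereal T < b \<longrightarrow> abs_continuous_on_interval 0 T x) \<and>
     (AE t in lebesgue. 0 < t \<and> ereal t < b \<longrightarrow>
        (x has_vector_derivative f t (x t, x (t - 1))) (at t))"

definition maximal_dde_solution ::
    "(real \<Rightarrow> 'x \<times> 'x \<Rightarrow> 'x) \<Rightarrow> (real \<Rightarrow> 'x) \<Rightarrow> ereal \<Rightarrow> (real \<Rightarrow> 'x::euclidean_space) \<Rightarrow> bool" where
  "maximal_dde_solution f \<phi> b x \<longleftrightarrow>
     dde_solution f \<phi> b x \<and>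
     (\<forall>b' x'. dde_solution f \<phi> b' x' \<and> b \<le> b' \<and> (\<forall>t. - 1 \<le> t \<and> ereal t < b \<longrightarrow> x' t = x t)
        \<longrightarrow> b' = b)"

text \<open>
  For \<open>f \<in> LC p\<close> and continuous \<open>\<phi>\<close> the maximal solution exists and is unique on \<open>[-1, b)\<close>.
  The choice operator is needed since values outside this interval are irrelevant.
\<close>

definition dde_end :: "(real \<Rightarrow> 'x \<times> 'x \<Rightarrow> 'x) \<Rightarrow> (real \<Rightarrow> 'x::euclidean_space) \<Rightarrow> ereal" where
  "dde_end f \<phi> = (THE b. \<exists>x. maximal_dde_solution f \<phi> b x)"

definition dde_sol :: "(real \<Rightarrow> 'x \<times> 'x \<Rightarrow> 'x) \<Rightarrow> (real \<Rightarrow> 'x) \<Rightarrow> real \<Rightarrow> 'x::euclidean_space" where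
  "dde_sol f \<phi> = (SOME x. maximal_dde_solution f \<phi> (dde_end f \<phi>) x)"

text \<open>
  Convergence of the solutions in \<open>C1p p 0 T\<close> for every \<open>[0, T]\<close> inside the interval of definition
  of the limit solution, including that the solutions are eventually defined on \<open>[0, T]\<close> and
  that they belong to that space.
\<close>

definition dde_sols_converge ::
    "nat \<Rightarrow> (nat \<Rightarrow> real \<Rightarrow> 'x \<times> 'x \<Rightarrow> 'x) \<Rightarrow> (nat \<Rightarrow> real \<Rightarrow> 'x) \<Rightarrow>
     (real \<Rightarrow> 'x \<times> 'x \<Rightarrow> 'x) \<Rightarrow> (real \<Rightarrow> 'x::euclidean_space) \<Rightarrow> bool" where
  "dde_sols_converge p fs \<phi>s f \<phi> \<longleftrightarrow>
     (\<forall>T\<ge>0. ereal T < dde_end f \<phi> \<longrightarrow>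
        dde_sol f \<phi> \<in> C1p p 0 T \<and>
        (\<forall>\<^sub>F n in sequentially.
           ereal T < dde_end (fs n) (\<phi>s n) \<and> dde_sol (fs n) (\<phi>s n) \<in> C1p p 0 T) \<and>
        (\<lambda>n. C1p_norm p 0 T (\<lambda>t. dde_sol (fs n) (\<phi>s n) t - dde_sol f \<phi> t)) \<longlonglongrightarrow> 0)"

end

theory Submission
  imports Defs
begin

text \<open>
  Write \<open>x\<close> for the limit solution and replace \<open>f\<^sub>n\<close> by its composition with the metric projection onto
  a ball containing the values of \<open>x\<close> in its interior. The solutions \<open>z\<^sub>n\<close> of the truncated equations exist
  globally, and
  \<open>|z\<^sub>n' - x'| \<le> g\<^sub>n + L\<^sub>n (|z\<^sub>n - x|(t) + |z\<^sub>n - x|(t - 1))\<close> with \<open>\<parallel>g\<^sub>n\<parallel>\<^sub>p \<rightarrow> 0\<close> and \<open>\<parallel>L\<^sub>n\<parallel>\<^sub>p\<close> bounded. A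
  Gronwall inequality then gives convergence in \<open>C\<^sup>1\<^sup>,\<^sup>p\<close>; in particular the truncation is eventually inactive.
  With \<open>y\<^sub>n\<close> the projection of \<open>z\<^sub>n\<close>, the three cases differ only in how \<open>f\<^sub>n(t, y\<^sub>n(t), y\<^sub>n(t - 1))\<close> and
  \<open>f(t, x(t), x(t - 1))\<close> are compared. In (i), \<open>g\<^sub>n\<close> is \<open>|f\<^sub>n - f|\<close> along \<open>(y\<^sub>n(t), y\<^sub>n(t - 1))\<close>, a
  curve with the prescribed moduli because \<open>f\<^sub>n \<in> E\<close>, and \<open>L\<^sub>n\<close> is the Lipschitz constant of \<open>f\<close>. In (ii) it is
  \<open>|f\<^sub>n - f|\<close> along \<open>(y\<^sub>n(t), x(t - 1))\<close>, the delayed argument of \<open>f\<^sub>n\<close> being absorbed by its \<open>l\<^sub>2\<close>-bound. In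
  (iii) it is \<open>|f\<^sub>n - f|\<close> along \<open>(x(t), x(t - 1))\<close>, with the \<open>l\<close>-bound of \<open>f\<^sub>n\<close> as Lipschitz constant. In
  the last two cases \<open>x\<close> is replaced by step functions with values in the dense set.
\<close>

section \<open>Absolutely continuous functions and their derivatives\<close>

text \<open>No bound of \<open>E\<close> is assumed for the limit \<open>f\<close>, and this decides
  which curve each case can use. In (i) the Lipschitz constants of the approximating functions are
  not uniformly bounded, so only the fixed constant of \<open>f\<close> can absorb the error and the
  difference must be taken along a curve that moves with \<open>n\<close>. A seminorm that is a
  supremum over curves tolerates this, provided the moving curve has the prescribed moduli: its
  increments are integrals of a member of \<open>E\<close>, hence controlled by an m-bound. In (ii)
  the seminorms freeze the second argument at a constant, so the delayed curve has to be fixed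
  before it can be replaced by steps. In (iii) no common modulus is at hand, and both arguments have
  to be fixed. The number 4 in the exponential weights comes from the two arguments of the
  right-hand side, present and delayed: they give a factor 2, and the exponent 4 turns it into
  1/2.\<close>

lemma AE_lebesgueE:
  assumes "AE t in lebesgue. P t"
  obtains N where "negligible N" "\<And>t. t \<notin> N \<Longrightarrow> P t"
  using assms unfolding eventually_ae_filter_negligible by blast

lemma AE_lebesgueI:
  assumes "negligible N" "\<And>t. t \<notin> N \<Longrightarrow> P t"
  shows "AE t in lebesgue. P t"
  unfolding eventually_ae_filter_negligible using assms by blast

lemma integral_norm_bound_AE:
  fixes f :: "'a::euclidean_space \<Rightarrow> 'b::euclidean_space"
  assumes f: "f integrable_on S" and g: "g integrable_on S"
    and ae: "AE x in lebesgue. x \<in> S \<longrightarrow> norm (f x) \<le> g x"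
  shows "norm (integral S f) \<le> integral S g"
proof -
  obtain N where N: "negligible N" "\<And>x. x \<notin> N \<Longrightarrow> x \<in> S \<longrightarrow> norm (f x) \<le> g x"
    using AE_lebesgueE[OF ae] by blast
  define f' where "f' x = (if x \<in> N then 0 else f x)" for x
  define g' where "g' x = (if x \<in> N then 0 else g x)" for x
  have "integral S f = integral S f'" "integral S g = integral S g'"
    by (rule integral_spike[OF N(1)], simp add: f'_def g'_def)+
  moreover have "f' integrable_on S"
    by (rule integrable_spike[OF f N(1)]) (simp add: f'_def)
  moreover have "g' integrable_on S"
    by (rule integrable_spike[OF g N(1)]) (simp add: g'_def)
  moreover have "norm (f' x) \<le> g' x" if "x \<in> S" for x
    using N(2)[of x] that by (auto simp: f'_def g'_def)
  ultimately show ?thesis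
    by (simp add: integral_norm_bound_integral)
qed

lemma integral_le_AE:
  fixes f g :: "'a::euclidean_space \<Rightarrow> real"
  assumes f: "f integrable_on S" and g: "g integrable_on S"
    and ae: "AE x in lebesgue. x \<in> S \<longrightarrow> f x \<le> g x"
  shows "integral S f \<le> integral S g"
proof -
  have "norm (integral S (\<lambda>x. 0 :: real)) \<le> integral S (\<lambda>x. g x - f x)"
    by (intro integral_norm_bound_AE integrable_diff integrable_0 f g) (use ae in \<open>auto elim: eventually_mono\<close>)
  then show ?thesis by (simp add: Henstock_Kurzweil_Integration.integral_diff f g)
qed

text \<open>In one dimension the lengths of a division add up to the measure of its union. This
  turns an open cover of small measure into the smallness condition in the definition of absolute
  continuity.\<close>

lemma sum_length_division_le:
  fixes U :: "real set"
  assumes "\<D> division_of S" "S \<subseteq> U" "U \<in> lmeasurable"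
  shows "(\<Sum>K\<in>\<D>. Sup K - Inf K) \<le> measure lebesgue U"
proof -
  have "(\<Sum>K\<in>\<D>. Sup K - Inf K) = (\<Sum>K\<in>\<D>. measure lebesgue K)"
  proof (rule sum.cong[OF refl])
    fix K assume "K \<in> \<D>"
    then obtain u v where "K = cbox u v" "K \<noteq> {}"
      using division_ofD(3,4)[OF assms(1)] by blast
    then show "Sup K - Inf K = measure lebesgue K" by auto
  qed
  also have "\<dots> = measure lebesgue S"
    using content_division[OF assms(1)] by simp
  also have "\<dots> \<le> measure lebesgue U"
    using assms by (intro measure_mono_fmeasurable) (auto simp: fmeasurableD lmeasurable_division)
  finally show ?thesis .
qed

lemma abs_continuous_on_interval_subset:
  "\<lbrakk>abs_continuous_on_interval a b x; {c..d} \<subseteq> {a..b}\<rbrakk> \<Longrightarrow> abs_continuous_on_interval c d x"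
  unfolding abs_continuous_on_interval_def by (meson order_trans)

text \<open>
  The exceptional null set is covered by an open set of small measure, and absolute continuity
  bounds the increments of \<open>x\<close> over the part of a fine division tagged in it.
\<close>

lemma abs_continuous_has_integral:
  fixes x :: "real \<Rightarrow> 'w::euclidean_space"
  assumes "a \<le> b" and ac: "abs_continuous_on_interval a b x" and N: "negligible N"
    and der: "\<And>t. t \<in> {a..b} - N \<Longrightarrow> (x has_vector_derivative g t) (at t within {a..b})"
  shows "(g has_integral (x b - x a)) {a..b}"
proof -
  \<comment> \<open>Resetting the derivative to 0 on \<open>N\<close> changes no integral, and an
    interval tagged in \<open>N\<close> then contributes only its increment of
    \<open>x\<close>.\<close>
  define h where "h t = (if t \<in> N then 0 else g t)" for t
  have "(h has_integral (x b - x a)) (cbox a b)"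
    unfolding has_integral
  proof (intro allI impI)
    fix e :: real assume "e > 0"
    \<comment> \<open>The \<open>+ 1\<close> gives the strict bound
      \<open>e1 * (b - a) < e / 2\<close> and covers \<open>a = b\<close>.\<close>
    define e1 where "e1 = e / 2 / (b - a + 1)"
    have e1: "e1 > 0" "e1 * (b - a) < e / 2"
      using \<open>e > 0\<close> \<open>a \<le> b\<close> by (auto simp: e1_def field_simps)
    obtain \<delta> where \<delta>: "\<delta> > 0" "\<And>\<D> S. \<D> division_of S \<Longrightarrow> S \<subseteq> {a..b} \<Longrightarrow>
        (\<Sum>k\<in>\<D>. Sup k - Inf k) < \<delta> \<Longrightarrow> (\<Sum>k\<in>\<D>. norm (x (Sup k) - x (Inf k))) < e / 2"
      using ac \<open>e > 0\<close> unfolding abs_continuous_on_interval_def by (metis half_gt_zero)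
    have Nnull: "N \<in> null_sets lebesgue" using N negligible_iff_null_sets by blast
    obtain U where U: "open U" "N \<subseteq> U" "U \<in> lmeasurable" "measure lebesgue U < \<delta>"
    proof -
      obtain U where U: "open U" "N \<subseteq> U" "(U - N) \<in> lmeasurable" "emeasure lebesgue (U - N) < ennreal \<delta>"
        using sets_lebesgue_outer_open[OF _ \<delta>(1), of N] Nnull by blast
      have UN: "U = (U - N) \<union> N" using U(2) by blast
      have 1: "U \<in> lmeasurable"
        by (subst UN) (intro fmeasurable.Un U(3) negligible_imp_measurable N)
      have "measure lebesgue U \<le> measure lebesgue (U - N) + measure lebesgue N"
        by (metis UN U(3) N measure_Un_le fmeasurableD negligible_imp_measurable)
      also have "measure lebesgue N = 0" using N by (simp add: negligible_imp_measure0)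
      also have "measure lebesgue (U - N) < \<delta>"
        using U(3,4) \<delta>(1) by (simp add: emeasure_eq_measure2 ennreal_less_iff)
      finally show ?thesis using that U 1 by simp
    qed
    have "\<exists>d>0. t \<in> {a..b} - N \<longrightarrow> (\<forall>y\<in>{a..b}. norm (y - t) < d \<longrightarrow>
        norm (x y - x t - (y - t) *\<^sub>R g t) \<le> e1 * norm (y - t))" for t
      using der[of t] e1(1) unfolding has_vector_derivative_def has_derivative_within_alt
      by (cases "t \<in> {a..b} - N") (auto intro: exI[of _ 1])
    then obtain d where d: "\<And>t. d t > 0" "\<And>t y. t \<in> {a..b} - N \<Longrightarrow> y\<in>{a..b} \<Longrightarrow> norm (y - t) < d t \<Longrightarrow>
        norm (x y - x t - (y - t) *\<^sub>R g t) \<le> e1 * norm (y - t)"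
      by metis
    \<comment> \<open>Intervals tagged in \<open>N\<close> lie in \<open>U\<close>, so their total
      length is below \<open>\<delta>\<close>; on the others \<open>x\<close> is nearly
      affine.\<close>
    define \<gamma> where "\<gamma> t = (if t \<in> N then U else ball t (d t))" for t
    have gauge: "gauge \<gamma>"
      unfolding gauge_def \<gamma>_def using U d by auto
    have main: "norm ((\<Sum>(t, K)\<in>p. measure lborel K *\<^sub>R h t) - (x b - x a)) < e"
      if p: "p tagged_division_of cbox a b" and fine: "\<gamma> fine p" for p
    proof -
      have fin: "finite p" using p by blast
      define p1 where "p1 = {(t, K) \<in> p. t \<in> N}"
      have p1p: "p1 \<subseteq> p" unfolding p1_def by blast
      have inc: "x b - x a = (\<Sum>(t, K)\<in>p. x (Sup K) - x (Inf K))"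
        using additive_tagged_division_1[OF \<open>a \<le> b\<close>, of p x] p by simp
      have len: "b - a = (\<Sum>(t, K)\<in>p. Sup K - Inf K)"
        using additive_tagged_division_1[OF \<open>a \<le> b\<close>, of p "\<lambda>x. x"] p by simp
      have K: "\<exists>u v. K = {u..v} \<and> a \<le> u \<and> u \<le> t \<and> t \<le> v \<and> v \<le> b" if "(t, K) \<in> p" for t K
      proof -
        obtain u v where "K = cbox u v" "t \<in> K" "K \<subseteq> cbox a b"
          using tagged_division_ofD(2-4)[OF p \<open>(t, K) \<in> p\<close>] by metis
        then show ?thesis by auto
      qed
      have ne: "K \<noteq> {}" if "(t, K) \<in> p1" for t K
        using K[of t K] p1p that by force
      have "norm ((\<Sum>(t, K)\<in>p. measure lborel K *\<^sub>R h t) - (x b - x a))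
          = norm (\<Sum>(t, K)\<in>p. measure lborel K *\<^sub>R h t - (x (Sup K) - x (Inf K)))"
        unfolding inc by (simp add: sum_subtractf split_def)
      also have "\<dots> \<le> (\<Sum>(t, K)\<in>p. norm (measure lborel K *\<^sub>R h t - (x (Sup K) - x (Inf K))))"
        by (simp add: split_def norm_sum)
      also have "\<dots> = (\<Sum>(t, K)\<in>p - p1. norm (measure lborel K *\<^sub>R h t - (x (Sup K) - x (Inf K)))) +
          (\<Sum>(t, K)\<in>p1. norm (measure lborel K *\<^sub>R h t - (x (Sup K) - x (Inf K))))"
        using sum.subset_diff[OF p1p fin] by blast
      also have "(\<Sum>(t, K)\<in>p - p1. norm (measure lborel K *\<^sub>R h t - (x (Sup K) - x (Inf K)))) \<le>
          (\<Sum>(t, K)\<in>p - p1. e1 * (Sup K - Inf K))"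
      proof (rule sum_mono, safe)
        fix t K assume tK: "(t, K) \<in> p" "(t, K) \<notin> p1"
        then have tN: "t \<notin> N" unfolding p1_def by blast
        obtain u v where uv: "K = {u..v}" "a \<le> u" "u \<le> t" "t \<le> v" "v \<le> b" using K[OF tK(1)] by blast
        have "K \<subseteq> ball t (d t)" using fineD[OF fine tK(1)] tN by (simp add: \<gamma>_def)
        moreover have "u \<in> K" "v \<in> K" using uv by auto
        ultimately have "u \<in> ball t (d t)" "v \<in> ball t (d t)" by blast+
        then have "norm (u - t) < d t" "norm (v - t) < d t" by (auto simp: dist_norm norm_minus_commute)
        then have "norm (x u - x t - (u - t) *\<^sub>R g t) \<le> e1 * norm (u - t)"
          "norm (x v - x t - (v - t) *\<^sub>R g t) \<le> e1 * norm (v - t)"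
          using d(2)[of t u] d(2)[of t v] uv tN by auto
        \<comment> \<open>The tag lies between the end points, so the two errors add up to exactly
          \<open>e1 * (v - u)\<close>.\<close>
        then have "norm ((x u - x t - (u - t) *\<^sub>R g t) - (x v - x t - (v - t) *\<^sub>R g t))
            \<le> e1 * norm (u - t) + e1 * norm (v - t)"
          by (meson norm_triangle_ineq4 add_mono order_trans)
        also have "\<dots> = e1 * (v - u)" using uv by (simp add: algebra_simps)
        finally have "norm ((v - u) *\<^sub>R g t - (x v - x u)) \<le> e1 * (v - u)"
          by (simp add: algebra_simps)
        then show "norm (measure lborel K *\<^sub>R h t - (x (Sup K) - x (Inf K))) \<le> e1 * (Sup K - Inf K)"
          using uv tN by (simp add: h_def)
      qed
      also have "(\<Sum>(t, K)\<in>p - p1. e1 * (Sup K - Inf K)) \<le> (\<Sum>(t, K)\<in>p. e1 * (Sup K - Inf K))"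
      proof (rule sum_mono2[OF fin])
        fix tK assume "tK \<in> p - (p - p1)"
        then obtain t K where tK: "tK = (t, K)" "(t, K) \<in> p" by (cases tK) auto
        then obtain u v where "K = {u..v}" "u \<le> v" using K by force
        then show "0 \<le> (case tK of (t, K) \<Rightarrow> e1 * (Sup K - Inf K))" using tK e1 by simp
      qed auto
      also have "\<dots> = e1 * (b - a)" unfolding len by (simp add: sum_distrib_left split_def)
      also have "\<dots> < e / 2" by (rule e1)
      also have "(\<Sum>(t, K)\<in>p1. norm (measure lborel K *\<^sub>R h t - (x (Sup K) - x (Inf K))))
          = (\<Sum>(t, K)\<in>p1. norm (x (Sup K) - x (Inf K)))"
        by (rule sum.cong) (auto simp: p1_def h_def norm_minus_commute)
      \<comment> \<open>Absolute continuity speaks of divisions without tags. Passing to the set of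
        intervals needs a summand that vanishes on boxes with empty interior, while
        \<open>Sup {}\<close> and \<open>Inf {}\<close> are unspecified; hence the case
        distinction.\<close>
      also have "\<dots> = (\<Sum>(t, K)\<in>p1. if K = {} then 0 else norm (x (Sup K) - x (Inf K)))"
        by (rule sum.cong[OF refl]) (auto dest: ne)
      also have "\<dots> = (\<Sum>K\<in>snd ` p1. if K = {} then 0 else norm (x (Sup K) - x (Inf K)))"
      proof (rule sum.over_tagged_division_lemma)
        have "p tagged_partial_division_of cbox a b" using p by (simp add: tagged_division_of_def)
        then show "p1 tagged_division_of \<Union> (snd ` p1)"
          by (meson tagged_partial_division_of_Union_self tagged_partial_division_subset p1p)
      next
        fix u v :: real assume "box u v = {}"
        then have "v \<le> u" by auto
        then show "(if cbox u v = {} then 0 else norm (x (Sup (cbox u v)) - x (Inf (cbox u v)))) = 0"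
          by (cases "u = v") auto
      qed
      also have "\<dots> = (\<Sum>K\<in>snd ` p1. norm (x (Sup K) - x (Inf K)))"
        by (rule sum.cong[OF refl]) (auto dest: ne)
      also have "\<dots> < e / 2"
      proof (rule \<delta>(2))
        have "p tagged_partial_division_of cbox a b" using p by (simp add: tagged_division_of_def)
        then show div: "(snd ` p1) division_of \<Union> (snd ` p1)"
          by (meson partial_division_of_tagged_division tagged_partial_division_subset p1p)
        show "\<Union> (snd ` p1) \<subseteq> {a..b}"
        proof
          fix s assume "s \<in> \<Union> (snd ` p1)"
          then obtain t K where tK: "(t, K) \<in> p1" "s \<in> K" by auto
          then have "(t, K) \<in> p" using p1p by blast
          from tagged_division_ofD(3)[OF p this] show "s \<in> {a..b}" using tK(2) by auto
        qed
        have "\<Union> (snd ` p1) \<subseteq> U"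
        proof
          fix s assume "s \<in> \<Union> (snd ` p1)"
          then obtain t K where tK: "(t, K) \<in> p1" "s \<in> K" by auto
          then have "(t, K) \<in> p" "t \<in> N" by (auto simp: p1_def)
          with fineD[OF fine] tK(2) show "s \<in> U" by (force simp: \<gamma>_def)
        qed
        then show "(\<Sum>k\<in>snd ` p1. Sup k - Inf k) < \<delta>"
          using sum_length_division_le[OF div _ U(3)] U(4) by linarith
      qed
      finally show ?thesis by simp
    qed
    show "\<exists>\<gamma>. gauge \<gamma> \<and> (\<forall>\<D>. \<D> tagged_division_of cbox a b \<and> \<gamma> fine \<D> \<longrightarrow>
            norm ((\<Sum>(x, k)\<in>\<D>. measure lborel k *\<^sub>R h x) - (x b - x a)) < e)"
      by (intro exI[of _ \<gamma>] conjI gauge allI impI) (elim conjE, rule main)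
  qed
  then have "(h has_integral (x b - x a)) {a..b}" by simp
  then show ?thesis
    by (rule has_integral_spike[OF N, rotated]) (auto simp: h_def)
qed

text \<open>Serves to preserve absolute continuity under \<open>exp\<close>, which is Lipschitz on
  sets that are bounded above.\<close>

lemma abs_continuous_on_interval_compose:
  assumes "abs_continuous_on_interval a b x" "C \<ge> 0"
    and lip: "\<And>s t. \<lbrakk>s \<in> {a..b}; t \<in> {a..b}\<rbrakk> \<Longrightarrow> norm (y t - y s) \<le> C * norm (x t - x s)"
  shows "abs_continuous_on_interval a b y"
  unfolding abs_continuous_on_interval_def
proof (intro allI impI)
  fix e :: real assume "e > 0"
  then have "e / (C + 1) > 0" using assms(2) by simp
  then obtain \<delta> where \<delta>: "\<delta> > 0" "\<And>\<D> S. \<D> division_of S \<Longrightarrow> S \<subseteq> {a..b} \<Longrightarrow>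
        (\<Sum>k\<in>\<D>. Sup k - Inf k) < \<delta> \<Longrightarrow> (\<Sum>k\<in>\<D>. norm (x (Sup k) - x (Inf k))) < e / (C + 1)"
    using assms(1) unfolding abs_continuous_on_interval_def by metis
  have "(\<Sum>k\<in>\<D>. norm (y (Sup k) - y (Inf k))) < e"
    if \<D>: "\<D> division_of S" "S \<subseteq> {a..b}" "(\<Sum>k\<in>\<D>. Sup k - Inf k) < \<delta>" for \<D> S
  proof -
    have "(\<Sum>k\<in>\<D>. norm (y (Sup k) - y (Inf k))) \<le> (\<Sum>k\<in>\<D>. C * norm (x (Sup k) - x (Inf k)))"
    proof (rule sum_mono)
      fix K assume K: "K \<in> \<D>"
      then obtain u v where "K = cbox u v" "K \<noteq> {}" "K \<subseteq> {a..b}"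
        using division_ofD(2,3,4)[OF \<D>(1)] \<D>(2) by blast
      then show "norm (y (Sup K) - y (Inf K)) \<le> C * norm (x (Sup K) - x (Inf K))"
        by (auto intro!: lip)
    qed
    also have "\<dots> \<le> C * (e / (C + 1))"
      unfolding sum_distrib_left[symmetric] using \<delta>(2)[OF \<D>] assms(2)
      by (intro mult_left_mono) auto
    also have "\<dots> < e" using assms(2) \<open>e > 0\<close> by (simp add: field_simps)
    finally show ?thesis .
  qed
  then show "\<exists>\<delta>>0. \<forall>\<D> S. \<D> division_of S \<and> S \<subseteq> {a..b} \<and> (\<Sum>k\<in>\<D>. Sup k - Inf k) < \<delta> \<longrightarrow>
        (\<Sum>k\<in>\<D>. norm (y (Sup k) - y (Inf k))) < e"
    using \<delta>(1) by blast
qed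

lemma integral_increment:
  fixes g :: "real \<Rightarrow> 'w::euclidean_space"
  assumes g: "g integrable_on {a..b}"
    and x: "\<And>t. t \<in> {a..b} \<Longrightarrow> x t = c + integral {a..t} g"
    and uv: "a \<le> u" "u \<le> v" "v \<le> b"
  shows "x v - x u = integral {u..v} g"
proof -
  have "g integrable_on {a..v}" using g uv by (rule_tac integrable_on_subinterval[OF g]) auto
  from Henstock_Kurzweil_Integration.integral_combine[OF uv(1,2) this]
  have "integral {a..v} g = integral {a..u} g + integral {u..v} g" by simp
  then show ?thesis using x[of u] x[of v] uv by simp
qed

text \<open>The integrand is cut at height \<open>k\<close>: the excess \<open>h k\<close> has small
  integral by dominated convergence, while the part below \<open>k\<close> contributes at most
  \<open>k\<close> times the total length of the division.\<close>

lemma indefinite_integral_abs_continuous: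
  fixes g :: "real \<Rightarrow> 'w::euclidean_space"
  assumes g: "g absolutely_integrable_on {a..b}"
    and x: "\<And>t. t \<in> {a..b} \<Longrightarrow> x t = c + integral {a..t} g"
  shows "abs_continuous_on_interval a b x"
  unfolding abs_continuous_on_interval_def
proof (intro allI impI)
  fix e :: real assume "e > 0"
  have ng: "(\<lambda>t. norm (g t)) absolutely_integrable_on {a..b}"
    using absolutely_integrable_norm[OF g] by (simp add: o_def)
  have gi: "g integrable_on {a..b}" and ngi: "(\<lambda>t. norm (g t)) integrable_on {a..b}"
    using g by (auto simp: absolutely_integrable_on_def)
  define h where "h k t = max (norm (g t) - real k) 0" for k :: nat and t
  have hi: "h k integrable_on {a..b}" for k
  proof -
    have "h k absolutely_integrable_on {a..b}"
      unfolding h_def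
      by (intro absolutely_integrable_max_1 set_integral_diff(1) ng
          absolutely_integrable_continuous_real continuous_intros)
    then show ?thesis by (simp add: absolutely_integrable_on_def)
  qed
  have "(\<lambda>k. integral {a..b} (h k)) \<longlonglongrightarrow> integral {a..b} (\<lambda>t. 0)"
  proof (rule Equivalence_Lebesgue_Henstock_Integration.dominated_convergence(2)[OF hi ngi])
    fix t
    obtain K :: nat where "norm (g t) \<le> real K" using real_arch_simple by blast
    then have "\<forall>k\<ge>K. h k t = 0" by (auto simp: h_def)
    then have "\<forall>\<^sub>F k in sequentially. h k t = 0" unfolding eventually_sequentially by blast
    then show "(\<lambda>k. h k t) \<longlonglongrightarrow> 0" by (rule tendsto_eventually)
  qed (auto simp: h_def)
  then have "(\<lambda>k. integral {a..b} (h k)) \<longlonglongrightarrow> 0" by simp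
  then have "\<forall>\<^sub>F k in sequentially. integral {a..b} (h k) < e / 2"
    using \<open>e > 0\<close> by (intro order_tendstoD(2)) auto
  then obtain k where k: "integral {a..b} (h k) < e / 2"
    using eventually_sequentially by auto
  define \<delta> where "\<delta> = e / 2 / (real k + 1)"
  have "\<delta> > 0" using \<open>e > 0\<close> by (simp add: \<delta>_def)
  moreover have "(\<Sum>K\<in>\<D>. norm (x (Sup K) - x (Inf K))) < e"
    if \<D>: "\<D> division_of S" "S \<subseteq> {a..b}" "(\<Sum>K\<in>\<D>. Sup K - Inf K) < \<delta>" for \<D> S
  proof -
    have Klen: "\<exists>u v. K = {u..v} \<and> a \<le> u \<and> u \<le> v \<and> v \<le> b" if "K \<in> \<D>" for K
    proof -
      obtain u v where "K = cbox u v" "K \<noteq> {}" "K \<subseteq> {a..b}"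
        using division_ofD(2,3,4)[OF \<D>(1) \<open>K \<in> \<D>\<close>] \<D>(2) by blast
      then show ?thesis by auto
    qed
    have "(\<Sum>K\<in>\<D>. norm (x (Sup K) - x (Inf K))) \<le> (\<Sum>K\<in>\<D>. integral K (h k) + real k * (Sup K - Inf K))"
    proof (rule sum_mono)
      fix K assume "K \<in> \<D>"
      then obtain u v where uv: "K = {u..v}" "a \<le> u" "u \<le> v" "v \<le> b" using Klen by blast
      have sub: "{u..v} \<subseteq> {a..b}" using uv by auto
      have "x v - x u = integral {u..v} g"
        using integral_increment[OF gi x uv(2,3,4)] by blast
      also have "norm \<dots> \<le> integral {u..v} (\<lambda>t. h k t + real k)"
      proof (rule Henstock_Kurzweil_Integration.integral_norm_bound_integral)
        show "g integrable_on {u..v}" by (rule integrable_on_subinterval[OF gi sub])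
        show "(\<lambda>t. h k t + real k) integrable_on {u..v}"
          by (intro integrable_add integrable_on_subinterval[OF hi sub]) auto
      qed (auto simp: h_def)
      also have "\<dots> = integral {u..v} (h k) + real k * (v - u)"
        using uv by (subst Henstock_Kurzweil_Integration.integral_add)
          (auto intro!: integrable_on_subinterval[OF hi sub])
      finally show "norm (x (Sup K) - x (Inf K)) \<le> integral K (h k) + real k * (Sup K - Inf K)"
        using uv by simp
    qed
    also have "\<dots> = (\<Sum>K\<in>\<D>. integral K (h k)) + real k * (\<Sum>K\<in>\<D>. Sup K - Inf K)"
      by (simp add: sum.distrib sum_distrib_left)
    also have "(\<Sum>K\<in>\<D>. integral K (h k)) = integral S (h k)"
    proof (rule integral_combine_division_topdown[OF _ \<D>(1), symmetric])
      show "h k integrable_on S" using integrable_on_subdivision[OF \<D>(1) hi \<D>(2)] .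
    qed
    also have "integral S (h k) \<le> integral {a..b} (h k)"
    proof (rule integral_subset_le[OF \<D>(2) _ hi])
      show "h k integrable_on S" using integrable_on_subdivision[OF \<D>(1) hi \<D>(2)] .
    qed (auto simp: h_def)
    also have "real k * (\<Sum>K\<in>\<D>. Sup K - Inf K) \<le> real k * \<delta>"
      using \<D>(3) by (intro mult_left_mono) auto
    also have "real k * \<delta> \<le> e / 2" using \<open>e > 0\<close> by (simp add: \<delta>_def field_simps)
    finally show ?thesis using k by linarith
  qed
  ultimately show "\<exists>\<delta>>0. \<forall>\<D> S. \<D> division_of S \<and> S \<subseteq> {a..b} \<and> (\<Sum>k\<in>\<D>. Sup k - Inf k) < \<delta> \<longrightarrow>
        (\<Sum>k\<in>\<D>. norm (x (Sup k) - x (Inf k))) < e"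
    by blast
qed

text \<open>
  The library only states the one-sided Lebesgue differentiation theorem; the left-hand
  derivatives are obtained by reflecting the integrand.
\<close>

lemma indefinite_integral_AE_derivative:
  fixes g :: "real \<Rightarrow> 'w::euclidean_space"
  assumes g: "g integrable_on {a..b}"
    and x: "\<And>t. t \<in> {a..b} \<Longrightarrow> x t = c + integral {a..t} g"
  shows "AE t in lebesgue. t \<in> {a<..<b} \<longrightarrow> (x has_vector_derivative g t) (at t)"
proof -
  \<comment> \<open>Extension by 0 makes the integrand integrable on every interval, as the
    differentiation theorem on the whole line requires.\<close>
  define G where "G t = (if t \<in> {a..b} then g t else 0)" for t
  have Gi: "G integrable_on {u..v}" for u v
  proof -
    have "g integrable_on ({a..b} \<inter> {u..v})"
      by (simp add: integrable_on_subinterval[OF g])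
    then show ?thesis unfolding G_def integrable_restrict_Int .
  qed
  have Gi': "(\<lambda>t. G (- t)) integrable_on {u..v}" for u v
    using Henstock_Kurzweil_Integration.integrable_reflect_real[of G "-u" "-v"] Gi[of "-v" "-u"] by simp
  obtain N1 where N1: "negligible N1" "\<And>x e. \<lbrakk>x \<notin> N1; 0 < e\<rbrakk> \<Longrightarrow>
       \<exists>d>0. \<forall>h. 0 < h \<and> h < d \<longrightarrow> norm (integral {x..x + h} G /\<^sub>R h - G x) < e"
    using integrable_ccontinuous_explicit[of G] Gi by auto
  obtain N2 where N2: "negligible N2" "\<And>x e. \<lbrakk>x \<notin> N2; 0 < e\<rbrakk> \<Longrightarrow>
       \<exists>d>0. \<forall>h. 0 < h \<and> h < d \<longrightarrow> norm (integral {x..x + h} (\<lambda>t. G (- t)) /\<^sub>R h - G (- x)) < e"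
    using integrable_ccontinuous_explicit[of "\<lambda>t. G (- t)"] Gi' by auto
  show ?thesis
  proof (rule AE_lebesgueI)
    show "negligible (N1 \<union> uminus ` N2)"
      by (intro negligible_Un N1(1) negligible_differentiable_image_negligible[OF order_refl N2(1)]
          linear_imp_differentiable_on linear_uminus)
    fix t assume t: "t \<notin> N1 \<union> uminus ` N2"
    then have tN: "t \<notin> N1" "- t \<notin> N2" by (auto simp: image_iff)
    show "t \<in> {a<..<b} \<longrightarrow> (x has_vector_derivative g t) (at t)"
      unfolding has_vector_derivative_def has_derivative_at_alt
    proof (intro impI conjI allI)
      assume tab: "t \<in> {a<..<b}"
      fix e :: real assume "e > 0"
      obtain d1 where d1: "d1 > 0" "\<And>h. 0 < h \<Longrightarrow> h < d1 \<Longrightarrow> norm (integral {t..t + h} G /\<^sub>R h - G t) < e"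
        using N1(2)[OF tN(1) \<open>e > 0\<close>] by blast
      obtain d2 where d2: "d2 > 0" "\<And>h. 0 < h \<Longrightarrow> h < d2 \<Longrightarrow>
          norm (integral {-t..-t + h} (\<lambda>t. G (- t)) /\<^sub>R h - G t) < e"
        using N2(2)[OF tN(2) \<open>e > 0\<close>] by auto
      \<comment> \<open>The last two terms keep \<open>y\<close> inside \<open>{a..b}\<close>, where
        \<open>x\<close> is given by the integral.\<close>
      define d where "d = min (min d1 d2) (min (t - a) (b - t))"
      have Gt: "G t = g t" using tab by (simp add: G_def)
      have Gg: "integral {u..v} G = integral {u..v} g" if "a \<le> u" "v \<le> b" for u v
        using that by (intro Henstock_Kurzweil_Integration.integral_cong) (auto simp: G_def)
      have scale: "norm (I - h *\<^sub>R w) \<le> e * h" if "0 < h" "norm (I /\<^sub>R h - w) < e" for I w :: 'w and h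
      proof -
        have "I - h *\<^sub>R w = h *\<^sub>R (I /\<^sub>R h - w)" using that by (simp add: algebra_simps)
        then have "norm (I - h *\<^sub>R w) = h * norm (I /\<^sub>R h - w)" using that by simp
        then show ?thesis using that by (simp add: mult.commute less_imp_le)
      qed
      have "norm (x y - x t - (y - t) *\<^sub>R g t) \<le> e * norm (y - t)" if y: "norm (y - t) < d" for y
      proof -
        consider "y = t" | "y > t" | "y < t" by linarith
        then show ?thesis
        proof cases
          case 1 then show ?thesis by simp
        next
          case 2
          then have "x y - x t = integral {t..t + (y - t)} G"
            using integral_increment[OF g x, of t y] y tab by (simp add: d_def Gg)
          moreover have "norm (integral {t..t + (y - t)} G /\<^sub>R (y - t) - g t) < e"
            using 2 y d1(2)[of "y - t"] Gt by (simp add: d_def)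
          ultimately show ?thesis using scale[of "y - t" "x y - x t" "g t"] 2 by simp
        next
          case 3
          then have "x t - x y = integral {y..t} G"
            using integral_increment[OF g x, of y t] y tab by (simp add: d_def Gg)
          also have "\<dots> = integral {-t..-t + (t - y)} (\<lambda>t. G (- t))"
            using Henstock_Kurzweil_Integration.integral_reflect_real[of t y G] by simp
          finally have xx: "x t - x y = integral {-t..-t + (t - y)} (\<lambda>t. G (- t))" .
          have "norm (integral {-t..-t + (t - y)} (\<lambda>t. G (- t)) /\<^sub>R (t - y) - g t) < e"
            using 3 y d2(2)[of "t - y"] Gt by (simp add: d_def)
          then have "norm ((x t - x y) - (t - y) *\<^sub>R g t) \<le> e * (t - y)"
            using scale[of "t - y" "x t - x y" "g t"] 3 xx by simp
          moreover have "(x y - x t) - (y - t) *\<^sub>R g t = - ((x t - x y) - (t - y) *\<^sub>R g t)"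
            by (simp add: algebra_simps)
          ultimately show ?thesis using 3 by (metis norm_minus_cancel abs_of_pos diff_gt_0_iff_gt norm_minus_commute real_norm_def)
        qed
      qed
      moreover have "d > 0" using d1 d2 tab by (simp add: d_def)
      ultimately show "\<exists>d>0. \<forall>y. norm (y - t) < d \<longrightarrow> norm (x y - x t - (y - t) *\<^sub>R g t) \<le> e * norm (y - t)"
        by blast
    qed (simp add: bounded_linear_scaleR_left)
  qed
qed

section \<open>Exponentials of indefinite integrals\<close>

lemma exp_lipschitz_on_bounded:
  fixes u v :: real
  assumes "u \<le> B" "v \<le> B"
  shows "\<bar>exp u - exp v\<bar> \<le> exp B * \<bar>u - v\<bar>"
proof -
  have *: "exp v - exp u \<le> exp B * (v - u)" if "u \<le> v" "v \<le> B" for u v :: real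
  proof -
    have "exp v * (1 + (u - v)) \<le> exp v * exp (u - v)"
      by (intro mult_left_mono exp_ge_add_one_self) auto
    also have "\<dots> = exp u" by (simp add: exp_add[symmetric])
    finally have "exp v - exp u \<le> exp v * (v - u)" by (simp add: algebra_simps)
    also have "\<dots> \<le> exp B * (v - u)" using that by (intro mult_right_mono) auto
    finally show ?thesis .
  qed
  show ?thesis
    using *[of u v] *[of v u] assms by (cases "u \<le> v") (auto simp: abs_if algebra_simps)
qed

text \<open>Because \<open>L\<close> is merely integrable, the exponential is differentiable only
  almost everywhere: the chain rule holds where the indefinite integral has derivative
  \<open>L\<close>, and absolute continuity recovers the integral. Both the Gronwall inequality and
  the contraction argument integrate \<open>L\<close> against this weight.\<close>

lemma has_integral_exp_primitive:
  fixes L :: "real \<Rightarrow> real"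
  assumes L: "L integrable_on {0..T}" "\<And>t. t \<in> {0..T} \<Longrightarrow> 0 \<le> L t"
    and "0 < c" "t \<in> {0..T}"
  shows "((\<lambda>s. L s * exp (c * integral {0..s} L)) has_integral ((exp (c * integral {0..t} L) - 1) / c)) {0..t}"
proof -
  define \<Lambda> where "\<Lambda> s = integral {0..s} L" for s
  have La: "L absolutely_integrable_on {0..T}"
    using L(1) absolutely_integrable_on_iff_nonneg[of "{0..T}" L] L(2) by blast
  have ac: "abs_continuous_on_interval 0 T \<Lambda>"
    by (rule indefinite_integral_abs_continuous[OF La, of _ 0]) (simp add: \<Lambda>_def)
  have \<Lambda>T: "\<Lambda> s \<le> \<Lambda> T" if "s \<in> {0..T}" for s
    unfolding \<Lambda>_def using that L by (intro integral_subset_le integrable_on_subinterval[OF L(1)]) auto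
  define y where "y s = exp (c * \<Lambda> s) / c" for s
  have "abs_continuous_on_interval 0 T y"
  proof (rule abs_continuous_on_interval_compose[OF ac, of "exp (c * \<Lambda> T)"])
    fix s t assume st: "s \<in> {0..T}" "t \<in> {0..T}"
    have "\<bar>exp (c * \<Lambda> t) - exp (c * \<Lambda> s)\<bar> \<le> exp (c * \<Lambda> T) * \<bar>c * \<Lambda> t - c * \<Lambda> s\<bar>"
      using \<Lambda>T[OF st(1)] \<Lambda>T[OF st(2)] \<open>0 < c\<close> by (intro exp_lipschitz_on_bounded mult_left_mono) auto
    also have "\<bar>c * \<Lambda> t - c * \<Lambda> s\<bar> = c * \<bar>\<Lambda> t - \<Lambda> s\<bar>"
      using \<open>0 < c\<close> by (simp add: right_diff_distrib[symmetric] abs_mult)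
    finally have *: "\<bar>exp (c * \<Lambda> t) - exp (c * \<Lambda> s)\<bar> / c \<le> exp (c * \<Lambda> T) * \<bar>\<Lambda> t - \<Lambda> s\<bar>"
      using \<open>0 < c\<close> by (simp add: field_simps)
    have "norm (y t - y s) = \<bar>exp (c * \<Lambda> t) - exp (c * \<Lambda> s)\<bar> / c"
      using \<open>0 < c\<close> by (simp add: y_def diff_divide_distrib[symmetric])
    with * show "norm (y t - y s) \<le> exp (c * \<Lambda> T) * norm (\<Lambda> t - \<Lambda> s)" by simp
  qed auto
  then have acy: "abs_continuous_on_interval 0 t y"
    by (rule abs_continuous_on_interval_subset) (use assms in auto)
  have "AE s in lebesgue. s \<in> {0<..<T} \<longrightarrow> (\<Lambda> has_vector_derivative L s) (at s)"
    by (rule indefinite_integral_AE_derivative[OF L(1), of _ 0]) (simp add: \<Lambda>_def)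
  then obtain N where N: "negligible N" "\<And>s. s \<notin> N \<Longrightarrow> s \<in> {0<..<T} \<longrightarrow> (\<Lambda> has_vector_derivative L s) (at s)"
    using AE_lebesgueE by blast
  have "((\<lambda>s. L s * exp (c * \<Lambda> s)) has_integral (y t - y 0)) {0..t}"
  proof (rule abs_continuous_has_integral[OF _ acy])
    show "negligible (N \<union> {0, T})" using N(1) by (auto intro!: negligible_Un)
    fix s assume "s \<in> {0..t} - (N \<union> {0, T})"
    then have "(\<Lambda> has_vector_derivative L s) (at s)" using N(2)[of s] assms(4) by auto
    then have "(\<Lambda> has_real_derivative L s) (at s)"
      by (simp add: has_real_derivative_iff_has_vector_derivative)
    then have "(y has_real_derivative L s * exp (c * \<Lambda> s)) (at s)"
      unfolding y_def using \<open>0 < c\<close> by (auto intro!: derivative_eq_intros)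
    then have "(y has_vector_derivative L s * exp (c * \<Lambda> s)) (at s)"
      by (simp add: has_real_derivative_iff_has_vector_derivative)
    then show "(y has_vector_derivative L s * exp (c * \<Lambda> s)) (at s within {0..t})"
      by (rule has_vector_derivative_at_within)
  qed (use assms in auto)
  moreover have "y t - y 0 = (exp (c * \<Lambda> t) - 1) / c"
    using \<open>0 < c\<close> by (simp add: y_def \<Lambda>_def field_simps)
  ultimately show ?thesis by (simp add: \<Lambda>_def)
qed

section \<open>Functions in \<open>L\<^sup>p\<close> on a compact interval\<close>

lemma power_add_le_two_power:
  fixes a b :: real
  assumes "0 \<le> a" "0 \<le> b"
  shows "(a + b) ^ p \<le> 2 ^ p * (a ^ p + b ^ p)"
proof -
  have "(a + b) ^ p \<le> (2 * max a b) ^ p" using assms by (intro power_mono) auto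
  also have "\<dots> = 2 ^ p * max a b ^ p" by (simp add: power_mult_distrib)
  also have "max a b ^ p \<le> a ^ p + b ^ p" using assms by (auto simp: max_def)
  finally show ?thesis by simp
qed

text \<open>If \<open>x > e\<close>, then \<open>x \<le> x * (x / e) ^ (p - 1)\<close>. This
  elementary estimate takes the place of Hoelder's inequality whenever an integral is bounded
  through an integral of p-th powers.\<close>

lemma le_add_power_div:
  fixes x e :: real
  assumes "0 \<le> x" "0 < e" "1 \<le> p"
  shows "x \<le> e + x ^ p / e ^ (p - 1)"
proof (cases "x \<le> e")
  case True
  then show ?thesis using assms by (simp add: add_increasing2)
next
  case False
  have "x * e ^ (p - 1) \<le> x * x ^ (p - 1)"
    using False assms by (intro mult_left_mono power_mono) auto
  also have "\<dots> = x ^ p" using assms(3) by (simp add: power_eq_if)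
  finally have "x \<le> x ^ p / e ^ (p - 1)" using assms(2) by (simp add: field_simps)
  then show ?thesis using assms(2) by linarith
qed

lemma ex_small_power_factor:
  fixes r C :: real
  assumes "0 < r" "0 \<le> C" "1 \<le> p"
  shows "\<exists>e>0. e \<le> 1 \<and> 2 ^ p * (e ^ p * C) < r"
proof (intro exI conjI)
  \<comment> \<open>Since the witness is at most 1, its p-th power is at most the witness;
    \<open>C + 1\<close> avoids a division by 0 and makes the bound strict.\<close>
  let ?e = "min 1 (r / (2 ^ p * (C + 1)))"
  show "0 < ?e" "?e \<le> 1" using assms by auto
  have "?e ^ p * C \<le> ?e ^ 1 * C"
    using assms by (intro mult_right_mono power_decreasing) auto
  also have "\<dots> \<le> r / (2 ^ p * (C + 1)) * C" using assms by (intro mult_right_mono) auto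
  also have "\<dots> = r / 2 ^ p * (C / (C + 1))" by simp
  also have "\<dots> < r / 2 ^ p * 1" using assms by (intro mult_strict_left_mono) auto
  finally show "2 ^ p * (?e ^ p * C) < r" by (simp add: field_simps)
qed

text \<open>For a non-integrable power the integral is 0 by convention.\<close>

lemma integral_norm_power_nonneg: "0 \<le> integral S (\<lambda>t. norm (g t) ^ p)"
  using Henstock_Kurzweil_Integration.integral_nonneg[of "\<lambda>t. norm (g t) ^ p" S]
  by (cases "(\<lambda>t. norm (g t) ^ p) integrable_on S") (auto simp: not_integrable_integral)

text \<open>For nonnegative functions absolute and gauge integrability coincide, so all estimates of
  p-th powers can be made with the gauge integral.\<close>

lemma Lp_on_iff:
  fixes g :: "real \<Rightarrow> 'w::euclidean_space"
  shows "g \<in> Lp_on p {a..b} \<longleftrightarrow>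
    g \<in> borel_measurable (lebesgue_on {a..b}) \<and> (\<lambda>t. norm (g t) ^ p) integrable_on {a..b}"
proof -
  have "set_borel_measurable lebesgue {a..b} g \<longleftrightarrow> g \<in> borel_measurable (lebesgue_on {a..b})"
    unfolding set_borel_measurable_def by (subst borel_measurable_restrict_space_iff) auto
  moreover have "(\<lambda>t. norm (g t) ^ p) absolutely_integrable_on {a..b} \<longleftrightarrow>
      (\<lambda>t. norm (g t) ^ p) integrable_on {a..b}"
    by (intro absolutely_integrable_on_iff_nonneg) auto
  ultimately show ?thesis unfolding Lp_on_def by simp
qed

lemma integrable_bounded_AE:
  fixes g :: "real \<Rightarrow> 'w::euclidean_space"
  assumes g: "g \<in> borel_measurable (lebesgue_on {a..b})" and h: "h integrable_on {a..b}"
    and ae: "AE t in lebesgue. t \<in> {a..b} \<longrightarrow> norm (g t) \<le> h t"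
  shows "g absolutely_integrable_on {a..b}"
proof -
  obtain N where N: "negligible N" "\<And>t. t \<notin> N \<Longrightarrow> t \<in> {a..b} \<longrightarrow> norm (g t) \<le> h t"
    using AE_lebesgueE[OF ae] by blast
  have Nm: "N \<in> sets lebesgue" using N(1) by (simp add: negligible_imp_sets)
  define g' where "g' t = (if t \<in> N then 0 else g t)" for t
  define h' where "h' t = (if t \<in> N then 0 else h t)" for t
  have "(\<lambda>t. if t \<in> N then 0 else g t) \<in> borel_measurable (lebesgue_on {a..b})"
  proof (rule measurable_If_set[OF _ g])
    show "N \<inter> space (lebesgue_on {a..b}) \<in> sets (lebesgue_on {a..b})"
      using Nm by (auto simp: sets_restrict_space)
  qed auto
  then have "g' \<in> borel_measurable (lebesgue_on {a..b})" unfolding g'_def .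
  moreover have "h' integrable_on {a..b}"
    by (rule integrable_spike[OF h N(1)]) (simp add: h'_def)
  moreover have "norm (g' t) \<le> h' t" if "t \<in> {a..b}" for t
    using N(2)[of t] that by (auto simp: g'_def h'_def)
  ultimately have "g' absolutely_integrable_on {a..b}"
    by (intro measurable_bounded_by_integrable_imp_absolutely_integrable) auto
  then show ?thesis
    by (rule absolutely_integrable_spike[OF _ N(1)]) (simp add: g'_def)
qed

lemma Lp_on_bounded_AE:
  fixes g :: "real \<Rightarrow> 'w::euclidean_space"
  assumes g: "g \<in> borel_measurable (lebesgue_on {a..b})" and h: "h \<in> Lp_on p {a..b}"
    and ae: "AE t in lebesgue. t \<in> {a..b} \<longrightarrow> norm (g t) \<le> (h t :: real)"
  shows "g \<in> Lp_on p {a..b}"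
    "integral {a..b} (\<lambda>t. norm (g t) ^ p) \<le> integral {a..b} (\<lambda>t. norm (h t) ^ p)"
proof -
  have hi: "(\<lambda>t. norm (h t) ^ p) integrable_on {a..b}" using h by (simp add: Lp_on_iff)
  have ae': "AE t in lebesgue. t \<in> {a..b} \<longrightarrow> norm (norm (g t) ^ p) \<le> norm (h t) ^ p"
    using ae by (eventually_elim) (auto intro!: power_mono)
  have "(\<lambda>t. norm (g t) ^ p) \<in> borel_measurable (lebesgue_on {a..b})" using g by measurable
  then have *: "(\<lambda>t. norm (g t) ^ p) integrable_on {a..b}"
    using integrable_bounded_AE[OF _ hi ae'] set_lebesgue_integral_eq_integral(1) by blast
  with g show "g \<in> Lp_on p {a..b}" by (simp add: Lp_on_iff)
  show "integral {a..b} (\<lambda>t. norm (g t) ^ p) \<le> integral {a..b} (\<lambda>t. norm (h t) ^ p)"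
    using ae' by (intro integral_le_AE[OF * hi]) (auto elim: eventually_mono)
qed

lemma Lp_on_subinterval:
  fixes g :: "real \<Rightarrow> 'w::euclidean_space"
  assumes "g \<in> Lp_on p {a..b}" "{c..d} \<subseteq> {a..b}"
  shows "g \<in> Lp_on p {c..d}"
  using assms unfolding Lp_on_iff
  by (auto intro: integrable_on_subinterval measurable_restrict_mono)

lemma Lp_on_norm:
  fixes g :: "real \<Rightarrow> 'w::euclidean_space"
  assumes "g \<in> Lp_on p {a..b}"
  shows "(\<lambda>t. norm (g t)) \<in> Lp_on p {a..b}"
  using assms unfolding Lp_on_iff by auto

lemma Lp_on_scale:
  fixes g :: "real \<Rightarrow> real"
  assumes "g \<in> Lp_on p {a..b}"
  shows "(\<lambda>t. c * g t) \<in> Lp_on p {a..b}"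
    "integral {a..b} (\<lambda>t. norm (c * g t) ^ p) = \<bar>c\<bar> ^ p * integral {a..b} (\<lambda>t. norm (g t) ^ p)"
  using assms integrable_on_mult_right[of "\<lambda>t. norm (g t) ^ p" "{a..b}" "\<bar>c\<bar> ^ p"] unfolding Lp_on_iff
  by (auto simp: abs_mult power_mult_distrib)

text \<open>The factor \<open>2 ^ p\<close> replaces Minkowski's inequality: only boundedness and
  convergence to 0 of these integrals matter.\<close>

lemma Lp_on_add:
  fixes g h :: "real \<Rightarrow> 'w::euclidean_space"
  assumes g: "g \<in> Lp_on p {a..b}" and h: "h \<in> Lp_on p {a..b}"
  shows "(\<lambda>t. g t + h t) \<in> Lp_on p {a..b}"
    "integral {a..b} (\<lambda>t. norm (g t + h t) ^ p) \<le>
       2 ^ p * (integral {a..b} (\<lambda>t. norm (g t) ^ p) + integral {a..b} (\<lambda>t. norm (h t) ^ p))"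
proof -
  have gm: "g \<in> borel_measurable (lebesgue_on {a..b})" "h \<in> borel_measurable (lebesgue_on {a..b})"
    and gi: "(\<lambda>t. norm (g t) ^ p) integrable_on {a..b}" "(\<lambda>t. norm (h t) ^ p) integrable_on {a..b}"
    using g h by (auto simp: Lp_on_iff)
  have m: "(\<lambda>t. norm (g t + h t) ^ p) \<in> borel_measurable (lebesgue_on {a..b})"
    using gm by measurable
  have le: "norm (g t + h t) ^ p \<le> 2 ^ p * (norm (g t) ^ p + norm (h t) ^ p)" for t
    by (rule order_trans[OF power_mono[OF norm_triangle_ineq] power_add_le_two_power]) auto
  have i: "(\<lambda>t. 2 ^ p * (norm (g t) ^ p + norm (h t) ^ p)) integrable_on {a..b}"
    using gi by (intro integrable_on_mult_right integrable_add)
  have *: "(\<lambda>t. norm (g t + h t) ^ p) integrable_on {a..b}"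
    by (rule set_lebesgue_integral_eq_integral(1)[OF integrable_bounded_AE[OF m i]]) (use le in auto)
  with gm show "(\<lambda>t. g t + h t) \<in> Lp_on p {a..b}" by (simp add: Lp_on_iff)
  have "integral {a..b} (\<lambda>t. norm (g t + h t) ^ p) \<le>
      integral {a..b} (\<lambda>t. 2 ^ p * (norm (g t) ^ p + norm (h t) ^ p))"
    by (intro integral_le * i le)
  also have "\<dots> = 2 ^ p * (integral {a..b} (\<lambda>t. norm (g t) ^ p) + integral {a..b} (\<lambda>t. norm (h t) ^ p))"
    using gi by (simp add: Henstock_Kurzweil_Integration.integral_add)
  finally show "integral {a..b} (\<lambda>t. norm (g t + h t) ^ p) \<le>
       2 ^ p * (integral {a..b} (\<lambda>t. norm (g t) ^ p) + integral {a..b} (\<lambda>t. norm (h t) ^ p))" .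
qed

lemma Lp_on_absolutely_integrable:
  fixes g :: "real \<Rightarrow> 'w::euclidean_space"
  assumes g: "g \<in> Lp_on p {a..b}" and "1 \<le> p"
  shows "g absolutely_integrable_on {a..b}"
proof (rule integrable_bounded_AE)
  show "(\<lambda>t. 1 + norm (g t) ^ p) integrable_on {a..b}"
    using g by (intro integrable_add) (auto simp: Lp_on_iff)
  show "AE t in lebesgue. t \<in> {a..b} \<longrightarrow> norm (g t) \<le> 1 + norm (g t) ^ p"
    using le_add_power_div[of _ 1 p] assms(2) by auto
qed (use g in \<open>simp add: Lp_on_iff\<close>)

lemma integral_norm_le_Lp:
  fixes g :: "real \<Rightarrow> 'w::euclidean_space"
  assumes g: "g \<in> Lp_on p {a..b}" and "1 \<le> p" "0 < e" "a \<le> b"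
  shows "integral {a..b} (\<lambda>t. norm (g t)) \<le> e * (b - a) + integral {a..b} (\<lambda>t. norm (g t) ^ p) / e ^ (p - 1)"
proof -
  have gi: "(\<lambda>t. norm (g t)) integrable_on {a..b}" "(\<lambda>t. norm (g t) ^ p) integrable_on {a..b}"
    using Lp_on_absolutely_integrable[OF g assms(2)] g by (auto simp: Lp_on_iff absolutely_integrable_on_def)
  then have i: "(\<lambda>t. norm (g t) ^ p / e ^ (p - 1)) integrable_on {a..b}"
    by (intro integrable_on_divide)
  have "integral {a..b} (\<lambda>t. norm (g t)) \<le> integral {a..b} (\<lambda>t. e + norm (g t) ^ p / e ^ (p - 1))"
    using le_add_power_div[of _ e p] assms gi i by (intro integral_le integrable_add) auto
  also have "\<dots> = e * (b - a) + integral {a..b} (\<lambda>t. norm (g t) ^ p) / e ^ (p - 1)"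
    using i assms by (subst Henstock_Kurzweil_Integration.integral_add) auto
  finally show ?thesis .
qed

lemma Lp_tendsto_imp_L1_tendsto:
  fixes g :: "nat \<Rightarrow> real \<Rightarrow> 'w::euclidean_space"
  assumes g: "\<And>n. g n \<in> Lp_on p {a..b}" and "1 \<le> p" "a \<le> b"
    and lim: "(\<lambda>n. integral {a..b} (\<lambda>t. norm (g n t) ^ p)) \<longlonglongrightarrow> 0"
  shows "(\<lambda>n. integral {a..b} (\<lambda>t. norm (g n t))) \<longlonglongrightarrow> 0"
proof (rule LIMSEQ_I)
  fix r :: real assume "r > 0"
  \<comment> \<open>\<open>e\<close> is fixed before \<open>n\<close>: the length term stays below
    \<open>r / 2\<close>, and for large \<open>n\<close> the power term does as well.\<close>
  define e where "e = r / 2 / (b - a + 1)"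
  have e: "e > 0" "e * (b - a) < r / 2" using \<open>r > 0\<close> \<open>a \<le> b\<close> by (auto simp: e_def field_simps)
  have "\<forall>\<^sub>F n in sequentially. integral {a..b} (\<lambda>t. norm (g n t) ^ p) < r / 2 * e ^ (p - 1)"
    using \<open>r > 0\<close> e by (intro order_tendstoD(2)[OF lim]) auto
  then obtain N where N: "\<And>n. n \<ge> N \<Longrightarrow> integral {a..b} (\<lambda>t. norm (g n t) ^ p) < r / 2 * e ^ (p - 1)"
    unfolding eventually_sequentially by blast
  have "norm (integral {a..b} (\<lambda>t. norm (g n t)) - 0) < r" if "n \<ge> N" for n
  proof -
    have "integral {a..b} (\<lambda>t. norm (g n t) ^ p) / e ^ (p - 1) < r / 2"
      using N[OF that] e by (simp add: field_simps)
    then have "integral {a..b} (\<lambda>t. norm (g n t)) < r"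
      using integral_norm_le_Lp[OF g[of n] assms(2) e(1) assms(3)] e(2) by linarith
    moreover have "0 \<le> integral {a..b} (\<lambda>t. norm (g n t))"
      using integral_norm_power_nonneg[of _ "g n" 1] by simp
    ultimately show ?thesis by simp
  qed
  then show "\<exists>N. \<forall>n\<ge>N. norm (integral {a..b} (\<lambda>t. norm (g n t)) - 0) < r" by blast
qed

lemma Lp_norm_eq:
  fixes g :: "real \<Rightarrow> 'w::euclidean_space"
  assumes "g \<in> Lp_on p {a..b}"
  shows "Lp_norm p {a..b} g = root p (integral {a..b} (\<lambda>t. norm (g t) ^ p))"
  using assms unfolding Lp_norm_def Lp_on_def by (simp add: set_lebesgue_integral_eq_integral)

text \<open>Completeness of Lebesgue measure supplies the measurability of \<open>h\<close>. This
  matters because the derivative of a solution is known only almost everywhere.\<close>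

lemma Lp_on_AE_cong:
  fixes g h :: "real \<Rightarrow> 'w::euclidean_space"
  assumes g: "g \<in> Lp_on p {a..b}" and ae: "AE t in lebesgue. t \<in> {a..b} \<longrightarrow> g t = h t"
  shows "h \<in> Lp_on p {a..b}"
    "integral {a..b} (\<lambda>t. norm (h t) ^ p) = integral {a..b} (\<lambda>t. norm (g t) ^ p)"
proof -
  obtain N where N: "negligible N" "\<And>t. t \<notin> N \<Longrightarrow> t \<in> {a..b} \<longrightarrow> g t = h t"
    using AE_lebesgueE[OF ae] by blast
  have "(\<lambda>t. indicator {a..b} t *\<^sub>R g t) \<in> borel_measurable lebesgue"
    using g by (simp add: Lp_on_def set_borel_measurable_def)
  then have "(\<lambda>t. indicator {a..b} t *\<^sub>R h t) \<in> borel_measurable lebesgue"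
    by (rule borel_measurable_AE) (use ae in \<open>auto elim!: eventually_mono simp: indicator_def\<close>)
  then have "h \<in> borel_measurable (lebesgue_on {a..b})"
    by (subst borel_measurable_restrict_space_iff) auto
  moreover have "(\<lambda>t. norm (h t) ^ p) integrable_on {a..b}"
    by (rule integrable_spike[OF _ N(1), of "\<lambda>t. norm (g t) ^ p"]) (use g N(2) in \<open>auto simp: Lp_on_iff\<close>)
  ultimately show "h \<in> Lp_on p {a..b}" by (simp add: Lp_on_iff)
  show "integral {a..b} (\<lambda>t. norm (h t) ^ p) = integral {a..b} (\<lambda>t. norm (g t) ^ p)"
    by (rule integral_spike[OF N(1)]) (use N(2) in auto)
qed

section \<open>Lipschitz Caratheodory functions along continuous curves\<close>

lemma LC_measurable_along:
  fixes f :: "real \<Rightarrow> 'z::euclidean_space \<Rightarrow> 'w::euclidean_space"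
  assumes f: "f \<in> LC p" and z: "continuous_on {a..b} z"
  shows "(\<lambda>t. f t (z t)) \<in> borel_measurable (lebesgue_on {a..b})"
proof -
  have "z \<in> borel_measurable (lebesgue_on {a..b})"
    using z by (intro continuous_imp_measurable_on_sets_lebesgue) auto
  moreover have "(\<lambda>t. t) \<in> borel_measurable (lebesgue_on {a..b})" 
    by (intro continuous_imp_measurable_on_sets_lebesgue) auto
  ultimately have "(\<lambda>t. (t, z t)) \<in> borel_measurable (lebesgue_on {a..b})"
    by (rule borel_measurable_Pair[rotated])
  moreover have "(\<lambda>(t, z). f t z) \<in> borel_measurable borel" using f by (simp add: LC_def)
  ultimately have "(\<lambda>t. (\<lambda>(t, z). f t z) (t, z t)) \<in> borel_measurable (lebesgue_on {a..b})"
    by (rule measurable_compose)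
  then show ?thesis by simp
qed

lemma LC_mbound:
  fixes f :: "real \<Rightarrow> 'z::euclidean_space \<Rightarrow> 'w::euclidean_space"
  assumes "f \<in> LC p"
  shows "\<exists>m\<in>Lp_loc p. (\<forall>t. 0 \<le> m t) \<and>
    (AE t in lebesgue. \<forall>z\<in>cball 0 (real j). norm (f t z) \<le> m t)"
proof -
  obtain m where m: "m \<in> Lp_loc p" and ae: "AE t in lebesgue. \<forall>z\<in>cball 0 (real j). norm (f t z) \<le> m t"
  proof -
    obtain m l where "m \<in> Lp_loc p" "AE t in lebesgue. (\<forall>z\<in>cball 0 (real j). norm (f t z) \<le> m t) \<and>
      (\<forall>z1\<in>cball 0 (real j). \<forall>z2\<in>cball 0 (real j). norm (f t z1 - f t z2) \<le> l t * norm (z1 - z2))"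
      using assms unfolding LC_def by (auto dest!: spec[of _ "cball 0 (real j)"])
    then show ?thesis by (intro that[of m]) (auto elim!: eventually_mono)
  qed
  show ?thesis
  proof (intro bexI[of _ "\<lambda>t. \<bar>m t\<bar>"] conjI)
    show "(\<lambda>t. \<bar>m t\<bar>) \<in> Lp_loc p"
      using m Lp_on_norm[of m p] by (simp add: Lp_loc_def)
    show "AE t in lebesgue. \<forall>z\<in>cball 0 (real j). norm (f t z) \<le> \<bar>m t\<bar>"
      using ae by eventually_elim fastforce
  qed auto
qed

lemma LC_lbound:
  fixes f :: "real \<Rightarrow> 'z::euclidean_space \<Rightarrow> 'w::euclidean_space"
  assumes "f \<in> LC p"
  shows "\<exists>l\<in>Lp_loc p. (\<forall>t. 0 \<le> l t) \<and>
    (AE t in lebesgue. \<forall>z1\<in>cball 0 (real j). \<forall>z2\<in>cball 0 (real j).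
       norm (f t z1 - f t z2) \<le> l t * norm (z1 - z2))"
proof -
  obtain l where l: "l \<in> Lp_loc p" and ae: "AE t in lebesgue. \<forall>z1\<in>cball 0 (real j). \<forall>z2\<in>cball 0 (real j).
       norm (f t z1 - f t z2) \<le> l t * norm (z1 - z2)"
  proof -
    obtain m l where "l \<in> Lp_loc p" "AE t in lebesgue. (\<forall>z\<in>cball 0 (real j). norm (f t z) \<le> m t) \<and>
      (\<forall>z1\<in>cball 0 (real j). \<forall>z2\<in>cball 0 (real j). norm (f t z1 - f t z2) \<le> l t * norm (z1 - z2))"
      using assms unfolding LC_def by (auto dest!: spec[of _ "cball 0 (real j)"])
    then show ?thesis by (intro that[of l]) (auto elim!: eventually_mono)
  qed
  show ?thesis
  proof (intro bexI[of _ "\<lambda>t. \<bar>l t\<bar>"] conjI)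
    show "(\<lambda>t. \<bar>l t\<bar>) \<in> Lp_loc p"
      using l Lp_on_norm[of l p] by (simp add: Lp_loc_def)
    show "AE t in lebesgue. \<forall>z1\<in>cball 0 (real j). \<forall>z2\<in>cball 0 (real j).
       norm (f t z1 - f t z2) \<le> \<bar>l t\<bar> * norm (z1 - z2)"
      using ae by eventually_elim (meson abs_ge_self mult_right_mono norm_ge_zero order_trans)
  qed auto
qed

text \<open>A continuous curve on a compact interval stays in some ball, on which \<open>f\<close>
  has a majorant in \<open>Lp_loc p\<close>.\<close>

lemma LC_Lp_along:
  fixes f :: "real \<Rightarrow> 'z::euclidean_space \<Rightarrow> 'w::euclidean_space"
  assumes f: "f \<in> LC p" and z: "continuous_on {a..b} z"
  shows "(\<lambda>t. f t (z t)) \<in> Lp_on p {a..b}"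
proof -
  have "bounded (z ` {a..b})"
    using z by (intro compact_imp_bounded compact_continuous_image) auto
  then obtain B where "\<forall>y\<in>z ` {a..b}. norm y \<le> B" unfolding bounded_iff ..
  then have B: "norm (z t) \<le> B" if "t \<in> {a..b}" for t using that by simp
  obtain j :: nat where "B \<le> real j" using real_arch_simple by blast
  then have zj: "z t \<in> cball 0 (real j)" if "t \<in> {a..b}" for t using B[OF that] by simp
  obtain m where ml: "m \<in> Lp_loc p" "AE t in lebesgue. \<forall>z\<in>cball 0 (real j). norm (f t z) \<le> m t"
    using LC_mbound[OF f, of j] by (elim bexE conjE)
  show ?thesis
  proof (rule Lp_on_bounded_AE(1)[OF LC_measurable_along[OF f z]])
    show "m \<in> Lp_on p {a..b}" using ml(1) by (simp add: Lp_loc_def)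
    show "AE t in lebesgue. t \<in> {a..b} \<longrightarrow> norm (f t (z t)) \<le> m t"
      using ml(2) by (eventually_elim) (intro impI, drule bspec[OF _ zj])
  qed
qed

lemma LC_diff:
  fixes f g :: "real \<Rightarrow> 'z::euclidean_space \<Rightarrow> 'w::euclidean_space"
  assumes f: "f \<in> LC p" and g: "g \<in> LC p"
  shows "f - g \<in> LC p"
proof -
  have "(\<lambda>(t, z). (f - g) t z) = (\<lambda>x. (\<lambda>(t, z). f t z) x - (\<lambda>(t, z). g t z) x)" by auto
  moreover have "\<dots> \<in> borel_measurable borel"
    using f g by (intro borel_measurable_diff) (auto simp: LC_def)
  ultimately have "(\<lambda>(t, z). (f - g) t z) \<in> borel_measurable borel" by simp
  moreover have "\<exists>m\<in>Lp_loc p. \<exists>l\<in>Lp_loc p. AE t in lebesgue.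
        (\<forall>z\<in>K. norm ((f - g) t z) \<le> m t) \<and>
        (\<forall>z1\<in>K. \<forall>z2\<in>K. norm ((f - g) t z1 - (f - g) t z2) \<le> l t * norm (z1 - z2))"
    if K: "compact K" for K
  proof -
    obtain m1 l1 where 1: "m1 \<in> Lp_loc p" "l1 \<in> Lp_loc p" "AE t in lebesgue.
        (\<forall>z\<in>K. norm (f t z) \<le> m1 t) \<and>
        (\<forall>z1\<in>K. \<forall>z2\<in>K. norm (f t z1 - f t z2) \<le> l1 t * norm (z1 - z2))"
      using f K unfolding LC_def by blast
    obtain m2 l2 where 2: "m2 \<in> Lp_loc p" "l2 \<in> Lp_loc p" "AE t in lebesgue.
        (\<forall>z\<in>K. norm (g t z) \<le> m2 t) \<and>
        (\<forall>z1\<in>K. \<forall>z2\<in>K. norm (g t z1 - g t z2) \<le> l2 t * norm (z1 - z2))"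
      using g K unfolding LC_def by blast
    have "AE t in lebesgue. (\<forall>z\<in>K. norm ((f - g) t z) \<le> m1 t + m2 t) \<and>
        (\<forall>z1\<in>K. \<forall>z2\<in>K. norm ((f - g) t z1 - (f - g) t z2) \<le> (l1 t + l2 t) * norm (z1 - z2))"
      using 1(3) 2(3)
    proof eventually_elim
      case (elim t)
      have "norm ((f - g) t z) \<le> m1 t + m2 t" if "z \<in> K" for z
        using elim that norm_triangle_ineq4[of "f t z" "g t z"] by fastforce
      moreover have "norm ((f - g) t z1 - (f - g) t z2) \<le> (l1 t + l2 t) * norm (z1 - z2)"
        if "z1 \<in> K" "z2 \<in> K" for z1 z2
      proof -
        have "(f - g) t z1 - (f - g) t z2 = (f t z1 - f t z2) - (g t z1 - g t z2)" by simp
        then have "norm ((f - g) t z1 - (f - g) t z2) \<le> norm (f t z1 - f t z2) + norm (g t z1 - g t z2)"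
          by (metis norm_triangle_ineq4)
        also have "\<dots> \<le> l1 t * norm (z1 - z2) + l2 t * norm (z1 - z2)"
          using elim that by (intro add_mono) auto
        finally show ?thesis by (simp add: algebra_simps)
      qed
      ultimately show ?case by blast
    qed
    moreover have "(\<lambda>t. m1 t + m2 t) \<in> Lp_loc p" "(\<lambda>t. l1 t + l2 t) \<in> Lp_loc p"
      using 1 2 by (auto simp: Lp_loc_def intro: Lp_on_add)
    ultimately show ?thesis by (intro bexI[of _ "\<lambda>t. m1 t + m2 t"] bexI[of _ "\<lambda>t. l1 t + l2 t"])
  qed
  ultimately show ?thesis unfolding LC_def by blast
qed

section \<open>A Gronwall inequality with delay\<close>

text \<open>A non-integrable \<open>f\<close> has integral 0, which \<open>0 \<le> I\<close> covers;
  the delayed term of the Gronwall inequality can thus be estimated by a pointwise bound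
  alone.\<close>

lemma integral_le_has_integral:
  fixes f :: "real \<Rightarrow> real"
  assumes "(g has_integral I) S" "0 \<le> I" "\<And>x. x \<in> S \<Longrightarrow> f x \<le> g x"
  shows "integral S f \<le> I"
proof (cases "f integrable_on S")
  case True
  then show ?thesis using assms by (intro has_integral_le[OF integrable_integral assms(1)]) auto
next
  case False
  then show ?thesis using assms(2) by (simp add: not_integrable_integral)
qed

text \<open>
  With the weight \<open>exp (- 4 \<integral> L)\<close> the integral term is at most half of the weighted maximum of
  \<open>norm d\<close>, whatever the length of the interval.
\<close>

lemma delay_gronwall:
  fixes d :: "real \<Rightarrow> 'w::euclidean_space"
  assumes cont: "continuous_on {-1..T} d" and "0 \<le> T"
    and L: "L integrable_on {0..T}" "\<And>t. t \<in> {0..T} \<Longrightarrow> 0 \<le> L t"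
    and past: "\<And>t. t \<in> {-1..0} \<Longrightarrow> norm (d t) \<le> a"
    and ineq: "\<And>t. t \<in> {0..T} \<Longrightarrow> norm (d t) \<le> a + integral {0..t} (\<lambda>s. L s * (norm (d s) + norm (d (s - 1))))"
    and t: "t \<in> {-1..T}"
  shows "norm (d t) \<le> 2 * a * exp (4 * integral {0..T} L)"
proof -
  \<comment> \<open>Keeping \<open>\<Lambda>\<close> equal to 0 on \<open>[-1, 0]\<close> extends
    the weight to the delayed arguments.\<close>
  define \<Lambda> where "\<Lambda> s = integral {0..max 0 s} L" for s
  have "norm (d 0) \<le> a" by (rule past) auto
  then have a0: "0 \<le> a" using norm_ge_zero[of "d 0"] by linarith
  have Li: "L integrable_on {0..max 0 s}" if "s \<le> T" for s
    by (rule integrable_on_subinterval[OF L(1)]) (use that \<open>0 \<le> T\<close> in auto)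
  have \<Lambda>mono: "\<Lambda> s \<le> \<Lambda> s'" if "s \<le> s'" "s' \<le> T" for s s'
    unfolding \<Lambda>_def
  proof (rule integral_subset_le)
    show "{0..max 0 s} \<subseteq> {0..max 0 s'}" using that by auto
    show "L integrable_on {0..max 0 s}" "L integrable_on {0..max 0 s'}" using that by (intro Li; simp)+
    show "\<forall>t\<in>{0..max 0 s'}. 0 \<le> L t" using that \<open>0 \<le> T\<close> by (auto intro!: L(2))
  qed
  have \<Lambda>0: "0 \<le> \<Lambda> s" if "s \<le> T" for s
    unfolding \<Lambda>_def using that \<open>0 \<le> T\<close>
    by (intro Henstock_Kurzweil_Integration.integral_nonneg Li) (auto intro!: L(2))
  have \<Lambda>cont: "continuous_on {-1..T} \<Lambda>"
    unfolding \<Lambda>_def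
    by (rule continuous_on_compose2[OF indefinite_integral_continuous_1[OF L(1)]])
      (auto intro!: continuous_intros simp: \<open>0 \<le> T\<close>)
  define W where "W s = exp (- 4 * \<Lambda> s) * norm (d s)" for s
  have "continuous_on {-1..T} W"
    unfolding W_def by (intro continuous_intros \<Lambda>cont cont)
  then obtain t0 where t0: "t0 \<in> {-1..T}" "\<And>s. s \<in> {-1..T} \<Longrightarrow> W s \<le> W t0"
    using continuous_attains_sup[of "{-1..T}" W] \<open>0 \<le> T\<close> by auto
  define M where "M = W t0"
  have M0: "0 \<le> M" by (simp add: M_def W_def)
  have dM: "norm (d s) \<le> M * exp (4 * \<Lambda> s)" if "s \<in> {-1..T}" for s
    using t0(2)[OF that] by (simp add: M_def W_def exp_minus field_simps)
  have "M \<le> 2 * a"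
  proof (cases "t0 \<le> 0")
    case True
    then have "\<Lambda> t0 = 0" by (simp add: \<Lambda>_def max_def)
    then show ?thesis using past[of t0] True t0(1) a0 by (simp add: M_def W_def)
  next
    case False
    have hi: "((\<lambda>s. L s * exp (4 * integral {0..s} L)) has_integral ((exp (4 * integral {0..t0} L) - 1) / 4)) {0..t0}"
      using has_integral_exp_primitive[OF L, of 4 t0] False t0(1) by simp
    \<comment> \<open>Since \<open>\<Lambda> (s - 1) \<le> \<Lambda> s\<close>, the delayed term
      obeys the same bound as the present one; together they give the factor
      \<open>2 * M\<close>.\<close>
    have le: "L s * (norm (d s) + norm (d (s - 1))) \<le> 2 * M * (L s * exp (4 * integral {0..s} L))"
      if "s \<in> {0..t0}" for s
    proof -
      have s: "s \<in> {0..T}" using that t0(1) by auto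
      have "norm (d s) \<le> M * exp (4 * \<Lambda> s)" using s by (intro dM) auto
      moreover have "norm (d (s - 1)) \<le> M * exp (4 * \<Lambda> (s - 1))" using s by (intro dM) auto
      moreover have "M * exp (4 * \<Lambda> (s - 1)) \<le> M * exp (4 * \<Lambda> s)"
        using \<Lambda>mono[of "s - 1" s] s M0 by (intro mult_left_mono) auto
      moreover have "\<Lambda> s = integral {0..s} L" using s by (simp add: \<Lambda>_def)
      ultimately have "norm (d s) + norm (d (s - 1)) \<le> 2 * M * exp (4 * integral {0..s} L)"
        by simp
      then have "L s * (norm (d s) + norm (d (s - 1))) \<le> L s * (2 * M * exp (4 * integral {0..s} L))"
        using L(2)[OF s] by (rule mult_left_mono)
      then show ?thesis by (simp add: algebra_simps)
    qed
    have \<Lambda>t0: "\<Lambda> t0 = integral {0..t0} L" using False by (simp add: \<Lambda>_def)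
    \<comment> \<open>The factor 2 against the exponent 4 leaves at most \<open>M / 2\<close> after
      multiplication by the weight, which the left-hand side absorbs:
      \<open>M \<le> a + M / 2\<close>.\<close>
    have "integral {0..t0} (\<lambda>s. L s * (norm (d s) + norm (d (s - 1)))) \<le> 2 * M * ((exp (4 * \<Lambda> t0) - 1) / 4)"
    proof (rule integral_le_has_integral[OF _ _ le])
      show "((\<lambda>s. 2 * M * (L s * exp (4 * integral {0..s} L))) has_integral 2 * M * ((exp (4 * \<Lambda> t0) - 1) / 4)) {0..t0}"
        using has_integral_mult_right[OF hi, of "2 * M"] \<Lambda>t0 by simp
      show "0 \<le> 2 * M * ((exp (4 * \<Lambda> t0) - 1) / 4)"
        using M0 \<Lambda>0[of t0] t0(1) by simp
    qed
    then have "norm (d t0) \<le> a + 2 * M * ((exp (4 * \<Lambda> t0) - 1) / 4)"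
      using ineq[of t0] False t0(1) by auto
    also have "\<dots> \<le> a * exp (4 * \<Lambda> t0) + M / 2 * exp (4 * \<Lambda> t0)"
    proof -
      have "a * 1 \<le> a * exp (4 * \<Lambda> t0)" using a0 \<Lambda>0[of t0] t0(1) by (intro mult_left_mono) auto
      moreover have "2 * M * ((exp (4 * \<Lambda> t0) - 1) / 4) \<le> M / 2 * exp (4 * \<Lambda> t0)"
        using M0 by (simp add: algebra_simps)
      ultimately show ?thesis by linarith
    qed
    finally have "exp (- 4 * \<Lambda> t0) * norm (d t0) \<le> exp (- 4 * \<Lambda> t0) * ((a + M / 2) * exp (4 * \<Lambda> t0))"
      by (intro mult_left_mono) (auto simp: algebra_simps)
    also have "\<dots> = a + M / 2" by (simp add: exp_minus)
    finally have "exp (- 4 * \<Lambda> t0) * norm (d t0) \<le> a + M / 2" .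
    moreover have "M = exp (- 4 * \<Lambda> t0) * norm (d t0)" by (simp add: M_def W_def)
    ultimately show ?thesis by linarith
  qed
  have "norm (d t) \<le> M * exp (4 * \<Lambda> t)" using dM t by blast
  also have "\<dots> \<le> 2 * a * exp (4 * \<Lambda> T)"
    using \<open>M \<le> 2 * a\<close> \<Lambda>mono[of t T] t a0 M0 by (intro mult_mono) auto
  also have "\<Lambda> T = integral {0..T} L" using \<open>0 \<le> T\<close> by (simp add: \<Lambda>_def)
  finally show ?thesis .
qed

section \<open>Integral form of the delay equation and truncation\<close>

text \<open>For \<open>f\<close> in \<open>LC p\<close> a continuous \<open>x\<close> makes the
  integrand integrable, so the integral is never a mere default value. Estimates are made in this
  form on compact intervals; the differential form returns for maximal solutions and for the Sobolev
  norm.\<close>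

definition integral_solution ::
    "(real \<Rightarrow> 'x \<times> 'x \<Rightarrow> 'x) \<Rightarrow> (real \<Rightarrow> 'x) \<Rightarrow> real \<Rightarrow> (real \<Rightarrow> 'x::euclidean_space) \<Rightarrow> bool" where
  "integral_solution f \<phi> T x \<longleftrightarrow>
     continuous_on {-1..T} x \<and> (\<forall>t\<in>{-1..0}. x t = \<phi> t) \<and>
     (\<forall>t\<in>{0..T}. x t = \<phi> 0 + integral {0..t} (\<lambda>s. f s (x s, x (s - 1))))"

lemma norm_Pair_diff_le: "norm ((a, b) - (c, d)) \<le> norm (a - c) + norm (b - d)"
  using norm_Pair_le[of "a - c" "b - d"] by simp

lemma continuous_on_delay_pair:
  fixes x :: "real \<Rightarrow> 'x::euclidean_space"
  assumes "continuous_on {-1..T} x"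
  shows "continuous_on {0..T} (\<lambda>s. (x s, x (s - 1)))"
  by (intro continuous_on_Pair continuous_on_compose2[OF assms] continuous_intros) auto

lemma LC_Lp_along_delay:
  fixes x :: "real \<Rightarrow> 'x::euclidean_space" and f :: "real \<Rightarrow> 'x \<times> 'x \<Rightarrow> 'w::euclidean_space"
  assumes "f \<in> LC p" "continuous_on {-1..T} x"
  shows "(\<lambda>s. f s (x s, x (s - 1))) \<in> Lp_on p {0..T}"
  by (rule LC_Lp_along[OF assms(1) continuous_on_delay_pair[OF assms(2)]])

lemma bounded_continuous_on_interval:
  fixes x :: "real \<Rightarrow> 'x::euclidean_space"
  assumes "continuous_on {a..b} x"
  shows "\<exists>j::nat. \<forall>t\<in>{a..b}. norm (x t) \<le> real j"
proof -
  have "bounded (x ` {a..b})"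
    using assms by (intro compact_imp_bounded compact_continuous_image) auto
  then obtain B where B: "\<forall>y\<in>x ` {a..b}. norm y \<le> B" unfolding bounded_iff ..
  obtain j :: nat where "B \<le> real j" using real_arch_simple by blast
  with B show ?thesis by (intro exI[of _ j]) force
qed

text \<open>The Gronwall inequality with \<open>e + \<integral> |g|\<close> in place of
  \<open>a\<close>. The bound depends on \<open>L\<close> only through \<open>C\<close>, which makes
  it uniform over a sequence of equations.\<close>

lemma integral_solution_difference_bound:
  fixes h k :: "real \<Rightarrow> 'x \<times> 'x \<Rightarrow> 'x::euclidean_space" and z x :: "real \<Rightarrow> 'x"
    and g L :: "real \<Rightarrow> real"
  assumes h: "h \<in> LC p" and k: "k \<in> LC p" and "1 \<le> p" "0 \<le> T"
    and z: "integral_solution h \<psi> T z" and x: "integral_solution k \<phi> T x"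
    and past: "\<And>t. t \<in> {-1..0} \<Longrightarrow> norm (\<psi> t - \<phi> t) \<le> e"
    and g: "g \<in> Lp_on p {0..T}" and L: "L \<in> Lp_on p {0..T}" "\<And>t. 0 \<le> L t"
      "integral {0..T} (\<lambda>t. norm (L t) ^ p) \<le> C"
    and ae: "AE t in lebesgue. t \<in> {0..T} \<longrightarrow>
      norm (h t (z t, z (t - 1)) - k t (x t, x (t - 1))) \<le>
        norm (g t) + L t * (norm (z t - x t) + norm (z (t - 1) - x (t - 1)))"
    and t: "t \<in> {-1..T}"
  shows "norm (z t - x t) \<le> 2 * (e + integral {0..T} (\<lambda>t. norm (g t))) * exp (4 * (T + C))"
proof -
  have cz: "continuous_on {-1..T} z" and cx: "continuous_on {-1..T} x"
    using z x by (auto simp: integral_solution_def)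
  define d where "d s = z s - x s" for s
  have cd: "continuous_on {-1..T} d" unfolding d_def by (intro continuous_intros cz cx)
  have La: "L absolutely_integrable_on {0..T}"
    and Li: "L integrable_on {0..T}" and gi: "(\<lambda>t. norm (g t)) integrable_on {0..T}"
    using Lp_on_absolutely_integrable[OF L(1) \<open>1 \<le> p\<close>] Lp_on_absolutely_integrable[OF g \<open>1 \<le> p\<close>]
    by (auto simp: absolutely_integrable_on_def)
  have g0: "0 \<le> integral {0..T} (\<lambda>t. norm (g t))"
    using gi by (intro Henstock_Kurzweil_Integration.integral_nonneg) auto
  define A where "A = e + integral {0..T} (\<lambda>t. norm (g t))"
  have "norm (d t) \<le> 2 * A * exp (4 * integral {0..T} L)"
  proof (rule delay_gronwall[OF cd \<open>0 \<le> T\<close> Li L(2) _ _ t])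
    show "norm (d t) \<le> A" if "t \<in> {-1..0}" for t
      using past[OF that] z x that g0 by (simp add: integral_solution_def d_def A_def)
    fix t assume t: "t \<in> {0..T}"
    let ?Fz = "\<lambda>s. h s (z s, z (s - 1))" and ?Fx = "\<lambda>s. k s (x s, x (s - 1))"
    have sub: "{0..t} \<subseteq> {0..T}" using t by auto
    have F: "?Fz integrable_on {0..t}" "?Fx integrable_on {0..t}"
      using Lp_on_absolutely_integrable[OF LC_Lp_along_delay[OF h cz] \<open>1 \<le> p\<close>]
        Lp_on_absolutely_integrable[OF LC_Lp_along_delay[OF k cx] \<open>1 \<le> p\<close>]
      by (auto simp: absolutely_integrable_on_def intro: integrable_on_subinterval[OF _ sub])
    have gt: "(\<lambda>s. norm (g s)) integrable_on {0..t}" by (rule integrable_on_subinterval[OF gi sub])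
    have "continuous_on {0..t} (\<lambda>s. norm (d s) + norm (d (s - 1)))"
      using t by (intro continuous_intros continuous_on_compose2[OF cd]) auto
    then have "(\<lambda>s. (norm (d s) + norm (d (s - 1))) * L s) absolutely_integrable_on {0..t}"
      using t by (intro absolutely_integrable_bounded_measurable_product_real
          continuous_imp_measurable_on_sets_lebesgue compact_imp_bounded compact_continuous_image
          absolutely_integrable_on_subinterval[OF La]) auto
    then have Ld: "(\<lambda>s. L s * (norm (d s) + norm (d (s - 1)))) integrable_on {0..t}"
      by (simp add: absolutely_integrable_on_def mult.commute)
    have "d t = (\<psi> 0 - \<phi> 0) + integral {0..t} (\<lambda>s. ?Fz s - ?Fx s)"
      using z x t F by (simp add: integral_solution_def d_def Henstock_Kurzweil_Integration.integral_diff)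
    then have "norm (d t) \<le> norm (\<psi> 0 - \<phi> 0) + norm (integral {0..t} (\<lambda>s. ?Fz s - ?Fx s))"
      by (simp only: norm_triangle_ineq)
    also have "norm (\<psi> 0 - \<phi> 0) \<le> e" by (rule past) auto
    also have "norm (integral {0..t} (\<lambda>s. ?Fz s - ?Fx s)) \<le>
        integral {0..t} (\<lambda>s. norm (g s) + L s * (norm (d s) + norm (d (s - 1))))"
    proof (rule integral_norm_bound_AE)
      show "AE s in lebesgue. s \<in> {0..t} \<longrightarrow>
          norm (?Fz s - ?Fx s) \<le> norm (g s) + L s * (norm (d s) + norm (d (s - 1)))"
        using ae by eventually_elim (use t in \<open>auto simp: d_def\<close>)
    qed (intro integrable_diff F integrable_add gt Ld)+
    also have "\<dots> = integral {0..t} (\<lambda>s. norm (g s)) + integral {0..t} (\<lambda>s. L s * (norm (d s) + norm (d (s - 1))))"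
      by (rule Henstock_Kurzweil_Integration.integral_add[OF gt Ld])
    also have "integral {0..t} (\<lambda>s. norm (g s)) \<le> integral {0..T} (\<lambda>s. norm (g s))"
      by (rule integral_subset_le[OF sub gt gi]) auto
    finally show "norm (d t) \<le> A + integral {0..t} (\<lambda>s. L s * (norm (d s) + norm (d (s - 1))))"
      by (simp add: A_def)
  qed
  also have "\<dots> \<le> 2 * A * exp (4 * (T + C))"
  proof (intro mult_left_mono)
    have "norm (\<psi> 0 - \<phi> 0) \<le> e" by (rule past) auto
    then have "0 \<le> e" using norm_ge_zero[of "\<psi> 0 - \<phi> 0"] by linarith
    then show "0 \<le> 2 * A" using g0 by (simp add: A_def)
    have "integral {0..T} L = integral {0..T} (\<lambda>t. norm (L t))"
      using L(2) by (intro Henstock_Kurzweil_Integration.integral_cong) auto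
    \<comment> \<open>The choice \<open>e = 1\<close> in \<open>integral_norm_le_Lp\<close> turns
      the bound on p-th powers into one on the integral of \<open>L\<close>.\<close>
    also have "\<dots> \<le> T + C"
      using integral_norm_le_Lp[OF L(1) \<open>1 \<le> p\<close>, of 1] \<open>0 \<le> T\<close> L(3) by simp
    finally show "exp (4 * integral {0..T} L) \<le> exp (4 * (T + C))" by simp
  qed
  finally show ?thesis by (simp add: d_def A_def)
qed

text \<open>Both curves lie in one ball, where \<open>f\<close> has a single Lipschitz majorant; the
  comparison with \<open>g = 0\<close> and \<open>e = 0\<close> then bounds the difference by
  0.\<close>

lemma integral_solution_unique:
  fixes f :: "real \<Rightarrow> 'x \<times> 'x \<Rightarrow> 'x::euclidean_space"
  assumes f: "f \<in> LC p" and "1 \<le> p" "0 \<le> T"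
    and x: "integral_solution f \<phi> T x" and y: "integral_solution f \<phi> T y"
    and t: "t \<in> {-1..T}"
  shows "x t = y t"
proof -
  have cx: "continuous_on {-1..T} x" and cy: "continuous_on {-1..T} y"
    using x y by (auto simp: integral_solution_def)
  obtain j1 :: nat where j1: "\<forall>t\<in>{0..T}. norm (x t, x (t - 1)) \<le> real j1"
    using bounded_continuous_on_interval[OF continuous_on_delay_pair[OF cx]] by (elim exE)
  obtain j2 :: nat where j2: "\<forall>t\<in>{0..T}. norm (y t, y (t - 1)) \<le> real j2"
    using bounded_continuous_on_interval[OF continuous_on_delay_pair[OF cy]] by (elim exE)
  define J where "J = j1 + j2"
  have J: "(x s, x (s - 1)) \<in> cball 0 (real J)" "(y s, y (s - 1)) \<in> cball 0 (real J)" if "s \<in> {0..T}" for s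
    using j1[rule_format, OF that] j2[rule_format, OF that] by (simp_all add: J_def)
  obtain l where l: "l \<in> Lp_loc p" "\<forall>t. 0 \<le> l t"
    and lip: "AE t in lebesgue. \<forall>z1\<in>cball 0 (real J). \<forall>z2\<in>cball 0 (real J).
       norm (f t z1 - f t z2) \<le> l t * norm (z1 - z2)"
    using LC_lbound[OF f, of J] by (elim bexE conjE)
  have "norm (x t - y t) \<le> 2 * (0 + integral {0..T} (\<lambda>t. norm (0 :: real))) *
      exp (4 * (T + integral {0..T} (\<lambda>t. norm (l t) ^ p)))"
  proof (rule integral_solution_difference_bound[OF f f \<open>1 \<le> p\<close> \<open>0 \<le> T\<close> x y, where L = l])
    show "(\<lambda>_. 0 :: real) \<in> Lp_on p {0..T}" by (simp add: Lp_on_iff integrable_const_ivl)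
    show "l \<in> Lp_on p {0..T}" using l(1) by (simp add: Lp_loc_def)
    show "AE t in lebesgue. t \<in> {0..T} \<longrightarrow> norm (f t (x t, x (t - 1)) - f t (y t, y (t - 1))) \<le>
        norm (0 :: real) + l t * (norm (x t - y t) + norm (x (t - 1) - y (t - 1)))"
      using lip
    proof eventually_elim
      case (elim s)
      show ?case
      proof
        assume s: "s \<in> {0..T}"
        have "norm (f s (x s, x (s - 1)) - f s (y s, y (s - 1))) \<le> l s * norm ((x s, x (s - 1)) - (y s, y (s - 1)))"
          using elim J[OF s] by blast
        also have "\<dots> \<le> l s * (norm (x s - y s) + norm (x (s - 1) - y (s - 1)))"
          using l(2) by (intro mult_left_mono norm_Pair_diff_le) auto
        finally show "norm (f s (x s, x (s - 1)) - f s (y s, y (s - 1))) \<le>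
            norm (0 :: real) + l s * (norm (x s - y s) + norm (x (s - 1) - y (s - 1)))" by simp
      qed
    qed
  qed (use l(2) t in auto)
  then show ?thesis by simp
qed

text \<open>Only the values of the right-hand side along \<open>x\<close> enter the equation. This
  serves for restriction to shorter intervals, for gluing, and for removing an inactive
  truncation.\<close>

lemma integral_solution_cong:
  assumes x: "integral_solution f \<phi> T x" and "S \<le> T"
    and y: "\<And>t. t \<in> {-1..S} \<Longrightarrow> y t = x t"
    and g: "\<And>t. t \<in> {0..S} \<Longrightarrow> g t (x t, x (t - 1)) = f t (x t, x (t - 1))" and "0 \<le> S"
  shows "integral_solution g \<phi> S y"
  unfolding integral_solution_def
proof (intro conjI ballI)
  have "continuous_on {-1..S} x"
    using x \<open>S \<le> T\<close> by (auto simp: integral_solution_def intro: continuous_on_subset)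
  then show "continuous_on {-1..S} y" by (rule continuous_on_eq) (simp add: y)
  show "y t = \<phi> t" if "t \<in> {-1..0}" for t
    using x y[of t] that \<open>0 \<le> S\<close> by (simp add: integral_solution_def)
  fix t assume t: "t \<in> {0..S}"
  have "integral {0..t} (\<lambda>s. f s (x s, x (s - 1))) = integral {0..t} (\<lambda>s. g s (y s, y (s - 1)))"
    by (rule Henstock_Kurzweil_Integration.integral_cong) (use t in \<open>simp add: y g\<close>)
  then show "y t = \<phi> 0 + integral {0..t} (\<lambda>s. g s (y s, y (s - 1)))"
    using x t \<open>S \<le> T\<close> by (simp add: integral_solution_def y)
qed

lemma integral_solution_abs_continuous:
  fixes f :: "real \<Rightarrow> 'x \<times> 'x \<Rightarrow> 'x::euclidean_space"
  assumes f: "f \<in> LC p" and "1 \<le> p" and x: "integral_solution f \<phi> T x"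
  shows "abs_continuous_on_interval 0 T x"
proof (rule indefinite_integral_abs_continuous)
  show "(\<lambda>s. f s (x s, x (s - 1))) absolutely_integrable_on {0..T}"
    using x by (intro Lp_on_absolutely_integrable[OF _ \<open>1 \<le> p\<close>] LC_Lp_along_delay[OF f])
      (simp add: integral_solution_def)
  show "x t = \<phi> 0 + integral {0..t} (\<lambda>s. f s (x s, x (s - 1)))" if "t \<in> {0..T}" for t
    using x that by (simp add: integral_solution_def)
qed

lemma integral_solution_AE_derivative:
  fixes f :: "real \<Rightarrow> 'x \<times> 'x \<Rightarrow> 'x::euclidean_space"
  assumes f: "f \<in> LC p" and "1 \<le> p" and x: "integral_solution f \<phi> T x"
  shows "AE t in lebesgue. t \<in> {0<..<T} \<longrightarrow> (x has_vector_derivative f t (x t, x (t - 1))) (at t)"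
proof (rule indefinite_integral_AE_derivative)
  have "(\<lambda>s. f s (x s, x (s - 1))) absolutely_integrable_on {0..T}"
    using x by (intro Lp_on_absolutely_integrable[OF _ \<open>1 \<le> p\<close>] LC_Lp_along_delay[OF f])
      (simp add: integral_solution_def)
  then show "(\<lambda>s. f s (x s, x (s - 1))) integrable_on {0..T}"
    by (simp add: absolutely_integrable_on_def)
  show "x t = \<phi> 0 + integral {0..t} (\<lambda>s. f s (x s, x (s - 1)))" if "t \<in> {0..T}" for t
    using x that by (simp add: integral_solution_def)
qed

lemma dde_solutionI:
  fixes f :: "real \<Rightarrow> 'x \<times> 'x \<Rightarrow> 'x::euclidean_space"
  assumes f: "f \<in> LC p" and "1 \<le> p" and "0 < b"
    and x: "\<And>T. \<lbrakk>0 \<le> T; ereal T < b\<rbrakk> \<Longrightarrow> integral_solution f \<phi> T x"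
  shows "dde_solution f \<phi> b x"
  unfolding dde_solution_def
proof (intro conjI allI impI ballI)
  \<comment> \<open>Countably many compact intervals with rational end points exhaust the domain, so
    their exceptional null sets can be united.\<close>
  have q: "\<exists>q\<in>\<rat>. 0 < q \<and> t < q \<and> ereal q < b" if "ereal t < b" for t
  proof -
    have "ereal (max 0 t) < b" using that \<open>0 < b\<close> by (simp add: max_def zero_ereal_def)
    then obtain r where r: "max 0 t < r" "ereal r < b" using ereal_dense2 by (metis less_ereal.simps(1))
    obtain q where "q \<in> \<rat>" "max 0 t < q" "q < r" using Rats_dense_in_real[OF r(1)] by blast
    then show ?thesis using r(2) by (intro bexI[of _ q]) (auto intro: less_trans[of "ereal q" "ereal r"])
  qed
  show "0 < b" by fact
  show "x t = \<phi> t" if "t \<in> {-1..0}" for t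
    using x[of 0] that \<open>0 < b\<close> by (simp add: integral_solution_def zero_ereal_def)
  show "continuous_on {t. -1 \<le> t \<and> ereal t < b} x"
    unfolding continuous_on_eq_continuous_within
  proof
    fix t assume t: "t \<in> {t. -1 \<le> t \<and> ereal t < b}"
    then obtain q where q: "0 < q" "t < q" "ereal q < b" using q[of t] by auto
    have "continuous (at t within {-1..q}) x"
      using x[of q] t q by (simp add: continuous_on_eq_continuous_within integral_solution_def)
    \<comment> \<open>To the left of \<open>q\<close> the half-open domain and
      \<open>{-1..q}\<close> coincide, so continuity at \<open>t < q\<close> transfers.\<close>
    moreover have "at t within {t. -1 \<le> t \<and> ereal t < b} = at t within {-1..q}"
    proof (rule at_within_nhd[of _ "{..<q}"])
      have "ereal s < b" if "s \<le> q" for s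
        using that q(3) by (meson ereal_less_eq(3) le_less_trans)
      then show "{t. -1 \<le> t \<and> ereal t < b} \<inter> {..<q} - {t} = {-1..q} \<inter> {..<q} - {t}" by auto
    qed (use q in auto)
    ultimately show "continuous (at t within {t. -1 \<le> t \<and> ereal t < b}) x" by simp
  qed
  show "abs_continuous_on_interval 0 T x" if "0 \<le> T" "ereal T < b" for T
    by (rule integral_solution_abs_continuous[OF f \<open>1 \<le> p\<close> x[OF that]])
  have "AE t in lebesgue. \<forall>q\<in>\<rat>. 0 < q \<and> ereal q < b \<longrightarrow> t \<in> {0<..<q} \<longrightarrow>
      (x has_vector_derivative f t (x t, x (t - 1))) (at t)"
  proof (subst AE_ball_countable[OF countable_rat], intro ballI)
    fix q :: real
    show "AE t in lebesgue. 0 < q \<and> ereal q < b \<longrightarrow> t \<in> {0<..<q} \<longrightarrow>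
      (x has_vector_derivative f t (x t, x (t - 1))) (at t)"
    proof (cases "0 < q \<and> ereal q < b")
      case True
      then show ?thesis
        using integral_solution_AE_derivative[OF f \<open>1 \<le> p\<close> x[of q]] by (auto elim: eventually_mono)
    qed auto
  qed
  then show "AE t in lebesgue. 0 < t \<and> ereal t < b \<longrightarrow> (x has_vector_derivative f t (x t, x (t - 1))) (at t)"
  proof eventually_elim
    case (elim t)
    show ?case using elim q[of t] by force
  qed
qed

lemma dde_solution_imp_integral_solution:
  fixes f :: "real \<Rightarrow> 'x \<times> 'x \<Rightarrow> 'x::euclidean_space"
  assumes x: "dde_solution f \<phi> b x" and "0 \<le> T" "ereal T < b"
  shows "integral_solution f \<phi> T x"
  unfolding integral_solution_def
proof (intro conjI ballI)
  have Tb: "ereal t < b" if "t \<le> T" for t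
    using that \<open>ereal T < b\<close> by (meson ereal_less_eq(3) le_less_trans)
  have "continuous_on {t. - 1 \<le> t \<and> ereal t < b} x" using x by (simp add: dde_solution_def)
  then show "continuous_on {- 1..T} x"
    by (rule continuous_on_subset) (use Tb in auto)
  show init: "x t = \<phi> t" if "t \<in> {- 1..0}" for t using x that by (simp add: dde_solution_def)
  have "AE t in lebesgue. 0 < t \<and> ereal t < b \<longrightarrow> (x has_vector_derivative f t (x t, x (t - 1))) (at t)"
    using x by (simp add: dde_solution_def)
  from AE_lebesgueE[OF this] obtain N where N: "negligible N"
    "\<And>t. t \<notin> N \<Longrightarrow> 0 < t \<and> ereal t < b \<longrightarrow> (x has_vector_derivative f t (x t, x (t - 1))) (at t)"
    by blast
  fix t assume t: "t \<in> {0..T}"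
  have "((\<lambda>s. f s (x s, x (s - 1))) has_integral (x t - x 0)) {0..t}"
  proof (rule abs_continuous_has_integral)
    show "abs_continuous_on_interval 0 t x" using x t Tb[of t] by (simp add: dde_solution_def)
    \<comment> \<open>The point 0 joins the exceptional set because the equation is required only
      for \<open>t > 0\<close>.\<close>
    show "negligible (N \<union> {0})" using N(1) by (auto intro!: negligible_Un)
    show "(x has_vector_derivative f s (x s, x (s - 1))) (at s within {0..t})" if "s \<in> {0..t} - (N \<union> {0})" for s
      using N(2)[of s] that t Tb[of s] by (auto intro: has_vector_derivative_at_within)
  qed (use t in auto)
  from integral_unique[OF this] init[of 0]
  show "x t = \<phi> 0 + integral {0..t} (\<lambda>s. f s (x s, x (s - 1)))" by simp
qed

section \<open>Projection onto balls and truncated right-hand sides\<close>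

definition ball_proj :: "nat \<Rightarrow> 'x::euclidean_space \<Rightarrow> 'x" where
  "ball_proj j = closest_point (cball 0 (real j))"

lemma norm_ball_proj_le: "norm (ball_proj j x) \<le> real j"
  using closest_point_in_set[of "cball 0 (real j)" x] by (simp add: ball_proj_def)

lemma norm_ball_proj_diff_le: "norm (ball_proj j x - ball_proj j y) \<le> norm (x - y)"
  using closest_point_lipschitz[of "cball 0 (real j)" x y] by (simp add: ball_proj_def dist_norm)

lemma ball_proj_eq: "norm x \<le> real j \<Longrightarrow> ball_proj j x = x"
  by (simp add: ball_proj_def closest_point_self)

lemma continuous_on_ball_proj: "continuous_on S (ball_proj j)"
  unfolding ball_proj_def by (rule continuous_on_closest_point) auto

text \<open>The two components are projected separately, not as a pair: the projected delayed value
  is then the projected curve at time \<open>t - 1\<close>, so one curve serves for both arguments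
  and its modulus of continuity can be used in each. Projected pairs lie in the ball of radius
  \<open>2 * j\<close>.\<close>

definition truncate :: "nat \<Rightarrow> (real \<Rightarrow> 'x::euclidean_space \<times> 'x \<Rightarrow> 'w) \<Rightarrow> real \<Rightarrow> 'x \<times> 'x \<Rightarrow> 'w" where
  "truncate j f t z = f t (ball_proj j (fst z), ball_proj j (snd z))"

lemma ball_proj_pair_mem: "(ball_proj j x, ball_proj j y) \<in> cball 0 (real (2 * j))"
  using norm_Pair_le[of "ball_proj j x" "ball_proj j y"] norm_ball_proj_le[of j x] norm_ball_proj_le[of j y]
  by simp

text \<open>One ball contains all projected pairs, so its m- and l-majorants serve for every compact
  set, and the Lipschitz estimate becomes global in \<open>z\<close>, as the fixed point argument
  requires.\<close>

lemma truncate_LC: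
  fixes f :: "real \<Rightarrow> 'x::euclidean_space \<times> 'x \<Rightarrow> 'w::euclidean_space"
  assumes f: "f \<in> LC p"
  shows "truncate j f \<in> LC p"
    "\<exists>l\<in>Lp_loc p. (\<forall>t. 0 \<le> l t) \<and>
      (AE t in lebesgue. \<forall>z1 z2. norm (truncate j f t z1 - truncate j f t z2) \<le> l t * norm (z1 - z2))"
proof -
  let ?P = "\<lambda>z::'x \<times> 'x. (ball_proj j (fst z), ball_proj j (snd z))"
  have "continuous_on UNIV (\<lambda>x::real \<times> 'x \<times> 'x. (fst x, ?P (snd x)))"
    by (intro continuous_intros continuous_on_compose2[OF continuous_on_ball_proj[of UNIV]]) auto
  then have "(\<lambda>x::real \<times> 'x \<times> 'x. (fst x, ?P (snd x))) \<in> borel_measurable borel"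
    by (rule borel_measurable_continuous_onI)
  moreover have "(\<lambda>(t, z). f t z) \<in> borel_measurable borel" using f by (simp add: LC_def)
  ultimately have "(\<lambda>x. (\<lambda>(t, z). f t z) (fst x, ?P (snd x))) \<in> borel_measurable borel"
    by (rule measurable_compose)
  then have meas: "(\<lambda>(t, z). truncate j f t z) \<in> borel_measurable borel"
    by (simp add: truncate_def split_def)
  obtain m where m: "m \<in> Lp_loc p" "AE t in lebesgue. \<forall>z\<in>cball 0 (real (2 * j)). norm (f t z) \<le> m t"
    using LC_mbound[OF f, of "2 * j"] by (elim bexE conjE)
  obtain l where l: "l \<in> Lp_loc p" "\<forall>t. 0 \<le> l t"
    "AE t in lebesgue. \<forall>z1\<in>cball 0 (real (2 * j)). \<forall>z2\<in>cball 0 (real (2 * j)).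
       norm (f t z1 - f t z2) \<le> l t * norm (z1 - z2)"
    using LC_lbound[OF f, of "2 * j"] by (elim bexE conjE)
  have mb: "AE t in lebesgue. \<forall>z. norm (truncate j f t z) \<le> m t"
    using m(2) by eventually_elim (unfold truncate_def, intro allI, erule bspec, rule ball_proj_pair_mem)
  have P: "norm (?P z1 - ?P z2) \<le> norm (z1 - z2)" for z1 z2 :: "'x \<times> 'x"
    by (simp add: norm_prod_def norm_ball_proj_diff_le real_sqrt_le_mono add_mono power_mono)
  have lb: "AE t in lebesgue. \<forall>z1 z2. norm (truncate j f t z1 - truncate j f t z2) \<le> l t * norm (z1 - z2)"
    using l(3)
  proof eventually_elim
    case (elim t)
    show ?case
    proof (intro allI)
      fix z1 z2
      have "norm (truncate j f t z1 - truncate j f t z2) \<le> l t * norm (?P z1 - ?P z2)"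
        unfolding truncate_def using elim ball_proj_pair_mem by metis
      also have "\<dots> \<le> l t * norm (z1 - z2)" using l(2) P by (intro mult_left_mono) auto
      finally show "norm (truncate j f t z1 - truncate j f t z2) \<le> l t * norm (z1 - z2)" .
    qed
  qed
  show "\<exists>l\<in>Lp_loc p. (\<forall>t. 0 \<le> l t) \<and>
      (AE t in lebesgue. \<forall>z1 z2. norm (truncate j f t z1 - truncate j f t z2) \<le> l t * norm (z1 - z2))"
    using l(1,2) lb by blast
  have "AE t in lebesgue. (\<forall>z\<in>K. norm (truncate j f t z) \<le> m t) \<and>
     (\<forall>z1\<in>K. \<forall>z2\<in>K. norm (truncate j f t z1 - truncate j f t z2) \<le> l t * norm (z1 - z2))" for K
    using mb lb by eventually_elim blast
  with meas m(1) l(1) show "truncate j f \<in> LC p" unfolding LC_def by blast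
qed

section \<open>Global solutions of globally Lipschitz equations\<close>

text \<open>
  Banach's fixed point theorem applies on the whole interval to \<open>w = exp (- 4 \<integral> l) x\<close>: the weight
  makes the integral operator a contraction.
\<close>

lemma integral_solution_exists:
  fixes f :: "real \<Rightarrow> 'x \<times> 'x \<Rightarrow> 'x::euclidean_space"
  assumes f: "f \<in> LC p" and "1 \<le> p" "0 \<le> T" and \<phi>: "continuous_on {-1..0} \<phi>"
    and l: "l \<in> Lp_loc p" "\<And>t. 0 \<le> l t"
    and lip: "AE t in lebesgue. \<forall>z1 z2. norm (f t z1 - f t z2) \<le> l t * norm (z1 - z2)"
  shows "\<exists>x. integral_solution f \<phi> T x"
proof -
  have la: "l absolutely_integrable_on {0..T}"
    using Lp_on_absolutely_integrable[OF _ \<open>1 \<le> p\<close>, of l 0 T] l(1) by (simp add: Lp_loc_def)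
  then have li: "l integrable_on {0..T}" by (simp add: absolutely_integrable_on_def)
  \<comment> \<open>Times are clamped to \<open>[0, T]\<close> so that everything is defined and
    bounded on the whole line and the complete space of bounded continuous functions
    applies.\<close>
  define c where "c t = max 0 (min T t)" for t
  have c: "c t \<in> {0..T}" for t using \<open>0 \<le> T\<close> by (auto simp: c_def)
  have ceq: "c t = t" if "t \<in> {0..T}" for t using that by (auto simp: c_def)
  have c0: "c t = 0" if "t \<le> 0" for t using that \<open>0 \<le> T\<close> by (auto simp: c_def)
  have contc: "continuous_on UNIV c" unfolding c_def by (intro continuous_intros)
  define \<Lambda> where "\<Lambda> t = integral {0..c t} l" for t
  have \<Lambda>cont: "continuous_on UNIV \<Lambda>"
    unfolding \<Lambda>_def
    by (rule continuous_on_compose2[OF indefinite_integral_continuous_1[OF li] contc]) (use c in blast)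
  have li': "l integrable_on {0..c t}" for t
    by (rule integrable_on_subinterval[OF li]) (use c[of t] in auto)
  have \<Lambda>mono: "\<Lambda> s \<le> \<Lambda> t" if "s \<le> t" for s t
    unfolding \<Lambda>_def using that l(2) by (intro integral_subset_le li') (auto simp: c_def)
  have \<Lambda>0: "0 \<le> \<Lambda> t" for t
    unfolding \<Lambda>_def using l(2) by (intro Henstock_Kurzweil_Integration.integral_nonneg li') auto
  define E where "E t = exp (4 * \<Lambda> t)" for t
  have E1: "1 \<le> E t" "0 < E t" for t using \<Lambda>0 by (auto simp: E_def)
  have Emono: "E s \<le> E t" if "s \<le> t" for s t using \<Lambda>mono[OF that] by (simp add: E_def)
  have Econt: "continuous_on S E" for S
    unfolding E_def by (intro continuous_intros continuous_on_subset[OF \<Lambda>cont]) auto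
  \<comment> \<open>\<open>u w\<close> undoes the weight, and \<open>G\<close> below is the integral
    operator conjugated by it: the supremum norm of \<open>w\<close> is a weighted norm of the
    curve.\<close>
  define u where "u w s = E s *\<^sub>R w s" for w :: "real \<Rightarrow> 'x" and s
  define F where "F w s = f s (u w s, u w (s - 1))" for w s
  define past where "past t = \<phi> (max (-1) (min 0 t))" for t
  define G where "G w t = (1 / E t) *\<^sub>R (past t + integral {0..c t} (F w))" for w t
  have ucont: "continuous_on S (u w)" if "continuous_on UNIV w" for S w
    unfolding u_def by (intro continuous_intros Econt continuous_on_subset[OF that]) auto
  have FLp: "F w \<in> Lp_on p {0..T}" if "continuous_on UNIV w" for w
    unfolding F_def by (rule LC_Lp_along_delay[OF f ucont[OF that]])
  have Fa: "F w integrable_on {0..T}" if "continuous_on UNIV w" for w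
    using Lp_on_absolutely_integrable[OF FLp[OF that] \<open>1 \<le> p\<close>] by (simp add: absolutely_integrable_on_def)
  have Fi: "F w integrable_on {0..c t}" if "continuous_on UNIV w" for w t
    by (rule integrable_on_subinterval[OF Fa[OF that]]) (use c[of t] in auto)
  have pastcont: "continuous_on UNIV past"
    unfolding past_def by (rule continuous_on_compose2[OF \<phi>]) (auto intro!: continuous_intros)
  have Gb: "G w \<in> bcontfun" if w: "continuous_on UNIV w" for w
  proof -
    have Ic: "continuous_on {0..T} (\<lambda>t. integral {0..t} (F w))"
      by (rule indefinite_integral_continuous_1[OF Fa[OF w]])
    have "continuous_on UNIV (\<lambda>t. integral {0..c t} (F w))"
      by (rule continuous_on_compose2[OF Ic contc]) (use c in blast)
    then have Gc: "continuous_on UNIV (G w)"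
      unfolding G_def using E1(2) by (intro continuous_intros pastcont Econt) (simp add: less_imp_neq[symmetric])
    obtain B1 where B1: "\<forall>t\<in>{-1..0}. norm (\<phi> t) \<le> real B1"
      using bounded_continuous_on_interval[OF \<phi>] by blast
    obtain B2 where B2: "\<forall>t\<in>{0..T}. norm (integral {0..t} (F w)) \<le> real B2"
      using bounded_continuous_on_interval[OF Ic] by blast
    have "norm (G w t) \<le> real B1 + real B2" for t
    proof -
      have "norm (G w t) \<le> norm (past t + integral {0..c t} (F w))"
        using E1[of t] by (simp add: G_def divide_le_eq mult_le_cancel_left1)
      also have "\<dots> \<le> norm (past t) + norm (integral {0..c t} (F w))" by (rule norm_triangle_ineq)
      also have "\<dots> \<le> real B1 + real B2"
        using B1 B2 c[of t] by (intro add_mono) (auto simp: past_def)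
      finally show ?thesis .
    qed
    with Gc show ?thesis by (rule bcontfun_normI)
  qed
  have contr: "norm (G v t - G w t) \<le> D / 2"
    if v: "continuous_on UNIV v" and w: "continuous_on UNIV w" and D: "\<And>s. norm (v s - w s) \<le> D" for v w t D
  proof -
    have D0: "0 \<le> D" using D[of 0] norm_ge_zero[of "v 0 - w 0"] by linarith
    \<comment> \<open>As in the Gronwall inequality, two arguments and the exponent 4 lead to
      \<open>2 * D * ((E t - 1) / 4) \<le> D / 2 * E t\<close>, hence to the contraction factor
      1/2.\<close>
    have hi: "((\<lambda>s. l s * exp (4 * integral {0..s} l)) has_integral ((exp (4 * integral {0..c t} l) - 1) / 4)) {0..c t}"
      by (rule has_integral_exp_primitive[OF li l(2) _ c]) auto
    then have hi2: "((\<lambda>s. 2 * D * (l s * E s)) has_integral 2 * D * ((E t - 1) / 4)) {0..c t}"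
    proof (intro has_integral_mult_right)
      have "E s = exp (4 * integral {0..s} l)" if "s \<in> {0..c t}" for s
        using ceq[of s] that c[of t] by (auto simp: E_def \<Lambda>_def)
      then show "((\<lambda>s. l s * E s) has_integral (E t - 1) / 4) {0..c t}"
        using hi by (subst has_integral_cong[where g = "\<lambda>s. l s * exp (4 * integral {0..s} l)"])
          (auto simp: E_def \<Lambda>_def)
    qed
    have "norm (integral {0..c t} (F v) - integral {0..c t} (F w)) = norm (integral {0..c t} (\<lambda>s. F v s - F w s))"
      using Fi v w by (simp add: Henstock_Kurzweil_Integration.integral_diff)
    also have "\<dots> \<le> integral {0..c t} (\<lambda>s. 2 * D * (l s * E s))"
    proof (rule integral_norm_bound_AE)
      show "(\<lambda>s. F v s - F w s) integrable_on {0..c t}" using Fi v w by (intro integrable_diff) auto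
      show "(\<lambda>s. 2 * D * (l s * E s)) integrable_on {0..c t}" using hi2 by (rule has_integral_integrable)
      show "AE s in lebesgue. s \<in> {0..c t} \<longrightarrow> norm (F v s - F w s) \<le> 2 * D * (l s * E s)"
        using lip
      proof eventually_elim
        case (elim s)
        have "norm (u v s - u w s) \<le> E s * D"
          using D[of s] E1(2)[of s] by (simp add: u_def scaleR_diff_right[symmetric])
        moreover have "norm (u v (s - 1) - u w (s - 1)) \<le> E s * D"
        proof -
          have "norm (u v (s - 1) - u w (s - 1)) = E (s - 1) * norm (v (s - 1) - w (s - 1))"
            using E1(2)[of "s - 1"] by (simp add: u_def scaleR_diff_right[symmetric])
          also have "\<dots> \<le> E s * D"
            using D[of "s - 1"] E1(2)[of s] Emono[of "s - 1" s] by (intro mult_mono) auto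
          finally show ?thesis .
        qed
        ultimately have "norm ((u v s, u v (s - 1)) - (u w s, u w (s - 1))) \<le> E s * D + E s * D"
          by (intro order_trans[OF norm_Pair_diff_le] add_mono)
        also have "\<dots> = 2 * D * E s" by simp
        finally have "norm ((u v s, u v (s - 1)) - (u w s, u w (s - 1))) \<le> 2 * D * E s" .
        then have "l s * norm ((u v s, u v (s - 1)) - (u w s, u w (s - 1))) \<le> l s * (2 * D * E s)"
          by (rule mult_left_mono[OF _ l(2)])
        then show ?case unfolding F_def by (intro impI order_trans[OF elim[rule_format]]) (simp add: mult.left_commute)
      qed
    qed
    also have "\<dots> = 2 * D * ((E t - 1) / 4)" by (rule integral_unique[OF hi2])
    also have "\<dots> \<le> D / 2 * E t" using D0 by (simp add: algebra_simps)
    finally have *: "norm (integral {0..c t} (F v) - integral {0..c t} (F w)) \<le> D / 2 * E t" .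
    have "G v t - G w t = (1 / E t) *\<^sub>R (integral {0..c t} (F v) - integral {0..c t} (F w))"
      by (simp add: G_def algebra_simps)
    then have "norm (G v t - G w t) = norm (integral {0..c t} (F v) - integral {0..c t} (F w)) / E t"
      using E1(2)[of t] by simp
    with * show ?thesis using E1(2)[of t] by (simp add: divide_le_eq)
  qed
  define \<Phi> where "\<Phi> w = Bcontfun (G (apply_bcontfun w))" for w
  have \<Phi>: "apply_bcontfun (\<Phi> w) = G (apply_bcontfun w)" for w
    unfolding \<Phi>_def by (rule Bcontfun_inverse[OF Gb]) simp
  have "\<exists>!w. \<Phi> w = w"
  proof (rule banach_fix_type)
    show "\<forall>v w. dist (\<Phi> v) (\<Phi> w) \<le> 1 / 2 * dist v w"
    proof (intro allI dist_bound)
      fix v w t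
      show "dist (apply_bcontfun (\<Phi> v) t) (apply_bcontfun (\<Phi> w) t) \<le> 1 / 2 * dist v w"
        using contr[of "apply_bcontfun v" "apply_bcontfun w" "dist v w" t] dist_bounded[of v _ w]
        by (simp add: \<Phi> dist_norm)
    qed
  qed auto
  then obtain w where "\<Phi> w = w" by blast
  then have w: "apply_bcontfun w t = G (apply_bcontfun w) t" for t by (metis \<Phi>)
  define x where "x = u (apply_bcontfun w)"
  have xt: "x t = past t + integral {0..c t} (F (apply_bcontfun w))" for t
    using w[of t] E1(2)[of t] by (simp add: x_def u_def G_def)
  have "integral_solution f \<phi> T x"
    unfolding integral_solution_def
  proof (intro conjI ballI)
    show "continuous_on {-1..T} x" unfolding x_def by (rule ucont) simp
    show "x t = \<phi> t" if "t \<in> {-1..0}" for t using that by (simp add: xt c0 past_def)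
    show "x t = \<phi> 0 + integral {0..t} (\<lambda>s. f s (x s, x (s - 1)))" if "t \<in> {0..T}" for t
    proof -
      have "F (apply_bcontfun w) = (\<lambda>s. f s (x s, x (s - 1)))" by (simp add: F_def x_def fun_eq_iff)
      then show ?thesis using that by (simp add: xt[of t] ceq past_def)
    qed
  qed
  then show ?thesis by (rule exI[of _ x])
qed


lemma integral_solution_truncate:
  assumes "integral_solution (truncate j f) \<phi> T z" "0 \<le> S" "S \<le> T"
    and "\<And>t. t \<in> {-1..S} \<Longrightarrow> norm (z t) \<le> real j"
  shows "integral_solution f \<phi> S z"
  using assms by (intro integral_solution_cong[OF assms(1,3)]) (auto simp: truncate_def ball_proj_eq)

lemma truncated_solution_exists:
  fixes f :: "real \<Rightarrow> 'x \<times> 'x \<Rightarrow> 'x::euclidean_space"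
  assumes f: "f \<in> LC p" and "1 \<le> p" "0 \<le> T" and \<phi>: "continuous_on {-1..0} \<phi>"
  shows "\<exists>z. integral_solution (truncate j f) \<phi> T z"
proof -
  obtain l where l: "l \<in> Lp_loc p" "\<forall>t. 0 \<le> l t"
    "AE t in lebesgue. \<forall>z1 z2. norm (truncate j f t z1 - truncate j f t z2) \<le> l t * norm (z1 - z2)"
    using truncate_LC(2)[OF f, of j] by (elim bexE conjE)
  show ?thesis
    by (rule integral_solution_exists[OF truncate_LC(1)[OF f] assms(2-4) l(1) _ l(3)]) (use l(2) in blast)
qed

section \<open>Maximal solutions\<close>

text \<open>Truncation above the size of \<open>\<phi>\<close> yields a solution on
  \<open>[-1, 1]\<close>; by continuity at 0 it stays below the truncation radius for a short time
  and there solves the original equation.\<close>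

lemma dde_solution_exists:
  fixes f :: "real \<Rightarrow> 'x \<times> 'x \<Rightarrow> 'x::euclidean_space"
  assumes f: "f \<in> LC p" and "1 \<le> p" and \<phi>: "continuous_on {-1..0} \<phi>"
  shows "\<exists>b x. dde_solution f \<phi> b x"
proof -
  obtain j0 :: nat where j0: "\<forall>t\<in>{-1..0}. norm (\<phi> t) \<le> real j0"
    using bounded_continuous_on_interval[OF \<phi>] by blast
  obtain z where z: "integral_solution (truncate (j0 + 1) f) \<phi> 1 z"
    using truncated_solution_exists[OF f \<open>1 \<le> p\<close> _ \<phi>, of 1 "j0 + 1"] by auto
  have cz: "continuous_on {-1..1} z" and z\<phi>: "\<And>t. t \<in> {-1..0} \<Longrightarrow> z t = \<phi> t"
    using z by (auto simp: integral_solution_def)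
  obtain d where d: "d > 0" "\<And>t. t \<in> {-1..1} \<Longrightarrow> dist t 0 < d \<Longrightarrow> dist (z t) (z 0) < 1"
    using cz[unfolded continuous_on_iff, rule_format, of 0 1] by auto
  define S where "S = min (d / 2) 1"
  have S: "0 < S" "S \<le> 1" "S < d" using d(1) by (auto simp: S_def)
  have "norm (z t) \<le> real (j0 + 1)" if "t \<in> {-1..S}" for t
  proof (cases "t \<le> 0")
    case True
    then show ?thesis using that z\<phi>[of t] j0[rule_format, of t] by simp
  next
    case False
    then have "norm (z t - z 0) < 1" using d(2)[of t] that S by (simp add: dist_norm)
    moreover have "norm (z 0) \<le> real j0" using z\<phi>[of 0] j0 by simp
    ultimately show ?thesis using norm_triangle_sub[of "z t" "z 0"] by simp
  qed
  then have "integral_solution f \<phi> S z"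
    using S by (intro integral_solution_truncate[OF z]) auto
  then have "dde_solution f \<phi> (ereal S) z"
    using S(1) by (intro dde_solutionI[OF f \<open>1 \<le> p\<close>]) (auto elim: integral_solution_cong)
  then show ?thesis by blast
qed

lemma dde_solution_unique:
  fixes f :: "real \<Rightarrow> 'x \<times> 'x \<Rightarrow> 'x::euclidean_space"
  assumes f: "f \<in> LC p" and "1 \<le> p"
    and x: "dde_solution f \<phi> b x" and y: "dde_solution f \<phi> c y"
    and t: "-1 \<le> t" "ereal t < b" "ereal t < c"
  shows "x t = y t"
proof -
  have T: "ereal (max 0 t) < b" "ereal (max 0 t) < c"
    using x y t by (auto simp: dde_solution_def max_def zero_ereal_def)
  show ?thesis
    by (rule integral_solution_unique[OF f \<open>1 \<le> p\<close> _ dde_solution_imp_integral_solution[OF x _ T(1)]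
          dde_solution_imp_integral_solution[OF y _ T(2)]]) (use t in auto)
qed

text \<open>By uniqueness all solutions agree where both are defined, so they can be glued, and the
  supremum of the possible end points is attained.\<close>

lemma dde_solution_Sup:
  fixes f :: "real \<Rightarrow> 'x \<times> 'x \<Rightarrow> 'x::euclidean_space"
  assumes f: "f \<in> LC p" and "1 \<le> p" and \<phi>: "continuous_on {-1..0} \<phi>"
  shows "\<exists>X. dde_solution f \<phi> (Sup {b. \<exists>x. dde_solution f \<phi> b x}) X"
proof -
  define S where "S = {b. \<exists>x. dde_solution f \<phi> b x}"
  define \<xi> where "\<xi> b = (SOME x. dde_solution f \<phi> b x)" for b
  have \<xi>: "dde_solution f \<phi> b (\<xi> b)" if "b \<in> S" for b
    using that someI_ex[of "dde_solution f \<phi> b"] unfolding S_def \<xi>_def by blast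
  \<comment> \<open>Which \<open>b\<close> is chosen at \<open>t\<close> does not affect the value,
    again by uniqueness.\<close>
  define X where "X t = \<xi> (SOME b. b \<in> S \<and> ereal t < b) t" for t
  have X: "X t = \<xi> b t" if "b \<in> S" "-1 \<le> t" "ereal t < b" for b t
  proof -
    have "(SOME b. b \<in> S \<and> ereal t < b) \<in> S \<and> ereal t < (SOME b. b \<in> S \<and> ereal t < b)"
      by (rule someI[of _ b]) (use that in blast)
    then show ?thesis
      unfolding X_def using that by (intro dde_solution_unique[OF f \<open>1 \<le> p\<close> \<xi> \<xi>]) auto
  qed
  obtain b0 where b0: "b0 \<in> S" using dde_solution_exists[OF assms] unfolding S_def by blast
  have pos: "0 < b" if "b \<in> S" for b using \<xi>[OF that] by (simp add: dde_solution_def)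
  have "dde_solution f \<phi> (Sup S) X"
  proof (rule dde_solutionI[OF f \<open>1 \<le> p\<close>])
    show "0 < Sup S" using pos[OF b0] Sup_upper[OF b0] by (rule less_le_trans)
    fix T assume T: "0 \<le> T" "ereal T < Sup S"
    then obtain b where b: "b \<in> S" "ereal T < b" by (auto simp: less_Sup_iff)
    have "ereal t < b" if "t \<le> T" for t using that b(2) by (meson ereal_less_eq(3) le_less_trans)
    then show "integral_solution f \<phi> T X"
      using T(1) by (intro integral_solution_cong[OF dde_solution_imp_integral_solution[OF \<xi>[OF b(1)] T(1) b(2)]] X[OF b(1)]) auto
  qed
  then show ?thesis unfolding S_def by blast
qed

text \<open>Every solution is a restriction of the one up to the supremum \<open>B\<close>, so a
  solution without proper extension must end at \<open>B\<close>. This makes the operators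
  \<open>THE\<close> and \<open>SOME\<close> in \<open>dde_end\<close> and \<open>dde_sol\<close>
  meaningful.\<close>

lemma
  fixes f :: "real \<Rightarrow> 'x \<times> 'x \<Rightarrow> 'x::euclidean_space"
  assumes f: "f \<in> LC p" and "1 \<le> p" and \<phi>: "continuous_on {-1..0} \<phi>"
  shows dde_solution_dde_sol: "dde_solution f \<phi> (dde_end f \<phi>) (dde_sol f \<phi>)"
    and dde_end_ge: "dde_solution f \<phi> b x \<Longrightarrow> b \<le> dde_end f \<phi>"
proof -
  define B where "B = Sup {b. \<exists>x. dde_solution f \<phi> b x}"
  have le: "b \<le> B" if "dde_solution f \<phi> b x" for b x
    unfolding B_def by (rule Sup_upper) (use that in blast)
  obtain X where X: "dde_solution f \<phi> B X" using dde_solution_Sup[OF assms] B_def by blast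
  then have max: "maximal_dde_solution f \<phi> B X"
    unfolding maximal_dde_solution_def using le by (auto intro: antisym)
  have unique: "b = B" if "maximal_dde_solution f \<phi> b x" for b x
  proof -
    have x: "dde_solution f \<phi> b x" using that by (simp add: maximal_dde_solution_def)
    have eq: "\<forall>t. -1 \<le> t \<and> ereal t < b \<longrightarrow> X t = x t"
      using dde_solution_unique[OF f \<open>1 \<le> p\<close> X x] less_le_trans[OF _ le[OF x]] by blast
    \<comment> \<open>Maximality of \<open>x\<close> is applied to the glued solution
      \<open>X\<close>, which extends it to \<open>B\<close>.\<close>
    have "B = b"
      by (rule mp[OF spec[where x = X, OF spec[where x = B, OF conjunct2[OF that[unfolded maximal_dde_solution_def]]]]])
        (intro conjI X le[OF x] eq)
    then show ?thesis by simp
  qed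
  have "dde_end f \<phi> = B"
    unfolding dde_end_def by (rule the_equality) (use max unique in \<open>blast+\<close>)
  moreover have "maximal_dde_solution f \<phi> (dde_end f \<phi>) (dde_sol f \<phi>)"
    unfolding dde_sol_def \<open>dde_end f \<phi> = B\<close> 
    by (rule someI[of "maximal_dde_solution f \<phi> B", OF max])
  ultimately show "dde_solution f \<phi> (dde_end f \<phi>) (dde_sol f \<phi>)"
    "dde_solution f \<phi> b x \<Longrightarrow> b \<le> dde_end f \<phi>"
    using le by (auto simp: maximal_dde_solution_def)
qed

section \<open>Convergence from an integral comparison\<close>

text \<open>\<open>\<eta>\<close> is fixed first, so that the term with \<open>L\<close> stays below
  \<open>r / 2\<close> for all \<open>n\<close> thanks to \<open>C\<close>; the term with
  \<open>g\<close> is small for large \<open>n\<close>.\<close>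

lemma power_norm_comparison_tendsto_0:
  fixes D :: "nat \<Rightarrow> real \<Rightarrow> 'w::euclidean_space" and g L :: "nat \<Rightarrow> real \<Rightarrow> real"
  assumes "1 \<le> p" and D: "\<And>n. D n \<in> borel_measurable (lebesgue_on {a..b})"
    and g: "\<And>n. g n \<in> Lp_on p {a..b}" "(\<lambda>n. integral {a..b} (\<lambda>t. norm (g n t) ^ p)) \<longlonglongrightarrow> 0"
    and L: "\<And>n. L n \<in> Lp_on p {a..b}" "\<And>n. integral {a..b} (\<lambda>t. norm (L n t) ^ p) \<le> C"
    and D_le: "\<And>\<eta>. 0 < \<eta> \<Longrightarrow> \<forall>\<^sub>F n in sequentially.
      AE t in lebesgue. t \<in> {a..b} \<longrightarrow> norm (D n t) \<le> norm (g n t) + \<eta> * norm (L n t)"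
  shows "(\<lambda>n. integral {a..b} (\<lambda>t. norm (D n t) ^ p)) \<longlonglongrightarrow> 0"
proof (rule LIMSEQ_I)
  fix r :: real assume "0 < r"
  have C: "0 \<le> C" using L(2)[of 0] integral_norm_power_nonneg[of "{a..b}" "L 0" p] by linarith
  obtain \<eta> where \<eta>: "0 < \<eta>" and \<eta>C: "2 ^ p * (\<eta> ^ p * C) < r / 2"
    using ex_small_power_factor[of "r / 2" C p] \<open>0 < r\<close> C \<open>1 \<le> p\<close> by auto
  have "\<forall>\<^sub>F n in sequentially. integral {a..b} (\<lambda>t. norm (g n t) ^ p) < r / 2 / 2 ^ p"
    using \<open>0 < r\<close> by (intro order_tendstoD(2)[OF g(2)]) auto
  with D_le[OF \<eta>]
  have "\<forall>\<^sub>F n in sequentially. norm (integral {a..b} (\<lambda>t. norm (D n t) ^ p) - 0) < r"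
  proof eventually_elim
    case (elim n)
    let ?h = "\<lambda>t. norm (g n t) + \<eta> * norm (L n t)"
    have L': "(\<lambda>t. \<eta> * norm (L n t)) \<in> Lp_on p {a..b}"
      "integral {a..b} (\<lambda>t. norm (\<eta> * norm (L n t)) ^ p) = \<eta> ^ p * integral {a..b} (\<lambda>t. norm (L n t) ^ p)"
      using Lp_on_scale[OF Lp_on_norm[OF L(1)[of n]], of \<eta>] \<eta> by auto
    note h = Lp_on_add[OF Lp_on_norm[OF g(1)[of n]] L'(1)]
    have D': "D n \<in> Lp_on p {a..b}"
        "integral {a..b} (\<lambda>t. norm (D n t) ^ p) \<le> integral {a..b} (\<lambda>t. norm (?h t) ^ p)"
      using Lp_on_bounded_AE[OF D h(1)] elim(1) by blast+
    note D'(2)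
    also have "integral {a..b} (\<lambda>t. norm (?h t) ^ p) \<le>
        2 ^ p * (integral {a..b} (\<lambda>t. norm (g n t) ^ p) + \<eta> ^ p * integral {a..b} (\<lambda>t. norm (L n t) ^ p))"
      using h(2) unfolding L'(2) by simp
    also have "\<dots> \<le> 2 ^ p * (integral {a..b} (\<lambda>t. norm (g n t) ^ p) + \<eta> ^ p * C)"
      using L(2)[of n] \<eta> by (intro mult_left_mono add_left_mono) auto
    also have "\<dots> < r"
    proof -
      have "2 ^ p * integral {a..b} (\<lambda>t. norm (g n t) ^ p) < r / 2"
        using elim(2) by (simp add: field_simps)
      with \<eta>C show ?thesis by (simp add: algebra_simps)
    qed
    finally have "integral {a..b} (\<lambda>t. norm (D n t) ^ p) < r" .
    then show ?case using integral_norm_power_nonneg[of "{a..b}" "D n" p] by simp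
  qed
  then show "\<exists>N. \<forall>n\<ge>N. norm (integral {a..b} (\<lambda>t. norm (D n t) ^ p) - 0) < r"
    unfolding eventually_sequentially .
qed

text \<open>The comparison is used twice: through Gronwall it gives uniform closeness of the curves,
  and this closeness fed back into it makes the difference of the right-hand sides, that is, of the
  derivatives, tend to 0 in p-th mean.\<close>

lemma integral_solutions_converge:
  fixes hs :: "nat \<Rightarrow> real \<Rightarrow> 'x \<times> 'x \<Rightarrow> 'x::euclidean_space" and g L :: "nat \<Rightarrow> real \<Rightarrow> real"
  assumes hs: "\<And>n. hs n \<in> LC p" and k: "k \<in> LC p" and "1 \<le> p" "0 \<le> T"
    and z: "\<And>n. integral_solution (hs n) (\<phi>s n) T (z n)" and x: "integral_solution k \<phi> T x"
    and lim: "uniform_limit {-1..0} \<phi>s \<phi> sequentially"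
    and g: "\<And>n. g n \<in> Lp_on p {0..T}" "(\<lambda>n. integral {0..T} (\<lambda>t. norm (g n t) ^ p)) \<longlonglongrightarrow> 0"
    and L: "\<And>n. L n \<in> Lp_on p {0..T}" "\<And>n t. 0 \<le> L n t"
      "\<And>n. integral {0..T} (\<lambda>t. norm (L n t) ^ p) \<le> C"
    and ae: "\<And>n. AE t in lebesgue. t \<in> {0..T} \<longrightarrow>
      norm (hs n t (z n t, z n (t - 1)) - k t (x t, x (t - 1))) \<le>
        norm (g n t) + L n t * (norm (z n t - x t) + norm (z n (t - 1) - x (t - 1)))"
  shows "0 < \<eta> \<Longrightarrow> \<forall>\<^sub>F n in sequentially. \<forall>t\<in>{-1..T}. norm (z n t - x t) \<le> \<eta>"
    "(\<lambda>n. integral {0..T} (\<lambda>t. norm (hs n t (z n t, z n (t - 1)) - k t (x t, x (t - 1))) ^ p)) \<longlonglongrightarrow> 0"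
proof -
  have ev: "\<forall>\<^sub>F n in sequentially. \<forall>t\<in>{-1..T}. norm (z n t - x t) \<le> \<eta>" if "0 < \<eta>" for \<eta>
  proof -
    \<comment> \<open>With the initial error and the integral of \<open>g\<close> both at most
      \<open>e\<close>, the Gronwall bound becomes
      \<open>4 * e * exp (4 * (T + C)) = \<eta>\<close>.\<close>
    define e where "e = \<eta> / (4 * exp (4 * (T + C)))"
    have e: "0 < e" using that by (simp add: e_def)
    have "(\<lambda>n. integral {0..T} (\<lambda>t. norm (g n t))) \<longlonglongrightarrow> 0"
      by (rule Lp_tendsto_imp_L1_tendsto[OF g(1) \<open>1 \<le> p\<close> \<open>0 \<le> T\<close> g(2)])
    then have "\<forall>\<^sub>F n in sequentially. integral {0..T} (\<lambda>t. norm (g n t)) < e"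
      using e by (intro order_tendstoD(2)) auto
    moreover have "\<forall>\<^sub>F n in sequentially. \<forall>t\<in>{-1..0}. dist (\<phi>s n t) (\<phi> t) < e"
      using lim e by (rule uniform_limitD)
    ultimately show ?thesis
    proof eventually_elim
      case (elim n)
      show ?case
      proof
        fix t assume t: "t \<in> {-1..T}"
        have "norm (z n t - x t) \<le> 2 * (e + integral {0..T} (\<lambda>t. norm (g n t))) * exp (4 * (T + C))"
        proof (rule integral_solution_difference_bound[OF hs k \<open>1 \<le> p\<close> \<open>0 \<le> T\<close> z x _ g(1) L ae t])
          show "norm (\<phi>s n t - \<phi> t) \<le> e" if "t \<in> {-1..0}" for t
            using elim(2) that by (auto simp: dist_norm intro: less_imp_le)
        qed
        also have "\<dots> \<le> 2 * (e + e) * exp (4 * (T + C))"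
          using elim(1) by (intro mult_right_mono mult_left_mono add_left_mono) auto
        also have "\<dots> = \<eta>" by (simp add: e_def)
        finally show "norm (z n t - x t) \<le> \<eta>" .
      qed
    qed
  qed
  then show "0 < \<eta> \<Longrightarrow> \<forall>\<^sub>F n in sequentially. \<forall>t\<in>{-1..T}. norm (z n t - x t) \<le> \<eta>" .
  have cz: "continuous_on {-1..T} (z n)" and cx: "continuous_on {-1..T} x" for n
    using z[of n] x by (auto simp: integral_solution_def)
  show "(\<lambda>n. integral {0..T} (\<lambda>t. norm (hs n t (z n t, z n (t - 1)) - k t (x t, x (t - 1))) ^ p)) \<longlonglongrightarrow> 0"
  proof (rule power_norm_comparison_tendsto_0[where g = g and L = L and C = C])
    show "(\<lambda>t. hs n t (z n t, z n (t - 1)) - k t (x t, x (t - 1))) \<in> borel_measurable (lebesgue_on {0..T})" for n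
      using LC_Lp_along_delay[OF hs[of n] cz[of n]] LC_Lp_along_delay[OF k cx]
      by (intro borel_measurable_diff) (auto simp: Lp_on_iff)
    fix \<eta> :: real assume "0 < \<eta>"
    then have "\<forall>\<^sub>F n in sequentially. \<forall>t\<in>{-1..T}. norm (z n t - x t) \<le> \<eta> / 2" by (intro ev) simp
    then show "\<forall>\<^sub>F n in sequentially. AE t in lebesgue. t \<in> {0..T} \<longrightarrow>
        norm (hs n t (z n t, z n (t - 1)) - k t (x t, x (t - 1))) \<le> norm (g n t) + \<eta> * norm (L n t)"
    proof eventually_elim
      case (elim n)
      show ?case using ae[of n]
      proof eventually_elim
        case (elim t)
        show ?case
        proof
          assume t: "t \<in> {0..T}"
          have "norm (z n t - x t) + norm (z n (t - 1) - x (t - 1)) \<le> \<eta> / 2 + \<eta> / 2"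
            by (intro add_mono \<open>\<forall>t\<in>{-1..T}. norm (z n t - x t) \<le> \<eta> / 2\<close>[rule_format]) (use t in auto)
          then have "L n t * (norm (z n t - x t) + norm (z n (t - 1) - x (t - 1))) \<le> L n t * \<eta>"
            using L(2) by (intro mult_left_mono) auto
          with elim t L(2)[of n t] show "norm (hs n t (z n t, z n (t - 1)) - k t (x t, x (t - 1))) \<le>
              norm (g n t) + \<eta> * norm (L n t)"
            by (simp add: mult.commute)
        qed
      qed
    qed
  qed (rule \<open>1 \<le> p\<close> g L)+
qed


section \<open>Derivatives and Sobolev norms of solutions\<close>

lemma AE_lebesgue_neq: "AE t in lebesgue. t \<noteq> (a::real)"
  by (rule AE_lebesgueI[of "{a}"]) auto

lemma vector_derivative_within_interval:
  fixes y :: "real \<Rightarrow> 'w::euclidean_space"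
  assumes "(y has_vector_derivative v) (at t)" "0 < t" "t < T"
  shows "vector_derivative y (at t within {0..T}) = v"
  using assms vector_derivative_within_cbox[of 0 T t y v] has_vector_derivative_at_within
  by (metis atLeastAtMost_iff box_real(2) less_imp_le order_less_trans)

lemma integral_solution_vector_derivative:
  fixes f :: "real \<Rightarrow> 'x \<times> 'x \<Rightarrow> 'x::euclidean_space"
  assumes f: "f \<in> LC p" and "1 \<le> p" and x: "integral_solution f \<phi> T x"
  shows "AE t in lebesgue. t \<in> {0..T} \<longrightarrow>
    (x has_vector_derivative f t (x t, x (t - 1))) (at t) \<and> 0 < t \<and> t < T"
  using integral_solution_AE_derivative[OF assms] AE_lebesgue_neq[of 0] AE_lebesgue_neq[of T]
  by eventually_elim auto

lemma integral_solution_C1p: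
  fixes f :: "real \<Rightarrow> 'x \<times> 'x \<Rightarrow> 'x::euclidean_space"
  assumes f: "f \<in> LC p" and "1 \<le> p" and x: "integral_solution f \<phi> T x"
  shows "x \<in> C1p p 0 T"
proof -
  have "(\<lambda>t. vector_derivative x (at t within {0..T})) \<in> Lp_on p {0..T}"
  proof (rule Lp_on_AE_cong)
    show "(\<lambda>t. f t (x t, x (t - 1))) \<in> Lp_on p {0..T}"
      using x by (intro LC_Lp_along_delay[OF f]) (simp add: integral_solution_def)
    show "AE t in lebesgue. t \<in> {0..T} \<longrightarrow>
        f t (x t, x (t - 1)) = vector_derivative x (at t within {0..T})"
      using integral_solution_vector_derivative[OF assms]
      by eventually_elim (auto simp: vector_derivative_within_interval)
  qed
  then show ?thesis
    unfolding C1p_def using integral_solution_abs_continuous[OF assms] by simp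
qed

lemma C1p_norm_diff:
  fixes h k :: "real \<Rightarrow> 'x \<times> 'x \<Rightarrow> 'x::euclidean_space"
  assumes h: "h \<in> LC p" and k: "k \<in> LC p" and "1 \<le> p" "0 \<le> T"
    and y: "integral_solution h \<psi> T y" and x: "integral_solution k \<phi> T x"
    and le: "\<And>t. t \<in> {0..T} \<Longrightarrow> norm (y t - x t) \<le> \<eta>"
  shows "0 \<le> C1p_norm p 0 T (\<lambda>t. y t - x t)"
    and "C1p_norm p 0 T (\<lambda>t. y t - x t) \<le>
      \<eta> + root p (integral {0..T} (\<lambda>t. norm (h t (y t, y (t - 1)) - k t (x t, x (t - 1))) ^ p))"
proof -
  let ?D = "\<lambda>t. h t (y t, y (t - 1)) - k t (x t, x (t - 1))"
  let ?V = "\<lambda>t. vector_derivative (\<lambda>t. y t - x t) (at t within {0..T})"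
  have H: "(\<lambda>t. h t (y t, y (t - 1))) \<in> Lp_on p {0..T}" "(\<lambda>t. k t (x t, x (t - 1))) \<in> Lp_on p {0..T}"
    using x y by (auto intro!: LC_Lp_along_delay h k simp: integral_solution_def)
  have "(\<lambda>t. - k t (x t, x (t - 1))) \<in> Lp_on p {0..T}"
    using H(2) by (auto simp: Lp_on_iff)
  from Lp_on_add(1)[OF H(1) this] have D: "?D \<in> Lp_on p {0..T}" by simp
  have ae: "AE t in lebesgue. t \<in> {0..T} \<longrightarrow> ?D t = ?V t"
    using integral_solution_vector_derivative[OF h \<open>1 \<le> p\<close> y]
      integral_solution_vector_derivative[OF k \<open>1 \<le> p\<close> x]
    by eventually_elim (auto simp: vector_derivative_within_interval[OF has_vector_derivative_diff])
  have V: "Lp_norm p {0..T} ?V = root p (integral {0..T} (\<lambda>t. norm (?D t) ^ p))"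
    using Lp_norm_eq[OF Lp_on_AE_cong(1)[OF D ae]] Lp_on_AE_cong(2)[OF D ae] by simp
  have ne: "{0..T} \<noteq> {}" using \<open>0 \<le> T\<close> by simp
  have "(SUP t\<in>{0..T}. norm (y t - x t)) \<le> \<eta>" by (rule cSUP_least[OF ne le])
  then show "C1p_norm p 0 T (\<lambda>t. y t - x t) \<le> \<eta> + root p (integral {0..T} (\<lambda>t. norm (?D t) ^ p))"
    unfolding C1p_norm_def V by simp
  have "norm (y 0 - x 0) \<le> (SUP t\<in>{0..T}. norm (y t - x t))"
    using le \<open>0 \<le> T\<close> by (intro cSUP_upper bdd_aboveI2) auto
  then have "0 \<le> (SUP t\<in>{0..T}. norm (y t - x t))" using norm_ge_zero order_trans by blast
  then show "0 \<le> C1p_norm p 0 T (\<lambda>t. y t - x t)"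
    unfolding C1p_norm_def V by (intro add_nonneg_nonneg real_root_ge_zero integral_norm_power_nonneg)
qed

text \<open>Interface between the convergence argument and the three topologies: \<open>D\<close> is
  the difference of the right-hand sides, \<open>e\<close> the sum of the distances of the curves at
  the present and the delayed time. The constants \<open>L\<close> may vary with \<open>n\<close> as
  long as their norms stay bounded, which (ii) and (iii) exploit.\<close>

definition dde_comparison ::
    "nat \<Rightarrow> real \<Rightarrow> (nat \<Rightarrow> real \<Rightarrow> 'w::euclidean_space) \<Rightarrow> (nat \<Rightarrow> real \<Rightarrow> real) \<Rightarrow> bool" where
  "dde_comparison p T D e \<longleftrightarrow> (\<exists>g L C.
     (\<forall>n. g n \<in> Lp_on p {0..T}) \<and> (\<lambda>n. integral {0..T} (\<lambda>t. norm (g n t :: real) ^ p)) \<longlonglongrightarrow> 0 \<and>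
     (\<forall>n. L n \<in> Lp_on p {0..T}) \<and> (\<forall>n t. 0 \<le> L n t) \<and>
     (\<forall>n. integral {0..T} (\<lambda>t. norm (L n t :: real) ^ p) \<le> C) \<and>
     (\<forall>n. AE t in lebesgue. t \<in> {0..T} \<longrightarrow> norm (D n t) \<le> norm (g n t) + L n t * e n t))"

lemma dde_comparisonI:
  fixes g L :: "nat \<Rightarrow> real \<Rightarrow> real"
  assumes "\<And>n. g n \<in> Lp_on p {0..T}" "(\<lambda>n. integral {0..T} (\<lambda>t. norm (g n t) ^ p)) \<longlonglongrightarrow> 0"
    and "\<And>n. L n \<in> Lp_on p {0..T}" "\<And>n t. 0 \<le> L n t" "\<And>n. integral {0..T} (\<lambda>t. norm (L n t) ^ p) \<le> C"
    and "\<And>n. AE t in lebesgue. t \<in> {0..T} \<longrightarrow> norm (D n t) \<le> norm (g n t) + L n t * e n t"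
  shows "dde_comparison p T D e"
  unfolding dde_comparison_def
  by (intro exI[of _ g] exI[of _ L] exI[of _ C] conjI allI assms)

text \<open>
  The solutions of the truncated equations are defined on all of \<open>[-1, T]\<close>, so that no exit times
  have to be considered; once they are close to the limit solution the truncation is inactive.
\<close>

lemma dde_sols_convergeI:
  fixes fs :: "nat \<Rightarrow> real \<Rightarrow> 'x \<times> 'x \<Rightarrow> 'x::euclidean_space"
  assumes fs: "\<And>n. fs n \<in> LC p" and f: "f \<in> LC p" and "1 \<le> p"
    and \<phi>s: "\<And>n. continuous_on {-1..0} (\<phi>s n)" and \<phi>: "continuous_on {-1..0} \<phi>"
    and lim: "uniform_limit {-1..0} \<phi>s \<phi> sequentially"
    and comparison: "\<And>T j z x y. \<lbrakk>T \<in> \<rat>; 0 < T; continuous_on {-1..T} x;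
        \<forall>t\<in>{-1..T}. norm (x t) + 1 \<le> real j;
        \<forall>n. integral_solution (truncate j (fs n)) (\<phi>s n) T (z n);
        \<forall>n t. y n t = ball_proj j (z n t)\<rbrakk> \<Longrightarrow>
      dde_comparison p T (\<lambda>n t. fs n t (y n t, y n (t - 1)) - f t (x t, x (t - 1)))
        (\<lambda>n t. norm (y n t - x t) + norm (y n (t - 1) - x (t - 1)))"
  shows "dde_sols_converge p fs \<phi>s f \<phi>"
  unfolding dde_sols_converge_def
proof (intro allI impI)
  fix T :: real assume T: "0 \<le> T" "ereal T < dde_end f \<phi>"
  define x where "x = dde_sol f \<phi>"
  have xsol: "dde_solution f \<phi> (dde_end f \<phi>) x"
    unfolding x_def by (rule dde_solution_dde_sol[OF f \<open>1 \<le> p\<close> \<phi>])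
  \<comment> \<open>The work is done up to a rational \<open>S > T\<close>: the seminorms are given
    on rational intervals, and a solution up to \<open>S\<close> shows that the maximal one is
    defined at \<open>T\<close>.\<close>
  obtain r where r: "T < r" "ereal r < dde_end f \<phi>" using ereal_dense2[OF T(2)] by auto
  obtain S where S: "S \<in> \<rat>" "T < S" "S < r" using Rats_dense_in_real[OF r(1)] by blast
  have S0: "0 < S" "0 \<le> S" using S T by auto
  have "ereal S < ereal r" using S by simp
  then have Send: "ereal S < dde_end f \<phi>" using r(2) by (rule less_trans)
  have xS: "integral_solution f \<phi> S x"
    by (rule dde_solution_imp_integral_solution[OF xsol S0(2) Send])
  have xT: "integral_solution f \<phi> T x"
    by (rule dde_solution_imp_integral_solution[OF xsol T])
  have cx: "continuous_on {-1..S} x" using xS by (simp add: integral_solution_def)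
  obtain j0 :: nat where j0: "\<forall>t\<in>{-1..S}. norm (x t) \<le> real j0"
    using bounded_continuous_on_interval[OF cx] by blast
  \<comment> \<open>The radius exceeds the size of \<open>x\<close> by 1, so the truncation is
    inactive once the error is at most 1.\<close>
  define j where "j = j0 + 1"
  have j: "\<forall>t\<in>{-1..S}. norm (x t) + 1 \<le> real j"
    using j0 by (simp add: j_def)
  have "\<exists>z. integral_solution (truncate j (fs n)) (\<phi>s n) S z" for n
    by (rule truncated_solution_exists[OF fs \<open>1 \<le> p\<close> S0(2) \<phi>s])
  then obtain z where z: "\<And>n. integral_solution (truncate j (fs n)) (\<phi>s n) S (z n)" by metis
  define y where "y n t = ball_proj j (z n t)" for n t
  have "dde_comparison p S (\<lambda>n t. fs n t (y n t, y n (t - 1)) - f t (x t, x (t - 1)))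
      (\<lambda>n t. norm (y n t - x t) + norm (y n (t - 1) - x (t - 1)))"
    by (rule comparison[OF S(1) S0(1) cx j, where z = z]) (simp_all add: z y_def)
  then obtain g :: "nat \<Rightarrow> real \<Rightarrow> real" and L :: "nat \<Rightarrow> real \<Rightarrow> real" and C
    where g: "\<forall>n. g n \<in> Lp_on p {0..S}" "(\<lambda>n. integral {0..S} (\<lambda>t. norm (g n t) ^ p)) \<longlonglongrightarrow> 0"
      and L: "\<forall>n. L n \<in> Lp_on p {0..S}" "\<forall>n t. 0 \<le> L n t"
        "\<forall>n. integral {0..S} (\<lambda>t. norm (L n t) ^ p) \<le> C"
      and ae': "\<forall>n. AE t in lebesgue. t \<in> {0..S} \<longrightarrow>
          norm (fs n t (y n t, y n (t - 1)) - f t (x t, x (t - 1))) \<le>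
            norm (g n t) + L n t * (norm (y n t - x t) + norm (y n (t - 1) - x (t - 1)))"
    unfolding dde_comparison_def by (elim exE conjE)
  \<comment> \<open>The comparison concerns the projected curves. The projection fixes the values of
    \<open>x\<close> and is nonexpansive, so the error of \<open>y\<close> is at most that of
    \<open>z\<close>.\<close>
  have ae: "AE t in lebesgue. t \<in> {0..S} \<longrightarrow>
      norm (truncate j (fs n) t (z n t, z n (t - 1)) - f t (x t, x (t - 1))) \<le>
        norm (g n t) + L n t * (norm (z n t - x t) + norm (z n (t - 1) - x (t - 1)))" for n
    using ae'[rule_format, of n]
  proof eventually_elim
    case (elim t)
    show ?case
    proof
      assume t: "t \<in> {0..S}"
      have "norm (y n s - x s) \<le> norm (z n s - x s)" if "s \<in> {-1..S}" for s
        using norm_ball_proj_diff_le[of j "z n s" "x s"] j[rule_format, OF that] by (simp add: y_def ball_proj_eq)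
      then have "L n t * (norm (y n t - x t) + norm (y n (t - 1) - x (t - 1))) \<le>
          L n t * (norm (z n t - x t) + norm (z n (t - 1) - x (t - 1)))"
        using t L(2) by (intro mult_left_mono add_mono) auto
      then show "norm (truncate j (fs n) t (z n t, z n (t - 1)) - f t (x t, x (t - 1))) \<le>
          norm (g n t) + L n t * (norm (z n t - x t) + norm (z n (t - 1) - x (t - 1)))"
        using elim t by (simp add: truncate_def y_def)
    qed
  qed
  define D where "D n t = truncate j (fs n) t (z n t, z n (t - 1)) - f t (x t, x (t - 1))" for n t
  have close: "\<forall>\<^sub>F n in sequentially. \<forall>t\<in>{-1..S}. norm (z n t - x t) \<le> \<eta>" if "0 < \<eta>" for \<eta>
    by (rule integral_solutions_converge(1)[OF truncate_LC(1)[OF fs] f \<open>1 \<le> p\<close> S0(2) z xS lim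
          g(1)[rule_format] g(2) L(1,2,3)[rule_format] ae that])
  have Dlim: "(\<lambda>n. integral {0..S} (\<lambda>t. norm (D n t) ^ p)) \<longlonglongrightarrow> 0"
    unfolding D_def
    by (rule integral_solutions_converge(2)[OF truncate_LC(1)[OF fs] f \<open>1 \<le> p\<close> S0(2) z xS lim
          g(1)[rule_format] g(2) L(1,2,3)[rule_format] ae])
  have DLp: "D n \<in> Lp_on p {0..S}" for n
  proof -
    have "(\<lambda>t. truncate j (fs n) t (z n t, z n (t - 1))) \<in> Lp_on p {0..S}"
      using z[of n] by (intro LC_Lp_along_delay truncate_LC(1) fs) (simp add: integral_solution_def)
    moreover have "(\<lambda>t. - f t (x t, x (t - 1))) \<in> Lp_on p {0..S}"
      using LC_Lp_along_delay[OF f, of S x] xS by (auto simp: Lp_on_iff integral_solution_def)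
    ultimately show ?thesis using Lp_on_add(1) unfolding D_def by fastforce
  qed
  have Dint: "(\<lambda>t. norm (D n t) ^ p) integrable_on {0..S}" for n using DLp[of n] by (simp add: Lp_on_iff)
  define Y where "Y n = dde_sol (fs n) (\<phi>s n)" for n
  have ysol: "dde_solution (fs n) (\<phi>s n) (dde_end (fs n) (\<phi>s n)) (Y n)" for n
    unfolding Y_def by (rule dde_solution_dde_sol[OF fs \<open>1 \<le> p\<close> \<phi>s])
  \<comment> \<open>Within distance 1 of \<open>x\<close> the truncated solution solves the original
    equation up to \<open>S\<close>; by uniqueness the maximal solution coincides with it and lasts
    beyond \<open>T\<close>.\<close>
  have follow: "ereal T < dde_end (fs n) (\<phi>s n) \<and> (\<forall>t\<in>{-1..T}. Y n t = z n t)"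
    if "\<forall>t\<in>{-1..S}. norm (z n t - x t) \<le> 1" for n
  proof -
    have bound: "norm (z n t) \<le> real j" if "t \<in> {-1..S}" for t
      using \<open>\<forall>t\<in>{-1..S}. norm (z n t - x t) \<le> 1\<close> that j[rule_format, OF that] norm_triangle_sub[of "z n t" "x t"]
      by fastforce
    have zS: "integral_solution (fs n) (\<phi>s n) S (z n)"
      by (rule integral_solution_truncate[OF z S0(2) order_refl bound])
    then have zsol: "dde_solution (fs n) (\<phi>s n) (ereal S) (z n)"
      using S0(1) by (intro dde_solutionI[OF fs \<open>1 \<le> p\<close>]) (auto elim: integral_solution_cong)
    then have "ereal S \<le> dde_end (fs n) (\<phi>s n)"
      by (rule dde_end_ge[OF fs \<open>1 \<le> p\<close> \<phi>s])
    then have e: "ereal t < dde_end (fs n) (\<phi>s n)" if "t \<le> T" for t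
      using that S(2) less_le_trans[of "ereal t" "ereal S"] by simp
    moreover have "Y n t = z n t" if "t \<in> {-1..T}" for t
      using that S(2) by (intro dde_solution_unique[OF fs \<open>1 \<le> p\<close> ysol zsol] e) auto
    ultimately show ?thesis by simp
  qed
  have yT: "integral_solution (fs n) (\<phi>s n) T (Y n)" if "ereal T < dde_end (fs n) (\<phi>s n)" for n
    by (rule dde_solution_imp_integral_solution[OF ysol T(1) that])
  have "dde_sol f \<phi> \<in> C1p p 0 T"
    unfolding x_def[symmetric] by (rule integral_solution_C1p[OF f \<open>1 \<le> p\<close> xT])
  moreover have "\<forall>\<^sub>F n in sequentially. ereal T < dde_end (fs n) (\<phi>s n) \<and> dde_sol (fs n) (\<phi>s n) \<in> C1p p 0 T"
    using close[of 1, simplified]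
  proof eventually_elim
    case (elim n)
    then have "ereal T < dde_end (fs n) (\<phi>s n)" using follow[of n] by simp
    then show ?case
      using integral_solution_C1p[OF fs \<open>1 \<le> p\<close> yT, of n] by (simp add: Y_def)
  qed
  moreover have "(\<lambda>n. C1p_norm p 0 T (\<lambda>t. dde_sol (fs n) (\<phi>s n) t - dde_sol f \<phi> t)) \<longlonglongrightarrow> 0"
    unfolding x_def[symmetric] Y_def[symmetric]
  proof (rule LIMSEQ_I)
    fix r :: real assume "0 < r"
    \<comment> \<open>\<open>\<eta> \<le> 1\<close> keeps the truncation inactive, and
      \<open>\<eta> \<le> r / 2\<close> bounds the supremum part of the norm.\<close>
    define \<eta> where "\<eta> = min 1 (r / 2)"
    have \<eta>: "0 < \<eta>" "\<eta> \<le> 1" "\<eta> \<le> r / 2" using \<open>0 < r\<close> by (auto simp: \<eta>_def)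
    have "(\<lambda>n. root p (integral {0..S} (\<lambda>t. norm (D n t) ^ p))) \<longlonglongrightarrow> root p 0"
      by (rule tendsto_real_root[OF Dlim])
    then have "\<forall>\<^sub>F n in sequentially. root p (integral {0..S} (\<lambda>t. norm (D n t) ^ p)) < r / 2"
      using \<open>0 < r\<close> by (intro order_tendstoD(2)) auto
    with close[OF \<eta>(1)]
    have "\<forall>\<^sub>F n in sequentially. norm (C1p_norm p 0 T (\<lambda>t. Y n t - x t) - 0) < r"
    proof eventually_elim
      case (elim n)
      have "\<forall>t\<in>{-1..S}. norm (z n t - x t) \<le> 1" using elim(1) \<eta>(2) by (meson order_trans)
      from follow[OF this] have e: "ereal T < dde_end (fs n) (\<phi>s n)" and yz: "\<And>t. t \<in> {-1..T} \<Longrightarrow> Y n t = z n t"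
        by auto
      have le: "norm (Y n t - x t) \<le> \<eta>" if "t \<in> {0..T}" for t
        using elim(1) yz[of t] that S(2) by simp
      note norm = C1p_norm_diff[OF fs f \<open>1 \<le> p\<close> T(1) yT[OF e] xT le]
      have "integral {0..T} (\<lambda>t. norm (fs n t (Y n t, Y n (t - 1)) - f t (x t, x (t - 1))) ^ p) =
          integral {0..T} (\<lambda>t. norm (D n t) ^ p)"
      proof (rule Henstock_Kurzweil_Integration.integral_cong)
        fix t assume t: "t \<in> {0..T}"
        have "norm (z n s) \<le> real j" if "s \<in> {-1..T}" for s
        proof -
          have s: "s \<in> {-1..S}" using that S(2) by auto
          then have "norm (z n s - x s) \<le> 1" using elim(1) \<eta>(2) by (meson order_trans)
          then show ?thesis using j[rule_format, OF s] norm_triangle_sub[of "z n s" "x s"] by linarith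
        qed
        then have "truncate j (fs n) t (z n t, z n (t - 1)) = fs n t (Y n t, Y n (t - 1))"
          using t yz[of t] yz[of "t - 1"] by (simp add: truncate_def ball_proj_eq)
        then show "norm (fs n t (Y n t, Y n (t - 1)) - f t (x t, x (t - 1))) ^ p = norm (D n t) ^ p"
          by (simp add: D_def)
      qed
      also have "\<dots> \<le> integral {0..S} (\<lambda>t. norm (D n t) ^ p)"
        using S(2) by (intro integral_subset_le integrable_on_subinterval[OF Dint] Dint) auto
      finally have "root p (integral {0..T} (\<lambda>t. norm (fs n t (Y n t, Y n (t - 1)) - f t (x t, x (t - 1))) ^ p)) \<le>
          root p (integral {0..S} (\<lambda>t. norm (D n t) ^ p))"
        using \<open>1 \<le> p\<close> by (intro real_root_le_mono) auto
      then have "C1p_norm p 0 T (\<lambda>t. Y n t - x t) < r" using norm(2) elim(2) \<eta>(3) by linarith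
      then show ?case using norm(1) by simp
    qed
    then show "\<exists>N. \<forall>n\<ge>N. norm (C1p_norm p 0 T (\<lambda>t. Y n t - x t) - 0) < r"
      unfolding eventually_sequentially .
  qed
  ultimately show "dde_sol f \<phi> \<in> C1p p 0 T \<and>
      (\<forall>\<^sub>F n in sequentially. ereal T < dde_end (fs n) (\<phi>s n) \<and> dde_sol (fs n) (\<phi>s n) \<in> C1p p 0 T) \<and>
      (\<lambda>n. C1p_norm p 0 T (\<lambda>t. dde_sol (fs n) (\<phi>s n) t - dde_sol f \<phi> t)) \<longlonglongrightarrow> 0"
    by blast
qed

section \<open>Measurability of the optimal bounds\<close>

lemma lebesgue_measurable_AE:
  assumes f: "f \<in> measurable lebesgue M" and ae: "AE t in lebesgue. f t = g t" and "\<And>t. g t \<in> space M"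
  shows "g \<in> measurable lebesgue M"
proof (rule measurableI)
  fix A assume A: "A \<in> sets M"
  obtain N where N: "negligible N" "\<And>t. t \<notin> N \<Longrightarrow> f t = g t" using AE_lebesgueE[OF ae] by blast
  have "g -` A = (f -` A - N) \<union> (g -` A \<inter> N)" using N(2) by auto
  moreover have "f -` A \<in> sets lebesgue" using measurable_sets[OF f A] by simp
  moreover have "g -` A \<inter> N \<in> sets lebesgue"
    using N(1) negligible_subset[of N "g -` A \<inter> N"] by (auto intro: negligible_imp_sets)
  ultimately have "g -` A \<in> sets lebesgue"
    using sets.Un sets.Diff negligible_imp_sets[OF N(1)] by metis
  then show "g -` A \<inter> space lebesgue \<in> sets lebesgue" by simp
qed (use assms in auto)

text \<open>By continuity in \<open>s\<close> the supremum equals, for almost every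
  \<open>t\<close>, the one over a countable dense subset of \<open>S\<close>; completeness of
  Lebesgue measure takes care of the remaining null set.\<close>

lemma SUP_measurable_lebesgue:
  fixes h :: "'s::{first_countable_topology, second_countable_topology, metric_space} \<Rightarrow> 'a::euclidean_space \<Rightarrow> real"
  assumes meas: "\<And>s. s \<in> S \<Longrightarrow> h s \<in> borel_measurable lebesgue"
    and cont: "AE t in lebesgue. continuous_on S (\<lambda>s. h s t)"
  shows "(\<lambda>t. SUP s\<in>S. ennreal (h s t)) \<in> borel_measurable lebesgue"
proof -
  obtain T where T: "countable T" "T \<subseteq> S" "S \<subseteq> closure T" using separable by blast
  have "(\<lambda>t. SUP s\<in>T. ennreal (h s t)) \<in> borel_measurable lebesgue"
    using T(2) by (intro borel_measurable_SUP T(1) measurable_compose[OF meas measurable_ennreal]) auto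
  moreover have "AE t in lebesgue. (SUP s\<in>T. ennreal (h s t)) = (SUP s\<in>S. ennreal (h s t))"
    using cont
  proof eventually_elim
    case (elim t)
    show ?case
    proof (rule antisym)
      show "(SUP s\<in>T. ennreal (h s t)) \<le> (SUP s\<in>S. ennreal (h s t))" using T(2) by (rule SUP_subset_mono) simp
      show "(SUP s\<in>S. ennreal (h s t)) \<le> (SUP s\<in>T. ennreal (h s t))"
      proof (rule SUP_least)
        fix s assume s: "s \<in> S"
        then obtain \<sigma> where \<sigma>: "\<And>n. \<sigma> n \<in> T" "\<sigma> \<longlonglongrightarrow> s"
          using T(3) closure_sequential[of s T] by blast
        have "(\<lambda>n. h (\<sigma> n) t) \<longlonglongrightarrow> h s t"
          using continuous_on_sequentially[of S "\<lambda>s. h s t"] elim s \<sigma> T(2) by (auto simp: o_def)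
        then have "(\<lambda>n. ennreal (h (\<sigma> n) t)) \<longlonglongrightarrow> ennreal (h s t)" by (rule tendsto_ennrealI)
        then show "ennreal (h s t) \<le> (SUP s\<in>T. ennreal (h s t))"
          by (rule LIMSEQ_le_const2) (intro exI[of _ 0] allI impI SUP_upper \<sigma>(1))
      qed
    qed
  qed
  ultimately show ?thesis by (rule lebesgue_measurable_AE) simp
qed

lemma LC_measurable_at:
  fixes f :: "real \<Rightarrow> 'z::euclidean_space \<Rightarrow> 'w::euclidean_space"
  assumes "f \<in> LC p"
  shows "(\<lambda>t. f t z) \<in> borel_measurable lebesgue"
proof -
  have "(\<lambda>t. (t, z)) \<in> borel_measurable (borel :: real measure)"
    by (intro borel_measurable_continuous_onI continuous_intros)
  moreover have "(\<lambda>(t, z). f t z) \<in> borel_measurable borel" using assms by (simp add: LC_def)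
  ultimately have "(\<lambda>t. (\<lambda>(t, z). f t z) (t, z)) \<in> borel_measurable borel" by (rule measurable_compose)
  then show ?thesis by (intro measurable_completion) simp
qed

lemma LC_continuous_AE:
  fixes f :: "real \<Rightarrow> 'z::euclidean_space \<Rightarrow> 'w::euclidean_space"
  assumes "f \<in> LC p"
  shows "AE t in lebesgue. continuous_on (cball 0 (real j)) (f t)"
proof -
  obtain l where l: "\<forall>t. 0 \<le> l t" "AE t in lebesgue. \<forall>z1\<in>cball 0 (real j). \<forall>z2\<in>cball 0 (real j).
       norm (f t z1 - f t z2) \<le> l t * norm (z1 - z2)"
    using LC_lbound[OF assms, of j] by (elim bexE conjE)
  show ?thesis using l(2)
  proof eventually_elim
    case (elim t)
    have "(l t)-lipschitz_on (cball 0 (real j)) (f t)"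
      using elim l(1) by (intro lipschitz_onI) (auto simp: dist_norm)
    then show ?case by (rule lipschitz_on_continuous_on)
  qed
qed

lemma mbound_measurable:
  fixes f :: "real \<Rightarrow> 'z::euclidean_space \<Rightarrow> 'w::euclidean_space"
  assumes f: "f \<in> LC p"
  shows "mbound j f \<in> borel_measurable lebesgue"
proof -
  have "(\<lambda>t. SUP z\<in>cball 0 (real j). ennreal (norm (f t z))) \<in> borel_measurable lebesgue"
  proof (rule SUP_measurable_lebesgue)
    show "(\<lambda>t. norm (f t z)) \<in> borel_measurable lebesgue" for z
      using LC_measurable_at[OF f, of z] by measurable
    show "AE t in lebesgue. continuous_on (cball 0 (real j)) (\<lambda>z. norm (f t z))"
      using LC_continuous_AE[OF f, of j] by eventually_elim (rule continuous_on_norm)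
  qed
  then show ?thesis by (simp add: mbound_def[abs_def])
qed

lemma lbound_measurable:
  fixes f :: "real \<Rightarrow> 'z::euclidean_space \<Rightarrow> 'w::euclidean_space"
  assumes f: "f \<in> LC p"
  shows "lbound j f \<in> borel_measurable lebesgue"
proof -
  let ?S = "{(z1, z2). z1 \<in> cball 0 (real j) \<and> z2 \<in> cball 0 (real j) \<and> z1 \<noteq> (z2::'z)}"
  have "(\<lambda>t. SUP z\<in>?S. ennreal (norm (f t (fst z) - f t (snd z)) / norm (fst z - snd z)))
      \<in> borel_measurable lebesgue"
  proof (rule SUP_measurable_lebesgue)
    show "(\<lambda>t. norm (f t (fst z) - f t (snd z)) / norm (fst z - snd z)) \<in> borel_measurable lebesgue" for z
      using LC_measurable_at[OF f, of "fst z"] LC_measurable_at[OF f, of "snd z"] by measurable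
    show "AE t in lebesgue. continuous_on ?S (\<lambda>z. norm (f t (fst z) - f t (snd z)) / norm (fst z - snd z))"
      using LC_continuous_AE[OF f, of j]
    proof eventually_elim
      case (elim t)
      have "continuous_on ?S (\<lambda>z. f t (fst z))" "continuous_on ?S (\<lambda>z. f t (snd z))"
        by (rule continuous_on_compose2[OF elim]; auto intro!: continuous_intros)+
      \<comment> \<open>The index set omits the diagonal, so the quotient is continuous on
        it.\<close>
      then show ?case by (intro continuous_intros) auto
    qed
  qed
  then show ?thesis by (simp add: lbound_def[abs_def] split_def)
qed

lemma l2bound_measurable:
  fixes f :: "real \<Rightarrow> 'x::euclidean_space \<times> 'u::euclidean_space \<Rightarrow> 'w::euclidean_space"
  assumes f: "f \<in> LC p"
  shows "l2bound j f \<in> borel_measurable lebesgue"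
proof -
  let ?S = "{(x, u1, u2). (x, u1) \<in> cball 0 (real j) \<and> (x, u2) \<in> cball 0 (real j) \<and> u1 \<noteq> (u2::'u)} :: ('x \<times> 'u \<times> 'u) set"
  let ?h = "\<lambda>z t. norm (f t (fst z, fst (snd z)) - f t (fst z, snd (snd z))) / norm (fst (snd z) - snd (snd z))"
  have "(\<lambda>t. SUP z\<in>?S. ennreal (?h z t)) \<in> borel_measurable lebesgue"
  proof (rule SUP_measurable_lebesgue)
    show "(\<lambda>t. ?h z t) \<in> borel_measurable lebesgue" for z
      using LC_measurable_at[OF f, of "(fst z, fst (snd z))"] LC_measurable_at[OF f, of "(fst z, snd (snd z))"]
      by measurable
    show "AE t in lebesgue. continuous_on ?S (\<lambda>z. ?h z t)"
      using LC_continuous_AE[OF f, of j]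
    proof eventually_elim
      case (elim t)
      have "continuous_on ?S (\<lambda>z. f t (fst z, fst (snd z)))" "continuous_on ?S (\<lambda>z. f t (fst z, snd (snd z)))"
        by (rule continuous_on_compose2[OF elim]; auto intro!: continuous_intros)+
      then show ?case by (intro continuous_intros) auto
    qed
  qed
  then show ?thesis by (simp add: l2bound_def[abs_def] split_def)
qed

section \<open>Measurable Lipschitz constants with bounded norms\<close>

lemma Lp_on_nn_integral:
  fixes g :: "real \<Rightarrow> 'w::euclidean_space"
  assumes "g \<in> Lp_on p {a..b}"
  shows "(\<integral>\<^sup>+t\<in>{a..b}. ennreal (norm (g t) ^ p) \<partial>lebesgue) = ennreal (integral {a..b} (\<lambda>t. norm (g t) ^ p))"
proof -
  have i: "(\<lambda>t. norm (g t) ^ p) absolutely_integrable_on {a..b}"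
    using assms by (simp add: Lp_on_def)
  then have "integrable lebesgue (\<lambda>t. indicator {a..b} t *\<^sub>R norm (g t) ^ p)"
    by (simp add: set_integrable_def)
  then have "(\<integral>\<^sup>+t. ennreal (indicator {a..b} t *\<^sub>R norm (g t) ^ p) \<partial>lebesgue) =
      ennreal (LINT t|lebesgue. indicator {a..b} t *\<^sub>R norm (g t) ^ p)"
    by (rule nn_integral_eq_integral) auto
  also have "(LINT t|lebesgue. indicator {a..b} t *\<^sub>R norm (g t) ^ p) = integral {a..b} (\<lambda>t. norm (g t) ^ p)"
    using set_lebesgue_integral_eq_integral(2)[OF i] by (simp add: set_lebesgue_integral_def)
  also have "(\<integral>\<^sup>+t. ennreal (indicator {a..b} t *\<^sub>R norm (g t) ^ p) \<partial>lebesgue) =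
      (\<integral>\<^sup>+t\<in>{a..b}. ennreal (norm (g t) ^ p) \<partial>lebesgue)"
    by (rule nn_integral_cong) (simp add: indicator_def)
  finally show ?thesis .
qed

text \<open>The majorant \<open>l\<close> makes \<open>M\<close> finite almost everywhere, and
  \<open>C\<close> then bounds the norm of its real version. Finiteness is recorded separately
  because \<open>enn2real\<close> sends infinity to 0.\<close>

lemma enn2real_bound_Lp:
  fixes M :: "real \<Rightarrow> ennreal"
  assumes meas: "M \<in> borel_measurable lebesgue"
    and l: "l \<in> Lp_loc p" "AE t in lebesgue. M t \<le> ennreal (l t)" "\<And>t. 0 \<le> l t"
    and C: "(\<integral>\<^sup>+t\<in>{-r..r}. M t ^ p \<partial>lebesgue) \<le> ennreal C" "0 \<le> C" and "{a..b} \<subseteq> {-r..r}"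
  shows "(\<lambda>t. enn2real (M t)) \<in> Lp_on p {a..b}"
    and "integral {a..b} (\<lambda>t. norm (enn2real (M t)) ^ p) \<le> C"
    and "AE t in lebesgue. M t = ennreal (enn2real (M t))"
proof -
  show fin: "AE t in lebesgue. M t = ennreal (enn2real (M t))"
    using l(2)
  proof eventually_elim
    case (elim t)
    then have "M t < top" using ennreal_less_top le_less_trans by blast
    then show ?case by simp
  qed
  show Lp: "(\<lambda>t. enn2real (M t)) \<in> Lp_on p {a..b}"
  proof (rule Lp_on_bounded_AE(1))
    show "(\<lambda>t. enn2real (M t)) \<in> borel_measurable (lebesgue_on {a..b})"
      by (rule measurable_restrict_space1[OF borel_measurable_enn2real[OF meas]])
    show "l \<in> Lp_on p {a..b}" using l(1) by (simp add: Lp_loc_def)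
    show "AE t in lebesgue. t \<in> {a..b} \<longrightarrow> norm (enn2real (M t)) \<le> l t"
      using l(2) by eventually_elim (use l(3) in \<open>simp add: enn2real_leI\<close>)
  qed
  have "ennreal (integral {a..b} (\<lambda>t. norm (enn2real (M t)) ^ p)) =
      (\<integral>\<^sup>+t\<in>{a..b}. ennreal (norm (enn2real (M t)) ^ p) \<partial>lebesgue)"
    by (rule Lp_on_nn_integral[OF Lp, symmetric])
  also have "\<dots> \<le> (\<integral>\<^sup>+t\<in>{-r..r}. M t ^ p \<partial>lebesgue)"
  proof (rule nn_integral_mono_AE)
    show "AE t in lebesgue. ennreal (norm (enn2real (M t)) ^ p) * indicator {a..b} t \<le> M t ^ p * indicator {-r..r} t"
      using fin
    proof eventually_elim
      case (elim t)
      have "ennreal (norm (enn2real (M t)) ^ p) = M t ^ p"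
        by (subst (2) elim) (simp add: ennreal_power)
      then show ?case using \<open>{a..b} \<subseteq> {-r..r}\<close> by (auto simp: indicator_def)
    qed
  qed
  also have "\<dots> \<le> ennreal C" by (rule C)
  finally show "integral {a..b} (\<lambda>t. norm (enn2real (M t)) ^ p) \<le> C" using C(2) by simp
qed

lemma lbound_le:
  fixes f :: "real \<Rightarrow> 'z::euclidean_space \<Rightarrow> 'w::euclidean_space"
  assumes "\<And>z1 z2. \<lbrakk>z1 \<in> cball 0 (real j); z2 \<in> cball 0 (real j)\<rbrakk> \<Longrightarrow> norm (f t z1 - f t z2) \<le> c * norm (z1 - z2)"
  shows "lbound j f t \<le> ennreal c"
  unfolding lbound_def
proof (rule SUP_least, clarify)
  fix z1 z2 :: 'z assume z: "z1 \<in> cball 0 (real j)" "z2 \<in> cball 0 (real j)" "z1 \<noteq> z2"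
  then have "norm (f t z1 - f t z2) / norm (z1 - z2) \<le> c"
    using assms[OF z(1,2)] by (simp add: divide_le_eq)
  then show "ennreal (norm (f t z1 - f t z2) / norm (z1 - z2)) \<le> ennreal c" by (rule ennreal_leI)
qed

text \<open>Points with equal first component are at distance \<open>norm (u1 - u2)\<close>, so the
  supremum runs over a part of the one for \<open>lbound\<close>. In this way \<open>l2bound\<close>
  inherits finiteness almost everywhere.\<close>

lemma l2bound_le_lbound:
  fixes f :: "real \<Rightarrow> 'x::euclidean_space \<times> 'u::euclidean_space \<Rightarrow> 'w::euclidean_space"
  shows "l2bound j f t \<le> lbound j f t"
  unfolding l2bound_def
proof (rule SUP_least, clarify)
  fix x :: 'x and u1 u2 :: 'u
  assume z: "(x, u1) \<in> cball 0 (real j)" "(x, u2) \<in> cball 0 (real j)" "u1 \<noteq> u2"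
  have "ennreal (norm (f t (x, u1) - f t (x, u2)) / norm ((x, u1) - (x, u2))) \<le> lbound j f t"
    unfolding lbound_def using z by (intro SUP_upper2[of "((x, u1), (x, u2))"]) auto
  then show "ennreal (norm (f t (x, u1) - f t (x, u2)) / norm (u1 - u2)) \<le> lbound j f t" by simp
qed

lemma le_enn2real_bound:
  fixes M :: ennreal
  assumes "ennreal (a / b) \<le> M" "M = ennreal (enn2real M)" "0 < b"
  shows "a \<le> enn2real M * b"
proof -
  have "a / b \<le> enn2real M"
    using assms(1) by (subst (asm) assms(2)) (simp only: ennreal_le_iff[OF enn2real_nonneg])
  then show ?thesis using assms(3) by (simp add: divide_le_eq)
qed

lemma SUP_finite_bound:
  fixes F :: "'f \<Rightarrow> ennreal"
  assumes "(SUP f\<in>E. F f) < \<infinity>"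
  shows "\<exists>C\<ge>0. \<forall>f\<in>E. F f \<le> ennreal C"
proof (intro exI[of _ "enn2real (SUP f\<in>E. F f)"] conjI ballI)
  fix f assume "f \<in> E"
  then have "F f \<le> (SUP f\<in>E. F f)" by (rule SUP_upper)
  then show "F f \<le> ennreal (enn2real (SUP f\<in>E. F f))" using assms by (simp add: less_top)
qed simp

lemma LC_lbound_AE:
  fixes f :: "real \<Rightarrow> 'z::euclidean_space \<Rightarrow> 'w::euclidean_space"
  assumes f: "f \<in> LC p"
  shows "\<exists>l\<in>Lp_loc p. (\<forall>t. 0 \<le> l t) \<and> (AE t in lebesgue. lbound j f t \<le> ennreal (l t))"
proof -
  obtain l where l: "l \<in> Lp_loc p" "\<forall>t. 0 \<le> l t" "AE t in lebesgue. \<forall>z1\<in>cball 0 (real j). \<forall>z2\<in>cball 0 (real j).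
       norm (f t z1 - f t z2) \<le> l t * norm (z1 - z2)"
    using LC_lbound[OF f, of j] by (elim bexE conjE)
  have "AE t in lebesgue. lbound j f t \<le> ennreal (l t)"
    using l(3) by eventually_elim (rule lbound_le, blast)
  then show ?thesis using l(1,2) by blast
qed

text \<open>\<open>M\<close> stands for \<open>lbound j\<close> in one application and for
  \<open>l2bound j\<close> in the other. Comparison with \<open>lbound\<close> gives finiteness
  almost everywhere, and \<open>C\<close> is common to all of \<open>E\<close>.\<close>

lemma uniform_bound_Lp:
  fixes E :: "(real \<Rightarrow> 'z::euclidean_space \<Rightarrow> 'w::euclidean_space) set" and M :: "(real \<Rightarrow> 'z \<Rightarrow> 'w) \<Rightarrow> real \<Rightarrow> ennreal"
  assumes E: "E \<subseteq> LC p" and meas: "\<And>f. f \<in> LC p \<Longrightarrow> M f \<in> borel_measurable lebesgue"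
    and le: "\<And>f t. M f t \<le> lbound j f t"
    and bd: "\<And>r. 0 < r \<Longrightarrow> (SUP f\<in>E. \<integral>\<^sup>+t\<in>{-r..r}. M f t ^ p \<partial>lebesgue) < \<infinity>"
  shows "\<exists>C. \<forall>f\<in>E. (\<lambda>t. enn2real (M f t)) \<in> Lp_on p {0..T} \<and>
    integral {0..T} (\<lambda>t. norm (enn2real (M f t)) ^ p) \<le> C \<and>
    (AE t in lebesgue. M f t = ennreal (enn2real (M f t)))"
proof -
  define r where "r = max 1 T"
  have r: "0 < r" "{0..T} \<subseteq> {-r..r}" by (auto simp: r_def)
  obtain C where C: "0 \<le> C" "\<forall>f\<in>E. (\<integral>\<^sup>+t\<in>{-r..r}. M f t ^ p \<partial>lebesgue) \<le> ennreal C"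
    using SUP_finite_bound[OF bd[OF r(1)]] by (elim exE conjE)
  show ?thesis
  proof (intro exI[of _ C] ballI)
    fix f assume "f \<in> E"
    then have f: "f \<in> LC p" using E by blast
    obtain l where l: "l \<in> Lp_loc p" "\<forall>t. 0 \<le> l t" "AE t in lebesgue. lbound j f t \<le> ennreal (l t)"
      using LC_lbound_AE[OF f, of j] by (elim bexE conjE)
    have "AE t in lebesgue. M f t \<le> ennreal (l t)"
      using l(3) by eventually_elim (rule order_trans[OF le])
    note b = enn2real_bound_Lp[OF meas[OF f] l(1) this l(2)[rule_format] C(2)[rule_format, OF \<open>f \<in> E\<close>] C(1) r(2)]
    show "(\<lambda>t. enn2real (M f t)) \<in> Lp_on p {0..T} \<and>
      integral {0..T} (\<lambda>t. norm (enn2real (M f t)) ^ p) \<le> C \<and>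
      (AE t in lebesgue. M f t = ennreal (enn2real (M f t)))"
      by (intro conjI b)
  qed
qed

lemma lbound_lipschitz:
  fixes f :: "real \<Rightarrow> 'z::euclidean_space \<Rightarrow> 'w::euclidean_space"
  assumes fin: "lbound j f t = ennreal (enn2real (lbound j f t))"
    and z: "z1 \<in> cball 0 (real j)" "z2 \<in> cball 0 (real j)"
  shows "norm (f t z1 - f t z2) \<le> enn2real (lbound j f t) * norm (z1 - z2)"
proof (cases "z1 = z2")
  case False
  have "ennreal (norm (f t z1 - f t z2) / norm (z1 - z2)) \<le> lbound j f t"
    unfolding lbound_def using z False by (intro SUP_upper2[of "(z1, z2)"]) auto
  then show ?thesis by (rule le_enn2real_bound[OF _ fin]) (use False in simp)
qed simp

lemma l2bound_lipschitz:
  fixes f :: "real \<Rightarrow> 'x::euclidean_space \<times> 'u::euclidean_space \<Rightarrow> 'w::euclidean_space"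
  assumes fin: "l2bound j f t = ennreal (enn2real (l2bound j f t))"
    and z: "(x, u1) \<in> cball 0 (real j)" "(x, u2) \<in> cball 0 (real j)"
  shows "norm (f t (x, u1) - f t (x, u2)) \<le> enn2real (l2bound j f t) * norm (u1 - u2)"
proof (cases "u1 = u2")
  case False
  have "ennreal (norm (f t (x, u1) - f t (x, u2)) / norm (u1 - u2)) \<le> l2bound j f t"
    unfolding l2bound_def using z False by (intro SUP_upper2[of "(x, u1, u2)"]) auto
  then show ?thesis by (rule le_enn2real_bound[OF _ fin]) (use False in simp)
qed simp

lemma Lp_on_add_uniform_bound:
  fixes l :: "real \<Rightarrow> real" and k :: "nat \<Rightarrow> real \<Rightarrow> real"
  assumes l: "l \<in> Lp_on p {a..b}" and k: "\<And>n. k n \<in> Lp_on p {a..b}" "\<And>n. integral {a..b} (\<lambda>t. norm (k n t) ^ p) \<le> C"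
  shows "\<exists>C. \<forall>n. (\<lambda>t. l t + k n t) \<in> Lp_on p {a..b} \<and> integral {a..b} (\<lambda>t. norm (l t + k n t) ^ p) \<le> C"
proof (intro exI allI conjI)
  fix n
  show "(\<lambda>t. l t + k n t) \<in> Lp_on p {a..b}" by (rule Lp_on_add(1)[OF l k(1)])
  have "2 ^ p * (integral {a..b} (\<lambda>t. norm (l t) ^ p) + integral {a..b} (\<lambda>t. norm (k n t) ^ p)) \<le>
      2 ^ p * (integral {a..b} (\<lambda>t. norm (l t) ^ p) + C)"
    using k(2) by (intro mult_left_mono add_left_mono) auto
  then show "integral {a..b} (\<lambda>t. norm (l t + k n t) ^ p) \<le> 2 ^ p * (integral {a..b} (\<lambda>t. norm (l t) ^ p) + C)"
    by (rule order_trans[OF Lp_on_add(2)[OF l k(1)]])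
qed

section \<open>Moduli of continuity given by the m-bounds\<close>

text \<open>Equicontinuity controls short intervals only; \<open>{s..t}\<close> is covered by
  finitely many of them, their number being independent of \<open>f\<close>, and each contributes at
  most 1.\<close>

lemma mbound_integrals_finite:
  fixes E :: "(real \<Rightarrow> 'z::euclidean_space \<Rightarrow> 'w::euclidean_space) set"
  assumes E: "E \<subseteq> LC p" and eq: "L1loc_equicontinuous_mbounds E"
  shows "(SUP f\<in>E. \<integral>\<^sup>+u\<in>{s..t}. mbound j f u \<partial>lebesgue) < \<infinity>"
proof (cases "s \<le> t")
  case False
  then have "(\<integral>\<^sup>+u\<in>{s..t}. mbound j f u \<partial>lebesgue) = 0" for f by simp
  then have "(SUP f\<in>E. \<integral>\<^sup>+u\<in>{s..t}. mbound j f u \<partial>lebesgue) \<le> 0" by (intro SUP_least) simp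
  then show ?thesis by simp
next
  case True
  define r where "r = \<bar>s\<bar> + \<bar>t\<bar> + 1"
  have r: "0 < r" "- r \<le> s" "t \<le> r" by (auto simp: r_def)
  obtain \<delta> where \<delta>: "\<delta> > 0" "\<forall>s t. - r \<le> s \<and> s \<le> t \<and> t \<le> r \<and> t - s < \<delta> \<longrightarrow>
        (SUP f\<in>E. \<integral>\<^sup>+u\<in>{s..t}. mbound j f u \<partial>lebesgue) < ennreal 1"
    using eq[unfolded L1loc_equicontinuous_mbounds_def, THEN spec[of _ j], THEN spec[of _ r],
        THEN mp, OF r(1), THEN spec[of _ 1], THEN mp, OF zero_less_one]
    by (elim exE conjE)
  obtain N :: nat where N: "(t - s) / \<delta> < real N" using reals_Archimedean2 by blast
  have N0: "0 < real N" using N True \<delta>(1) by (meson divide_nonneg_pos diff_ge_0_iff_ge le_less_trans)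
  define h where "h = (t - s) / real N"
  have h: "0 \<le> h" "h < \<delta>" "real N * h = t - s"
    using True N N0 \<delta>(1) by (auto simp: h_def field_simps)
  have small: "(\<integral>\<^sup>+u\<in>{c..d}. mbound j f u \<partial>lebesgue) \<le> 1"
    if "f \<in> E" "s \<le> c" "c \<le> d" "d \<le> t" "d - c \<le> h" for f c d
  proof -
    have "(\<integral>\<^sup>+u\<in>{c..d}. mbound j f u \<partial>lebesgue) \<le> (SUP f\<in>E. \<integral>\<^sup>+u\<in>{c..d}. mbound j f u \<partial>lebesgue)"
      using that(1) by (rule SUP_upper)
    also have "\<dots> < ennreal 1" using \<delta>(2)[rule_format, of c d] that r h(2) by simp
    finally show ?thesis by simp
  qed
  \<comment> \<open>The bound is \<open>Suc k\<close> because the degenerate interval at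
    \<open>k = 0\<close> is also estimated by 1.\<close>
  have steps: "(\<integral>\<^sup>+u\<in>{s..s + real k * h}. mbound j f u \<partial>lebesgue) \<le> of_nat (Suc k)" if f: "f \<in> E" and "k \<le> N" for f k
    using that(2)
  proof (induction k)
    case 0
    show ?case using small[OF f, of s s] True h by simp
  next
    case (Suc k)
    let ?c = "s + real k * h" and ?d = "s + real (Suc k) * h"
    have m: "mbound j f \<in> borel_measurable lebesgue" using mbound_measurable f E by blast
    have "real (Suc k) * h \<le> real N * h" using Suc.prems h(1) by (intro mult_right_mono) auto
    then have cd: "s \<le> ?c" "?c \<le> ?d" "?d \<le> t" "?d - ?c \<le> h" using h by (auto simp: algebra_simps)
    have "(\<integral>\<^sup>+u\<in>{s..?d}. mbound j f u \<partial>lebesgue) \<le>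
        (\<integral>\<^sup>+u. mbound j f u * indicator {s..?c} u + mbound j f u * indicator {?c..?d} u \<partial>lebesgue)"
      using cd by (intro nn_integral_mono) (auto simp: indicator_def)
    also have "\<dots> = (\<integral>\<^sup>+u\<in>{s..?c}. mbound j f u \<partial>lebesgue) + (\<integral>\<^sup>+u\<in>{?c..?d}. mbound j f u \<partial>lebesgue)"
      by (intro nn_integral_add borel_measurable_times_ennreal m borel_measurable_indicator) auto
    also have "\<dots> \<le> of_nat (Suc k) + 1"
      using Suc by (intro add_mono small[OF f cd]) auto
    finally show ?case by (simp add: add.commute)
  qed
  have "(SUP f\<in>E. \<integral>\<^sup>+u\<in>{s..t}. mbound j f u \<partial>lebesgue) \<le> of_nat (Suc N)"
    using steps[OF _ order_refl] h(3) by (intro SUP_least) simp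
  also have "\<dots> < \<infinity>" by (simp add: of_nat_less_top)
  finally show ?thesis .
qed

text \<open>\<open>mbound_moduli\<close> passes through \<open>enn2real\<close>, which sends
  infinity to 0. The estimate therefore rests on the finiteness of the supremum, obtained from the
  single interval \<open>{a..b + s}\<close> that contains all \<open>{t..t + s}\<close>.\<close>

lemma mbound_integral_le_moduli:
  fixes E :: "(real \<Rightarrow> 'z::euclidean_space \<Rightarrow> 'w::euclidean_space) set"
  assumes E: "E \<subseteq> LC p" and eq: "L1loc_equicontinuous_mbounds E"
    and "f \<in> E" "t \<in> {a..b}"
  shows "(\<integral>\<^sup>+u\<in>{t..t + s}. mbound j f u \<partial>lebesgue) \<le> ennreal (mbound_moduli E j a b s)"
proof -
  define S where "S = (SUP (t, f)\<in>{a..b} \<times> E. \<integral>\<^sup>+u\<in>{t..t + s}. mbound j f u \<partial>lebesgue)"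
  have "S \<le> (SUP f\<in>E. \<integral>\<^sup>+u\<in>{a..b + s}. mbound j f u \<partial>lebesgue)"
    unfolding S_def
  proof (rule SUP_least, clarify)
    fix t f assume "t \<in> {a..b}" "f \<in> E"
    then show "(\<integral>\<^sup>+u\<in>{t..t + s}. mbound j f u \<partial>lebesgue) \<le> (SUP f\<in>E. \<integral>\<^sup>+u\<in>{a..b + s}. mbound j f u \<partial>lebesgue)"
      by (intro SUP_upper2[of f] nn_integral_mono) (auto simp: indicator_def)
  qed
  also have "\<dots> < \<infinity>" by (rule mbound_integrals_finite[OF E eq])
  finally have "ennreal (enn2real S) = S" by simp
  moreover have "(\<integral>\<^sup>+u\<in>{t..t + s}. mbound j f u \<partial>lebesgue) \<le> S"
    unfolding S_def using assms(3,4) by (intro SUP_upper2[of "(t, f)"]) auto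
  ultimately show ?thesis by (simp add: mbound_moduli_def S_def)
qed

lemma norm_integral_le_moduli:
  fixes E :: "(real \<Rightarrow> 'z::euclidean_space \<Rightarrow> 'w::euclidean_space) set"
  assumes E: "E \<subseteq> LC p" and eq: "L1loc_equicontinuous_mbounds E"
    and f: "f \<in> E" and uv: "u \<in> {a..b}" "u \<le> v"
    and F: "(\<lambda>t. f t (y t)) absolutely_integrable_on {u..v}"
    and y: "\<And>t. t \<in> {u..v} \<Longrightarrow> y t \<in> cball 0 (real j)"
  shows "norm (integral {u..v} (\<lambda>t. f t (y t))) \<le> mbound_moduli E j a b (v - u)"
proof -
  have "(\<lambda>t. f t (y t)) \<in> Lp_on 1 {u..v}"
    using absolutely_integrable_measurable[of "{u..v}" "\<lambda>t. f t (y t)"] F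
    by (simp add: Lp_on_iff absolutely_integrable_on_def)
  from Lp_on_nn_integral[OF this]
  have I: "ennreal (integral {u..v} (\<lambda>t. norm (f t (y t)))) = (\<integral>\<^sup>+t\<in>{u..v}. ennreal (norm (f t (y t))) \<partial>lebesgue)"
    by simp
  have "ennreal (norm (integral {u..v} (\<lambda>t. f t (y t)))) \<le> ennreal (integral {u..v} (\<lambda>t. norm (f t (y t))))"
    using F by (intro ennreal_leI Henstock_Kurzweil_Integration.integral_norm_bound_integral)
      (auto simp: absolutely_integrable_on_def)
  also have "\<dots> \<le> (\<integral>\<^sup>+t\<in>{u..v}. mbound j f t \<partial>lebesgue)"
    unfolding I mbound_def using y
    by (intro nn_integral_mono) (auto simp: indicator_def intro: SUP_upper)
  also have "\<dots> \<le> ennreal (mbound_moduli E j a b (v - u))"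
    using mbound_integral_le_moduli[OF E eq f uv(1), where s = "v - u" and j = j] by simp
  finally show ?thesis by (simp add: mbound_moduli_def)
qed

text \<open>Increments of \<open>z\<close> are integrals of \<open>f\<close> along pairs in the ball
  of radius \<open>2 * j\<close>, hence bounded by the m-bound with that index, and the projection
  does not increase them. This admits the projected solutions to the suprema in the first two
  topologies.\<close>

lemma truncated_solution_moduli:
  fixes E :: "(real \<Rightarrow> 'x \<times> 'x \<Rightarrow> 'x::euclidean_space) set"
  assumes E: "E \<subseteq> LC p" and "1 \<le> p" and eq: "L1loc_equicontinuous_mbounds E"
    and f: "f \<in> E" and z: "integral_solution (truncate j f) \<psi> T z"
    and ab: "0 \<le> a" "b \<le> T"
  shows "(\<lambda>t. ball_proj j (z t)) \<in> moduli_functions (mbound_moduli E) (2 * j) a b"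
proof -
  have cz: "continuous_on {-1..T} z" using z by (simp add: integral_solution_def)
  have fLC: "f \<in> LC p" using f E by blast
  let ?F = "\<lambda>t. f t (ball_proj j (z t), ball_proj j (z (t - 1)))"
  have Fa: "?F absolutely_integrable_on {0..T}"
    using Lp_on_absolutely_integrable[OF LC_Lp_along_delay[OF truncate_LC(1)[OF fLC] cz] \<open>1 \<le> p\<close>]
    by (simp add: truncate_def)
  then have Fi: "?F integrable_on {0..T}" by (simp add: absolutely_integrable_on_def)
  have zt: "z t = \<psi> 0 + integral {0..t} ?F" if "t \<in> {0..T}" for t
    using z that by (simp add: integral_solution_def truncate_def)
  have *: "norm (ball_proj j (z v) - ball_proj j (z u)) \<le> mbound_moduli E (2 * j) a b (v - u)"
    if uv: "u \<in> {a..b}" "v \<in> {a..b}" "u \<le> v" for u v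
  proof -
    have "norm (ball_proj j (z v) - ball_proj j (z u)) \<le> norm (z v - z u)" by (rule norm_ball_proj_diff_le)
    also have "z v - z u = integral {u..v} ?F"
      using integral_increment[OF Fi zt, of u v] uv ab by simp
    also have "norm \<dots> \<le> mbound_moduli E (2 * j) a b (v - u)"
      using uv ab
      by (intro norm_integral_le_moduli[OF E eq f] absolutely_integrable_on_subinterval[OF Fa] ball_proj_pair_mem) auto
    finally show ?thesis .
  qed
  show ?thesis
    unfolding moduli_functions_def
  proof (intro CollectI conjI ballI)
    show "continuous_on {a..b} (\<lambda>t. ball_proj j (z t))"
      by (rule continuous_on_compose2[OF continuous_on_ball_proj[of UNIV] continuous_on_subset[OF cz]]) (use ab in auto)
    show "(\<lambda>t. ball_proj j (z t)) ` {a..b} \<subseteq> cball 0 (real (2 * j))"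
    proof (clarify)
      fix t show "ball_proj j (z t) \<in> cball 0 (real (2 * j))"
        using norm_ball_proj_le[of j "z t"] by simp
    qed
    fix t s assume "t \<in> {a..b}" "s \<in> {a..b}"
    then show "norm (ball_proj j (z t) - ball_proj j (z s)) \<le> mbound_moduli E (2 * j) a b \<bar>t - s\<bar>"
      using *[of s t] *[of t s] by (cases "s \<le> t") (auto simp: norm_minus_commute)
  qed
qed

lemma moduli_functions_max:
  "x \<in> moduli_functions \<Theta> j a b \<Longrightarrow> x \<in> moduli_functions (max_moduli \<Theta> \<theta>) j a b"
  unfolding moduli_functions_def max_moduli_def by (auto simp: le_max_iff_disj)

section \<open>Convergence in the seminorm topologies\<close>

text \<open>\<open>f\<close> itself serves as the centre of a subbasic set. The value there appears
  as \<open>\<rho> (f - f)\<close> since the type provides only subtraction.\<close>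

lemma limitin_seminorm_topology:
  assumes lim: "limitin (seminorm_topology V P) fs f sequentially"
  shows "f \<in> V" and "\<lbrakk>\<rho> \<in> P; \<rho> (f - f) = 0; 0 < \<epsilon>\<rbrakk> \<Longrightarrow> \<forall>\<^sub>F n in sequentially. \<rho> (fs n - f) < \<epsilon>"
proof -
  have "f \<in> topspace (seminorm_topology V P)" using lim by (simp add: limitin_def)
  then show fV: "f \<in> V" unfolding seminorm_topology_def topology_generated_by_topspace by blast
  assume \<rho>: "\<rho> \<in> P" "\<rho> (f - f) = 0" "0 < \<epsilon>"
  let ?U = "{g \<in> V. \<rho> (g - f) < \<epsilon>}"
  have "openin (seminorm_topology V P) ?U"
    unfolding seminorm_topology_def using fV \<rho> by (intro topology_generated_by_Basis) blast
  moreover have "f \<in> ?U" using fV \<rho> by simp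
  ultimately have "\<forall>\<^sub>F n in sequentially. fs n \<in> ?U" using lim unfolding limitin_def by blast
  then show "\<forall>\<^sub>F n in sequentially. \<rho> (fs n - f) < \<epsilon>" by eventually_elim simp
qed

lemma Lp_norm_zero: "1 \<le> p \<Longrightarrow> Lp_norm p I (\<lambda>_. 0) = 0"
  by (simp add: Lp_norm_def set_lebesgue_integral_def power_0_left)

text \<open>A supremum of reals dominates its members when the set is bounded above; this bound,
  uniform over all curves in a ball, guarantees it for the seminorms.\<close>

lemma LC_Lp_norm_bounded:
  fixes f :: "real \<Rightarrow> 'z::euclidean_space \<Rightarrow> 'w::euclidean_space"
  assumes f: "f \<in> LC p" and "1 \<le> p"
  shows "\<exists>B. \<forall>z :: real \<Rightarrow> 'z. continuous_on {a..b} z \<longrightarrow> z ` {a..b} \<subseteq> cball 0 (real j) \<longrightarrow> Lp_norm p {a..b} (\<lambda>t. f t (z t)) \<le> B"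
proof -
  obtain m where m: "m \<in> Lp_loc p" "AE t in lebesgue. \<forall>z\<in>cball 0 (real j). norm (f t z) \<le> m t"
    using LC_mbound[OF f, of j] by (elim bexE conjE)
  have mLp: "m \<in> Lp_on p {a..b}" using m(1) by (simp add: Lp_loc_def)
  show ?thesis
  proof (intro exI allI impI)
    fix z :: "real \<Rightarrow> 'z" assume z: "continuous_on {a..b} z" "z ` {a..b} \<subseteq> cball 0 (real j)"
    have ae: "AE t in lebesgue. t \<in> {a..b} \<longrightarrow> norm (f t (z t)) \<le> m t"
      using m(2)
    proof eventually_elim
      case (elim t)
      show ?case using elim z(2) by (meson image_subset_iff)
    qed
    note b = Lp_on_bounded_AE[OF LC_measurable_along[OF f z(1)] mLp ae]
    show "Lp_norm p {a..b} (\<lambda>t. f t (z t)) \<le> root p (integral {a..b} (\<lambda>t. norm (m t) ^ p))"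
      unfolding Lp_norm_eq[OF b(1)] using b(2) \<open>1 \<le> p\<close> by (intro real_root_le_mono) auto
  qed
qed

text \<open>The index \<open>i n\<close> may vary with \<open>n\<close>, which is the point of
  seminorms that are suprema over curves. The three topologies differ only in \<open>Z\<close> and
  \<open>\<zeta>\<close>; a one-point \<open>Z\<close> gives \<open>T_D\<close>.\<close>

lemma SUP_Lp_norm_tendsto:
  fixes fs :: "nat \<Rightarrow> real \<Rightarrow> 'z::euclidean_space \<Rightarrow> 'w::euclidean_space" and \<zeta> :: "'i \<Rightarrow> real \<Rightarrow> 'z"
  assumes "1 \<le> p" and fs: "\<And>n. fs n \<in> LC p"
    and lim: "limitin (seminorm_topology (LC p) P) fs f sequentially"
    and P: "(\<lambda>g. SUP i\<in>Z. Lp_norm p {a..b} (\<lambda>t. g t (\<zeta> i t))) \<in> P"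
    and \<zeta>: "\<And>i. i \<in> Z \<Longrightarrow> continuous_on {a..b} (\<zeta> i)" "\<And>i. i \<in> Z \<Longrightarrow> \<zeta> i ` {a..b} \<subseteq> cball 0 (real j)"
    and i: "\<And>n. i n \<in> Z"
  shows "(\<lambda>n. integral {a..b} (\<lambda>t. norm ((fs n - f) t (\<zeta> (i n) t)) ^ p)) \<longlonglongrightarrow> 0"
proof -
  define \<rho> where "\<rho> g = (SUP i\<in>Z. Lp_norm p {a..b} (\<lambda>t. g t (\<zeta> i t)))" for g :: "real \<Rightarrow> 'z \<Rightarrow> 'w"
  have f: "f \<in> LC p" by (rule limitin_seminorm_topology(1)[OF lim])
  have "Z \<noteq> {}" using i by blast
  then have \<rho>0: "\<rho> (f - f) = 0"
    by (simp add: \<rho>_def Lp_norm_zero[OF \<open>1 \<le> p\<close>] cSUP_const)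
  have D: "fs n - f \<in> LC p" for n by (rule LC_diff[OF fs f])
  define N where "N n = Lp_norm p {a..b} (\<lambda>t. (fs n - f) t (\<zeta> (i n) t))" for n
  have Lp: "(\<lambda>t. (fs n - f) t (\<zeta> (i n) t)) \<in> Lp_on p {a..b}" for n
    by (rule LC_Lp_along[OF D \<zeta>(1)[OF i]])
  have N0: "0 \<le> N n" and Np: "N n ^ p = integral {a..b} (\<lambda>t. norm ((fs n - f) t (\<zeta> (i n) t)) ^ p)" for n
    unfolding N_def Lp_norm_eq[OF Lp] using \<open>1 \<le> p\<close>
    by (simp_all only: real_root_ge_zero[OF integral_norm_power_nonneg]
        real_root_pow_pos2[OF _ integral_norm_power_nonneg] zero_less_iff_neq_zero)
  have N\<rho>: "N n \<le> \<rho> (fs n - f)" for n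
  proof -
    obtain B where B: "\<forall>z. continuous_on {a..b} z \<longrightarrow> z ` {a..b} \<subseteq> cball 0 (real j) \<longrightarrow>
        Lp_norm p {a..b} (\<lambda>t. (fs n - f) t (z t)) \<le> B"
      using LC_Lp_norm_bounded[OF D \<open>1 \<le> p\<close>, of a b j n] by (elim exE)
    show ?thesis
      unfolding N_def \<rho>_def using i B \<zeta> by (intro cSUP_upper bdd_aboveI2[of _ _ B]) auto
  qed
  have "N \<longlonglongrightarrow> 0"
  proof (rule LIMSEQ_I)
    fix r :: real assume "0 < r"
    have "\<rho> \<in> P" using P by (simp add: \<rho>_def[abs_def])
    then have "\<forall>\<^sub>F n in sequentially. \<rho> (fs n - f) < r"
      using \<rho>0 \<open>0 < r\<close> by (rule limitin_seminorm_topology(2)[OF lim])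
    then have "\<forall>\<^sub>F n in sequentially. norm (N n - 0) < r"
      by eventually_elim (use N0 N\<rho> in \<open>auto intro: le_less_trans\<close>)
    then show "\<exists>N'. \<forall>n\<ge>N'. norm (N n - 0) < r" unfolding eventually_sequentially .
  qed
  then have "(\<lambda>n. N n ^ p) \<longlonglongrightarrow> 0 ^ p" by (rule tendsto_power)
  then show ?thesis using \<open>1 \<le> p\<close> by (simp add: Np power_0_left)
qed

section \<open>Approximation of a continuous curve by step functions\<close>

lemma integral_partition:
  fixes F :: "real \<Rightarrow> real" and h :: real
  assumes "0 \<le> h" "F integrable_on {0..real N * h}"
  shows "integral {0..real N * h} F = (\<Sum>k<N. integral {real k * h..real (Suc k) * h} F)"
  using assms(2)
proof (induction N)
  case (Suc N)
  have le: "real N * h \<le> real (Suc N) * h" using assms(1) by (intro mult_right_mono) auto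
  have "F integrable_on {0..real N * h}"
    by (rule integrable_on_subinterval[OF Suc.prems]) (use le in auto)
  from Suc.IH[OF this] show ?case
    using Henstock_Kurzweil_Integration.integral_combine[OF _ le Suc.prems] assms(1) by simp
qed simp

text \<open>
  On a short rational interval the argument \<open>u t\<close> is replaced by a point of the dense set \<open>D\<close>;
  the error is controlled by the uniformly \<open>L\<^sup>p\<close>-bounded Lipschitz constants \<open>L n\<close>.
\<close>

lemma step_approximation_tendsto_0:
  fixes G :: "nat \<Rightarrow> real \<Rightarrow> 'u::euclidean_space \<Rightarrow> 'w::euclidean_space" and L :: "nat \<Rightarrow> real \<Rightarrow> real"
  assumes "1 \<le> p" "0 < T" "T \<in> \<rat>" and u: "continuous_on {0..T} u" and D: "closure D = UNIV"
    and R: "\<And>t. t \<in> {0..T} \<Longrightarrow> norm (u t) + 1 \<le> R"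
    and lim: "\<And>a b d. \<lbrakk>a \<in> \<rat>; b \<in> \<rat>; 0 \<le> a; a \<le> b; b \<le> T; d \<in> D; norm d \<le> R\<rbrakk> \<Longrightarrow>
       (\<lambda>n. integral {a..b} (\<lambda>t. norm (G n t d) ^ p)) \<longlonglongrightarrow> 0"
    and GLp: "\<And>n d. norm d \<le> R \<Longrightarrow> (\<lambda>t. G n t d) \<in> Lp_on p {0..T}"
    and GuLp: "\<And>n. (\<lambda>t. G n t (u t)) \<in> Lp_on p {0..T}"
    and L: "\<And>n. L n \<in> Lp_on p {0..T}" "\<And>n t. 0 \<le> L n t" "\<And>n. integral {0..T} (\<lambda>t. norm (L n t) ^ p) \<le> C"
    and lip: "\<And>n. AE t in lebesgue. t \<in> {0..T} \<longrightarrow>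
       (\<forall>d. norm d \<le> R \<longrightarrow> norm (G n t (u t) - G n t d) \<le> L n t * norm (u t - d))"
  shows "(\<lambda>n. integral {0..T} (\<lambda>t. norm (G n t (u t)) ^ p)) \<longlonglongrightarrow> 0"
proof (rule LIMSEQ_I)
  fix r :: real assume "0 < r"
  have C: "0 \<le> C" using L(3)[of 0] integral_norm_power_nonneg[of "{0..T}" "L 0" p] by linarith
  \<comment> \<open>\<open>\<epsilon> \<le> 1\<close> fits the margin 1 in the bound
    \<open>R\<close>: the approximating points keep norm at most \<open>R\<close>.\<close>
  obtain \<epsilon> where \<epsilon>: "0 < \<epsilon>" "\<epsilon> \<le> 1" and \<epsilon>C: "2 ^ p * (\<epsilon> ^ p * C) < r / 2"
    using ex_small_power_factor[of "r / 2" C p] \<open>0 < r\<close> C \<open>1 \<le> p\<close> by auto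
  have "uniformly_continuous_on {0..T} u" using u by (intro compact_uniformly_continuous) auto
  \<comment> \<open>One half of \<open>\<epsilon>\<close> is for the oscillation of \<open>u\<close>
    on a piece, the other for the distance of its value at the left node to
    \<open>D\<close>.\<close>
  then obtain \<delta> where \<delta>: "0 < \<delta>" "\<forall>s\<in>{0..T}. \<forall>t\<in>{0..T}. dist t s < \<delta> \<longrightarrow> dist (u t) (u s) < \<epsilon> / 2"
    unfolding uniformly_continuous_on_def using half_gt_zero[OF \<epsilon>(1)] by blast
  obtain N :: nat where N: "T / \<delta> < real N" using reals_Archimedean2 by blast
  have N0: "0 < real N" using N \<open>0 < T\<close> \<delta>(1) by (meson divide_pos_pos less_trans)
  define h where "h = T / real N"
  have h: "0 < h" "h < \<delta>" "real N * h = T"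
    using \<open>0 < T\<close> N N0 \<delta>(1) by (auto simp: h_def field_simps)
  \<comment> \<open>The nodes must be rational because convergence is known on rational intervals
    only.\<close>
  have hQ: "real k * h \<in> \<rat>" for k using \<open>T \<in> \<rat>\<close> by (simp add: h_def)
  have node: "real k * h \<in> {0..T}" if "k \<le> N" for k
    using h that mult_right_mono[of "real k" "real N" h] by auto
  have "\<exists>d\<in>D. dist d (u (real k * h)) < \<epsilon> / 2" for k
  proof -
    have "u (real k * h) \<in> closure D" using D by simp
    then show ?thesis using half_gt_zero[OF \<epsilon>(1)] unfolding closure_approachable by blast
  qed
  then obtain d where d: "\<And>k. d k \<in> D" "\<And>k. dist (d k) (u (real k * h)) < \<epsilon> / 2" by metis
  have dR: "norm (d k) \<le> R" if "k \<le> N" for k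
  proof -
    have "norm (d k) \<le> norm (u (real k * h)) + dist (d k) (u (real k * h))"
      by (simp add: dist_norm norm_triangle_sub)
    then show ?thesis using d(2)[of k] \<epsilon>(2) R[OF node[OF that]] by linarith
  qed
  have piece: "{real k * h..real (Suc k) * h} \<subseteq> {0..T}" if "k < N" for k
    using node[of k] node[of "Suc k"] that by auto
  have near: "norm (u t - d k) \<le> \<epsilon>" if "k < N" "t \<in> {real k * h..real (Suc k) * h}" for k t
  proof -
    have "t \<in> {0..T}" using piece[OF that(1)] that(2) by blast
    moreover have "dist t (real k * h) < \<delta>" using that(2) h by (auto simp: dist_norm algebra_simps)
    ultimately have "dist (u t) (u (real k * h)) < \<epsilon> / 2" using \<delta>(2)[rule_format, of "real k * h" t] node[of k] that(1) by simp
    then have "dist (u t) (d k) < \<epsilon>" using d(2)[of k] by (metis dist_commute dist_triangle_half_l)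
    then show ?thesis by (simp add: dist_norm)
  qed
  define I where "I n = (\<Sum>k<N. integral {real k * h..real (Suc k) * h} (\<lambda>t. norm (G n t (d k)) ^ p))" for n
  have "I \<longlonglongrightarrow> (\<Sum>k<N. 0)"
    unfolding I_def
  proof (intro tendsto_sum lim)
    fix k assume "k \<in> {..<N}"
    then have k: "k < N" by simp
    show "real (Suc k) * h \<le> T" "0 \<le> real k * h" "norm (d k) \<le> R"
      using node[of "Suc k"] node[of k] dR[of k] k by auto
    show "real k * h \<le> real (Suc k) * h" using h(1) by (intro mult_right_mono) auto
    show "real k * h \<in> \<rat>" "real (Suc k) * h \<in> \<rat>" "d k \<in> D" by (rule hQ d(1))+
  qed
  then have "\<forall>\<^sub>F n in sequentially. I n < r / 2 / 2 ^ p"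
    using \<open>0 < r\<close> by (intro order_tendstoD(2)[of I 0]) auto
  then have "\<forall>\<^sub>F n in sequentially. norm (integral {0..T} (\<lambda>t. norm (G n t (u t)) ^ p) - 0) < r"
  proof eventually_elim
    case (elim n)
    have Gi: "(\<lambda>t. norm (G n t (u t)) ^ p) integrable_on {0..T}" using GuLp[of n] by (simp add: Lp_on_iff)
    have Li: "(\<lambda>t. norm (L n t) ^ p) integrable_on {0..T}" using L(1)[of n] by (simp add: Lp_on_iff)
    have pk: "integral {real k * h..real (Suc k) * h} (\<lambda>t. norm (G n t (u t)) ^ p) \<le>
        2 ^ p * (integral {real k * h..real (Suc k) * h} (\<lambda>t. norm (G n t (d k)) ^ p) +
          \<epsilon> ^ p * integral {real k * h..real (Suc k) * h} (\<lambda>t. norm (L n t) ^ p))" if k: "k < N" for k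
    proof -
      let ?J = "{real k * h..real (Suc k) * h}"
      have dk: "norm (d k) \<le> R" using dR k by simp
      have 1: "(\<lambda>t. norm (G n t (d k))) \<in> Lp_on p ?J"
        by (intro Lp_on_norm Lp_on_subinterval[OF GLp[OF dk] piece[OF k]])
      note 2 = Lp_on_scale[OF Lp_on_subinterval[OF L(1)[of n] piece[OF k]], of \<epsilon>]
      note 3 = Lp_on_add[OF 1 2(1)]
      have ae: "AE t in lebesgue. t \<in> ?J \<longrightarrow> norm (G n t (u t)) \<le> norm (G n t (d k)) + \<epsilon> * L n t"
        using lip[of n]
      proof eventually_elim
        case (elim t)
        show ?case
        proof
          assume t: "t \<in> ?J"
          then have "norm (G n t (u t) - G n t (d k)) \<le> L n t * norm (u t - d k)"
            using elim dk piece[OF k] by blast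
          also have "\<dots> \<le> L n t * \<epsilon>" using L(2) near[OF k t] by (intro mult_left_mono) auto
          finally show "norm (G n t (u t)) \<le> norm (G n t (d k)) + \<epsilon> * L n t"
            using norm_triangle_sub[of "G n t (u t)" "G n t (d k)"] by (simp add: mult.commute)
        qed
      qed
      have m: "(\<lambda>t. G n t (u t)) \<in> borel_measurable (lebesgue_on ?J)"
        using Lp_on_subinterval[OF GuLp[of n] piece[OF k]] by (simp add: Lp_on_iff)
      have "integral ?J (\<lambda>t. norm (G n t (u t)) ^ p) \<le> integral ?J (\<lambda>t. norm (norm (G n t (d k)) + \<epsilon> * L n t) ^ p)"
        by (rule Lp_on_bounded_AE(2)[OF m 3(1) ae])
      also note 3(2)
      finally show ?thesis using 2(2) \<epsilon>(1) by simp
    qed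
    have "integral {0..T} (\<lambda>t. norm (G n t (u t)) ^ p) =
        (\<Sum>k<N. integral {real k * h..real (Suc k) * h} (\<lambda>t. norm (G n t (u t)) ^ p))"
      using integral_partition[of h _ N] h Gi by simp
    also have "\<dots> \<le> (\<Sum>k<N. 2 ^ p * (integral {real k * h..real (Suc k) * h} (\<lambda>t. norm (G n t (d k)) ^ p) +
          \<epsilon> ^ p * integral {real k * h..real (Suc k) * h} (\<lambda>t. norm (L n t) ^ p)))"
      by (rule sum_mono) (rule pk, simp)
    also have "\<dots> = 2 ^ p * (I n + \<epsilon> ^ p *
        (\<Sum>k<N. integral {real k * h..real (Suc k) * h} (\<lambda>t. norm (L n t) ^ p)))"
      by (simp only: I_def sum.distrib sum_distrib_left distrib_left)
    also have "(\<Sum>k<N. integral {real k * h..real (Suc k) * h} (\<lambda>t. norm (L n t) ^ p)) =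
        integral {0..T} (\<lambda>t. norm (L n t) ^ p)"
      using integral_partition[of h "\<lambda>t. norm (L n t) ^ p" N] h Li by simp
    also have "2 ^ p * (I n + \<epsilon> ^ p * integral {0..T} (\<lambda>t. norm (L n t) ^ p)) \<le> 2 ^ p * (I n + \<epsilon> ^ p * C)"
      using L(3) \<epsilon>(1) by (intro mult_left_mono add_left_mono) auto
    also have "\<dots> < r"
    proof -
      have "2 ^ p * I n < r / 2" using elim by (simp add: field_simps)
      with \<epsilon>C show ?thesis by (simp add: algebra_simps)
    qed
    finally have "integral {0..T} (\<lambda>t. norm (G n t (u t)) ^ p) < r" .
    then show ?case using integral_norm_power_nonneg[of "{0..T}" "\<lambda>t. G n t (u t)" p] by simp
  qed
  then show "\<exists>N. \<forall>n\<ge>N. norm (integral {0..T} (\<lambda>t. norm (G n t (u t)) ^ p) - 0) < r"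
    unfolding eventually_sequentially .
qed

text \<open>\<open>c n t d\<close> is the point of phase space into which \<open>d\<close> is
  inserted: \<open>(y n t, d)\<close> in (ii), \<open>d\<close> itself in (iii). It is isometric in
  \<open>d\<close>, so the majorant \<open>l\<close> of \<open>f\<close> simply adds to
  \<open>k n\<close> in the Lipschitz estimate for \<open>fs n - f\<close>.\<close>

lemma curve_approximation_tendsto_0:
  fixes fs :: "nat \<Rightarrow> real \<Rightarrow> 'z::euclidean_space \<Rightarrow> 'w::euclidean_space" and k :: "nat \<Rightarrow> real \<Rightarrow> real"
    and c :: "nat \<Rightarrow> real \<Rightarrow> 'u::euclidean_space \<Rightarrow> 'z"
  assumes "1 \<le> p" "0 < T" "T \<in> \<rat>" and u: "continuous_on {0..T} u" and D: "closure D = UNIV"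
    and fs: "\<And>n. fs n \<in> LC p" and f: "f \<in> LC p"
    and R: "\<And>t. t \<in> {0..T} \<Longrightarrow> norm (u t) + 1 \<le> R"
    and c: "\<And>n d. continuous_on {0..T} (\<lambda>t. c n t d)" "\<And>n. continuous_on {0..T} (\<lambda>t. c n t (u t))"
      "\<And>n t d. norm d \<le> R \<Longrightarrow> c n t d \<in> cball 0 (real J)" "\<And>n t d d'. norm (c n t d - c n t d') = norm (d - d')"
    and k: "\<And>n. k n \<in> Lp_on p {0..T}" "\<And>n t. 0 \<le> k n t" "\<And>n. integral {0..T} (\<lambda>t. norm (k n t) ^ p) \<le> C"
    and lip: "\<And>n. AE t in lebesgue. \<forall>d d'. norm d \<le> R \<longrightarrow> norm d' \<le> R \<longrightarrow>
      norm (fs n t (c n t d) - fs n t (c n t d')) \<le> k n t * norm (d - d')"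
    and lim: "\<And>a b d. \<lbrakk>a \<in> \<rat>; b \<in> \<rat>; 0 \<le> a; a \<le> b; b \<le> T; d \<in> D; norm d \<le> R\<rbrakk> \<Longrightarrow>
       (\<lambda>n. integral {a..b} (\<lambda>t. norm ((fs n - f) t (c n t d)) ^ p)) \<longlonglongrightarrow> 0"
  shows "(\<lambda>n. integral {0..T} (\<lambda>t. norm ((fs n - f) t (c n t (u t))) ^ p)) \<longlonglongrightarrow> 0"
proof -
  obtain l where l: "l \<in> Lp_loc p" "\<forall>t. 0 \<le> l t"
    and flip: "AE t in lebesgue. \<forall>z1\<in>cball 0 (real J). \<forall>z2\<in>cball 0 (real J).
       norm (f t z1 - f t z2) \<le> l t * norm (z1 - z2)"
    using LC_lbound[OF f, of J] by (elim bexE conjE)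
  have lLp: "l \<in> Lp_on p {0..T}" using l(1) by (simp add: Lp_loc_def)
  obtain C' where C': "\<forall>n. (\<lambda>t. l t + k n t) \<in> Lp_on p {0..T} \<and>
      integral {0..T} (\<lambda>t. norm (l t + k n t) ^ p) \<le> C'"
    using Lp_on_add_uniform_bound[OF lLp, of k, OF k(1,3)] by (elim exE)
  show ?thesis
  proof (rule step_approximation_tendsto_0[OF assms(1-3) u D R lim, where L = "\<lambda>n t. l t + k n t" and C = C'])
    show "(\<lambda>t. (fs n - f) t (c n t d)) \<in> Lp_on p {0..T}" for n d
      by (intro LC_Lp_along LC_diff fs f c(1))
    show "(\<lambda>t. (fs n - f) t (c n t (u t))) \<in> Lp_on p {0..T}" for n
      by (intro LC_Lp_along LC_diff fs f c(2))
    show "AE t in lebesgue. t \<in> {0..T} \<longrightarrow> (\<forall>d. norm d \<le> R \<longrightarrow>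
        norm ((fs n - f) t (c n t (u t)) - (fs n - f) t (c n t d)) \<le> (l t + k n t) * norm (u t - d))" for n
      using lip[of n] flip
    proof eventually_elim
      case (elim t)
      show ?case
      proof (intro impI allI)
        fix d :: 'u assume t: "t \<in> {0..T}" and d: "norm d \<le> R"
        have ut: "norm (u t) \<le> R" using R[OF t] by simp
        let ?a = "c n t (u t)" and ?b = "c n t d"
        have "(fs n - f) t ?a - (fs n - f) t ?b = (fs n t ?a - fs n t ?b) - (f t ?a - f t ?b)" by simp
        also have "norm \<dots> \<le> norm (fs n t ?a - fs n t ?b) + norm (f t ?a - f t ?b)" by (rule norm_triangle_ineq4)
        also have "\<dots> \<le> k n t * norm (u t - d) + l t * norm (?a - ?b)"
          using elim c(3)[OF ut] c(3)[OF d] ut d by (intro add_mono) blast+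
        finally show "norm ((fs n - f) t ?a - (fs n - f) t ?b) \<le> (l t + k n t) * norm (u t - d)"
          unfolding c(4) by (simp add: algebra_simps)
      qed
    qed
  qed (use k(2) l(2) C' in auto)
qed

section \<open>The three notions of convergence\<close>

lemma pair_mem_cball_double:
  assumes "norm x \<le> real j" "norm u \<le> real j"
  shows "(x, u) \<in> cball 0 (real (2 * j))"
  using norm_Pair_le[of x u] assms by simp

lemma continuous_on_ball_proj_compose:
  "continuous_on S z \<Longrightarrow> continuous_on S (\<lambda>t. ball_proj j (z t))"
  by (rule continuous_on_compose2[OF continuous_on_ball_proj[of UNIV]]) auto

lemma integral_split_tendsto_0:
  fixes F :: "nat \<Rightarrow> real \<Rightarrow> real"
  assumes "a \<le> c" "c \<le> b" "\<And>n. F n integrable_on {a..b}"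
    and "(\<lambda>n. integral {a..c} (F n)) \<longlonglongrightarrow> 0" "(\<lambda>n. integral {c..b} (F n)) \<longlonglongrightarrow> 0"
  shows "(\<lambda>n. integral {a..b} (F n)) \<longlonglongrightarrow> 0"
proof -
  have "(\<lambda>n. integral {a..c} (F n) + integral {c..b} (F n)) \<longlonglongrightarrow> 0 + 0"
    by (intro tendsto_add assms)
  then show ?thesis
    using Henstock_Kurzweil_Integration.integral_combine[OF assms(1,2,3)] by simp
qed

text \<open>
  A curve that equals the initial function on \<open>[-1, 0]\<close> and the solution on \<open>[0, T - 1]\<close> need not
  have the modulus \<open>max \<theta> \<theta>\<^sub>0\<close>, so the seminorms are used on \<open>[0, 1]\<close> and on \<open>[1, T]\<close> separately.
\<close>

lemma dde_sols_converge_Theta_Theta: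
  fixes E :: "(real \<Rightarrow> 'x \<times> 'x \<Rightarrow> 'x::euclidean_space) set"
  assumes "1 \<le> p" and E: "E \<subseteq> LC p" and eq: "L1loc_equicontinuous_mbounds E"
    and \<phi>s: "\<And>n. continuous_on {-1..0} (\<phi>s n)" and \<phi>: "continuous_on {-1..0} \<phi>"
    and unif: "uniform_limit {-1..0} \<phi>s \<phi> sequentially"
    and \<theta>: "\<And>n t s. \<lbrakk>t \<in> {-1..0}; s \<in> {-1..0}\<rbrakk> \<Longrightarrow> norm (\<phi>s n t - \<phi>s n s) \<le> \<theta> \<bar>t - s\<bar>"
    and fs: "\<And>n. fs n \<in> E"
    and lim: "limitin (T_Theta_Theta p (mbound_moduli E) (max_moduli (mbound_moduli E) \<theta>)) fs f sequentially"
  shows "dde_sols_converge p fs \<phi>s f \<phi>"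
proof -
  note lim' = lim[unfolded T_Theta_Theta_def]
  \<comment> \<open>A limit in the topology belongs to its underlying space, which is
    \<open>LC p\<close>.\<close>
  have f: "f \<in> LC p" by (rule limitin_seminorm_topology(1)[OF lim'])
  have fsLC: "fs n \<in> LC p" for n using fs E by blast
  show ?thesis
  proof (rule dde_sols_convergeI[OF fsLC f \<open>1 \<le> p\<close> \<phi>s \<phi> unif])
    fix T j z and x :: "real \<Rightarrow> 'x" and y
    assume T: "T \<in> \<rat>" "0 < T" and cx: "continuous_on {-1..T} x"
      and j: "\<forall>t\<in>{-1..T}. norm (x t) + 1 \<le> real j"
      and z: "\<forall>n. integral_solution (truncate j (fs n)) (\<phi>s n) T (z n)"
      and y: "\<forall>n t. y n t = ball_proj j (z n t)"
    have y_def: "y n = (\<lambda>t. ball_proj j (z n t))" for n using y by auto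
    define g where "g n t = norm ((fs n - f) t (y n t, y n (t - 1)))" for n t
    have cz: "continuous_on {-1..T} (z n)" and z\<phi>: "\<And>t. t \<in> {-1..0} \<Longrightarrow> z n t = \<phi>s n t" for n
      using z by (auto simp: integral_solution_def)
    have cy: "continuous_on {-1..T} (y n)" for n
      unfolding y_def by (rule continuous_on_ball_proj_compose[OF cz])
    have yK: "y n \<in> moduli_functions (mbound_moduli E) (2 * j) a b" if "0 \<le> a" "b \<le> T" for n a b
      unfolding y_def
      by (rule truncated_solution_moduli[OF E \<open>1 \<le> p\<close> eq fs z[rule_format] that])
    \<comment> \<open>On \<open>[-1, 0]\<close> the solution is the initial function, so the modulus
      comes from \<open>\<theta>\<close>.\<close>
    have yK0: "y n \<in> moduli_functions (max_moduli (mbound_moduli E) \<theta>) (2 * j) a b" if "-1 \<le> a" "b \<le> 0" for n a b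
      unfolding moduli_functions_def
    proof (intro CollectI conjI ballI)
      show "continuous_on {a..b} (y n)" by (rule continuous_on_subset[OF cy]) (use that T in auto)
      show "y n ` {a..b} \<subseteq> cball 0 (real (2 * j))"
      proof (rule image_subsetI)
        fix t show "y n t \<in> cball 0 (real (2 * j))"
          using norm_ball_proj_le[of j "z n t"] by (simp add: y_def)
      qed
      fix t s assume "t \<in> {a..b}" "s \<in> {a..b}"
      then have ts: "t \<in> {-1..0}" "s \<in> {-1..0}" using that by auto
      have "norm (y n t - y n s) \<le> norm (\<phi>s n t - \<phi>s n s)"
        unfolding y_def z\<phi>[OF ts(1)] z\<phi>[OF ts(2)] by (rule norm_ball_proj_diff_le)
      also have "\<dots> \<le> \<theta> \<bar>t - s\<bar>" by (rule \<theta>[OF ts])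
      finally show "norm (y n t - y n s) \<le> max_moduli (mbound_moduli E) \<theta> (2 * j) a b \<bar>t - s\<bar>"
        by (simp add: max_moduli_def)
    qed
    have piece: "(\<lambda>n. integral {a..b} (\<lambda>t. norm (g n t) ^ p)) \<longlonglongrightarrow> 0"
      if ab: "a \<in> \<rat>" "b \<in> \<rat>" "a \<le> b" "0 \<le> a" "b \<le> T"
        and yb: "\<And>n. y n \<in> moduli_functions (max_moduli (mbound_moduli E) \<theta>) (2 * j) (a - 1) (b - 1)" for a b
    proof -
      let ?Z = "moduli_functions (mbound_moduli E) (2 * j) a b \<times>
          moduli_functions (max_moduli (mbound_moduli E) \<theta>) (2 * j) (a - 1) (b - 1) :: ((real \<Rightarrow> 'x) \<times> (real \<Rightarrow> 'x)) set"
      let ?\<zeta> = "\<lambda>(i :: (real \<Rightarrow> 'x) \<times> (real \<Rightarrow> 'x)) t. (fst i t, snd i (t - 1))"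
      have "(\<lambda>n. integral {a..b} (\<lambda>t. norm ((fs n - f) t (?\<zeta> (y n, y n) t)) ^ p)) \<longlonglongrightarrow> 0"
      \<comment> \<open>Curves with index \<open>2 * j\<close> form pairs in the ball of radius
        \<open>4 * j\<close>.\<close>
      proof (rule SUP_Lp_norm_tendsto[OF \<open>1 \<le> p\<close> fsLC lim', where Z = ?Z and \<zeta> = ?\<zeta> and i = "\<lambda>n. (y n, y n)" and j = "4 * j"])
        show "(\<lambda>g. SUP i\<in>?Z. Lp_norm p {a..b} (\<lambda>t. g t (?\<zeta> i t))) \<in>
          {\<lambda>f. SUP (x, u)\<in>moduli_functions (mbound_moduli E) j a b \<times>
                moduli_functions (max_moduli (mbound_moduli E) \<theta>) j (a - 1) (b - 1).
              Lp_norm p {a..b} (\<lambda>t. f t (x t, u (t - 1))) | j a b. a \<in> \<rat> \<and> b \<in> \<rat> \<and> a \<le> b}"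
          using ab by (intro CollectI exI[of _ "2 * j"] exI[of _ a] exI[of _ b]) (simp add: split_def)
        show "(y n, y n) \<in> ?Z" for n using yK[OF ab(4,5), of n] yb[of n] by simp
        fix i assume i: "i \<in> ?Z"
        then have i': "fst i \<in> moduli_functions (mbound_moduli E) (2 * j) a b"
            "snd i \<in> moduli_functions (max_moduli (mbound_moduli E) \<theta>) (2 * j) (a - 1) (b - 1)"
          by auto
        have c: "continuous_on {a..b} (fst i)" "continuous_on {a - 1..b - 1} (snd i)"
          using i' by (auto simp: moduli_functions_def)
        have "continuous_on {a..b} (\<lambda>t. snd i (t - 1))"
          by (rule continuous_on_compose2[OF c(2)]) (auto intro!: continuous_intros)
        with c(1) show "continuous_on {a..b} (?\<zeta> i)" by (intro continuous_on_Pair)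
        show "?\<zeta> i ` {a..b} \<subseteq> cball 0 (real (4 * j))"
        proof (rule image_subsetI)
          fix t assume t: "t \<in> {a..b}"
          then have "t - 1 \<in> {a - 1..b - 1}" by simp
          with t i' have "fst i t \<in> cball 0 (real (2 * j))" "snd i (t - 1) \<in> cball 0 (real (2 * j))"
            unfolding moduli_functions_def by blast+
          then show "?\<zeta> i t \<in> cball 0 (real (4 * j))"
            using pair_mem_cball_double[of "fst i t" "2 * j" "snd i (t - 1)"] by simp
        qed
      qed
      then show ?thesis by (simp add: g_def)
    qed
    have gLp: "g n \<in> Lp_on p {0..T}" for n
      unfolding g_def by (intro Lp_on_norm LC_Lp_along_delay LC_diff fsLC f cy)
    \<comment> \<open>At time 1 the delayed argument crosses 0; for \<open>T \<le> 1\<close> the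
      second piece degenerates to a point.\<close>
    define c where "c = min 1 T"
    have c: "c \<in> \<rat>" "0 \<le> c" "c \<le> T" "c \<le> 1" using T by (auto simp: c_def min_def)
    have glim: "(\<lambda>n. integral {0..T} (\<lambda>t. norm (g n t) ^ p)) \<longlonglongrightarrow> 0"
    proof (rule integral_split_tendsto_0[OF c(2,3)])
      show "(\<lambda>t. norm (g n t) ^ p) integrable_on {0..T}" for n using gLp[of n] by (simp add: Lp_on_iff)
      show "(\<lambda>n. integral {0..c} (\<lambda>t. norm (g n t) ^ p)) \<longlonglongrightarrow> 0"
        by (rule piece) (use c in \<open>auto intro!: yK0\<close>)
      show "(\<lambda>n. integral {c..T} (\<lambda>t. norm (g n t) ^ p)) \<longlonglongrightarrow> 0"
      proof (rule piece)
        show "y n \<in> moduli_functions (max_moduli (mbound_moduli E) \<theta>) (2 * j) (c - 1) (T - 1)" for n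
        proof (cases "T \<le> 1")
          case True
          then show ?thesis using T(2) by (intro yK0) (auto simp: c_def)
        next
          case False
          then show ?thesis by (intro moduli_functions_max yK) (auto simp: c_def)
        qed
      qed (use c T in auto)
    qed
    obtain l where l: "l \<in> Lp_loc p" "\<forall>t. 0 \<le> l t"
      and lip: "AE t in lebesgue. \<forall>z1\<in>cball 0 (real (2 * j)). \<forall>z2\<in>cball 0 (real (2 * j)).
         norm (f t z1 - f t z2) \<le> l t * norm (z1 - z2)"
      using LC_lbound[OF f, of "2 * j"] by (elim bexE conjE)
    show "dde_comparison p T (\<lambda>n t. fs n t (y n t, y n (t - 1)) - f t (x t, x (t - 1)))
        (\<lambda>n t. norm (y n t - x t) + norm (y n (t - 1) - x (t - 1)))"
    proof (rule dde_comparisonI[OF gLp glim, where L = "\<lambda>_. l" and C = "integral {0..T} (\<lambda>t. norm (l t) ^ p)"])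
      show "l \<in> Lp_on p {0..T}" using l(1) by (simp add: Lp_loc_def)
      show "AE t in lebesgue. t \<in> {0..T} \<longrightarrow> norm (fs n t (y n t, y n (t - 1)) - f t (x t, x (t - 1))) \<le>
          norm (g n t) + l t * (norm (y n t - x t) + norm (y n (t - 1) - x (t - 1)))" for n
        using lip
      proof eventually_elim
        case (elim t)
        show ?case
        proof
          assume "t \<in> {0..T}"
          then have jt: "norm (x t) + 1 \<le> real j" "norm (x (t - 1)) + 1 \<le> real j" using j by auto
          let ?y = "(y n t, y n (t - 1))" and ?x = "(x t, x (t - 1))"
          have "?y \<in> cball 0 (real (2 * j))" unfolding y_def by (rule ball_proj_pair_mem)
          moreover have "?x \<in> cball 0 (real (2 * j))"
            using jt by (intro pair_mem_cball_double) linarith+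
          ultimately have lip_t: "norm (f t ?y - f t ?x) \<le> l t * norm (?y - ?x)" using elim by blast
          \<comment> \<open>The right-hand side is exchanged at \<open>?y\<close> first; only then
            is the curve changed, at the cost of the Lipschitz majorant of \<open>f\<close>.\<close>
          have "norm (fs n t ?y - f t ?x) = norm ((fs n - f) t ?y + (f t ?y - f t ?x))" by simp
          also have "\<dots> \<le> g n t + norm (f t ?y - f t ?x)"
            unfolding g_def by (rule norm_triangle_ineq)
          also have "norm (f t ?y - f t ?x) \<le> l t * norm (?y - ?x)" by (rule lip_t)
          also have "\<dots> \<le> l t * (norm (y n t - x t) + norm (y n (t - 1) - x (t - 1)))"
            using l(2) by (intro mult_left_mono norm_Pair_diff_le) auto
          finally show "norm (fs n t ?y - f t ?x) \<le>
              norm (g n t) + l t * (norm (y n t - x t) + norm (y n (t - 1) - x (t - 1)))"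
            by (simp add: g_def)
        qed
      qed
    qed (use l(2) in auto)
  qed
qed

text \<open>The seminorms hold the second argument constant, so the curve in it must be fixed in
  order to be replaced by steps: it is \<open>x (t - 1)\<close>, while the first argument may move
  with \<open>n\<close> under the moduli. Both the step approximation and the exchange of the
  delayed argument rely on the \<open>l2bound\<close> of \<open>fs n\<close>, bounded uniformly in
  \<open>n\<close>.\<close>

lemma dde_sols_converge_Theta_D:
  fixes E :: "(real \<Rightarrow> 'x \<times> 'x \<Rightarrow> 'x::euclidean_space) set"
  assumes "1 \<le> p" and E: "E \<subseteq> LC p" and eq: "L1loc_equicontinuous_mbounds E"
    and bd: "Lploc_bounded_l2bounds p E" and D': "closure D' = UNIV"
    and \<phi>s: "\<And>n. continuous_on {-1..0} (\<phi>s n)" and \<phi>: "continuous_on {-1..0} \<phi>"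
    and unif: "uniform_limit {-1..0} \<phi>s \<phi> sequentially"
    and fs: "\<And>n. fs n \<in> E"
    and lim: "limitin (T_Theta_D p (mbound_moduli E) D') fs f sequentially"
  shows "dde_sols_converge p fs \<phi>s f \<phi>"
proof -
  note lim' = lim[unfolded T_Theta_D_def]
  have f: "f \<in> LC p" by (rule limitin_seminorm_topology(1)[OF lim'])
  have fsLC: "fs n \<in> LC p" for n using fs E by blast
  show ?thesis
  proof (rule dde_sols_convergeI[OF fsLC f \<open>1 \<le> p\<close> \<phi>s \<phi> unif])
    fix T j z and x :: "real \<Rightarrow> 'x" and y
    assume T: "T \<in> \<rat>" "0 < T" and cx: "continuous_on {-1..T} x"
      and j: "\<forall>t\<in>{-1..T}. norm (x t) + 1 \<le> real j"
      and z: "\<forall>n. integral_solution (truncate j (fs n)) (\<phi>s n) T (z n)"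
      and y: "\<forall>n t. y n t = ball_proj j (z n t)"
    have y_def: "y n = (\<lambda>t. ball_proj j (z n t))" for n using y by auto
    define g where "g n t = norm ((fs n - f) t (y n t, x (t - 1)))" for n t
    have cz: "continuous_on {-1..T} (z n)" for n using z by (simp add: integral_solution_def)
    have cy: "continuous_on {0..T} (y n)" for n
      unfolding y_def by (rule continuous_on_ball_proj_compose[OF continuous_on_subset[OF cz]]) auto
    have cx1: "continuous_on {0..T} (\<lambda>t. x (t - 1))"
      by (rule continuous_on_compose2[OF cx]) (auto intro!: continuous_intros)
    have yK: "y n \<in> moduli_functions (mbound_moduli E) (2 * j) a b" if "0 \<le> a" "b \<le> T" for n a b
      unfolding y_def
      by (rule truncated_solution_moduli[OF E \<open>1 \<le> p\<close> eq fs z[rule_format] that])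
    have yb: "norm (y n t) \<le> real j" for n t unfolding y_def by (rule norm_ball_proj_le)
    obtain l where l: "l \<in> Lp_loc p" "\<forall>t. 0 \<le> l t"
      and lip: "AE t in lebesgue. \<forall>z1\<in>cball 0 (real (2 * j)). \<forall>z2\<in>cball 0 (real (2 * j)).
         norm (f t z1 - f t z2) \<le> l t * norm (z1 - z2)"
      using LC_lbound[OF f, of "2 * j"] by (elim bexE conjE)
    have lLp: "l \<in> Lp_on p {0..T}" using l(1) by (simp add: Lp_loc_def)
    define k where "k n t = enn2real (l2bound (2 * j) (fs n) t)" for n t
    have k0: "0 \<le> k n t" for n t by (simp add: k_def)
    obtain C where C: "\<forall>h\<in>E. (\<lambda>t. enn2real (l2bound (2 * j) h t)) \<in> Lp_on p {0..T} \<and>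
      integral {0..T} (\<lambda>t. norm (enn2real (l2bound (2 * j) h t)) ^ p) \<le> C \<and>
      (AE t in lebesgue. l2bound (2 * j) h t = ennreal (enn2real (l2bound (2 * j) h t)))"
      using uniform_bound_Lp[OF E, of "l2bound (2 * j)" "2 * j"] bd l2bound_measurable l2bound_le_lbound
      unfolding Lploc_bounded_l2bounds_def by blast
    have kLp: "k n \<in> Lp_on p {0..T}" and kC: "integral {0..T} (\<lambda>t. norm (k n t) ^ p) \<le> C"
      and kfin: "AE t in lebesgue. l2bound (2 * j) (fs n) t = ennreal (enn2real (l2bound (2 * j) (fs n) t))" for n
      using C[rule_format, OF fs[of n]] unfolding k_def by blast+
    obtain C' where C': "\<forall>n. (\<lambda>t. l t + k n t) \<in> Lp_on p {0..T} \<and>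
        integral {0..T} (\<lambda>t. norm (l t + k n t) ^ p) \<le> C'"
      using Lp_on_add_uniform_bound[OF lLp, of k, OF kLp kC] by (elim exE)
    have m: "(y n t, d) \<in> cball 0 (real (2 * j))" if "norm d \<le> real j" for n t d
      by (rule pair_mem_cball_double[OF yb that])
    have gLp: "g n \<in> Lp_on p {0..T}" for n
      unfolding g_def by (intro Lp_on_norm LC_Lp_along LC_diff fsLC f continuous_on_Pair cy cx1)
    have "(\<lambda>n. integral {0..T} (\<lambda>t. norm ((fs n - f) t (y n t, x (t - 1))) ^ p)) \<longlonglongrightarrow> 0"
    proof (rule curve_approximation_tendsto_0[OF \<open>1 \<le> p\<close> T(2,1) cx1 D' fsLC f _ _ _ _ _ kLp k0 kC,
          where c = "\<lambda>n t d. (y n t, d)" and R = "real j" and J = "2 * j"])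
      show "norm (x (t - 1)) + 1 \<le> real j" if "t \<in> {0..T}" for t using j that by simp
      show "continuous_on {0..T} (\<lambda>t. (y n t, d))" for n d by (intro continuous_on_Pair cy continuous_on_const)
      show "continuous_on {0..T} (\<lambda>t. (y n t, x (t - 1)))" for n by (intro continuous_on_Pair cy cx1)
      show "AE t in lebesgue. \<forall>d d'. norm d \<le> real j \<longrightarrow> norm d' \<le> real j \<longrightarrow>
          norm (fs n t (y n t, d) - fs n t (y n t, d')) \<le> k n t * norm (d - d')" for n
        using kfin[of n] unfolding k_def by eventually_elim (blast intro: l2bound_lipschitz m)
      fix a b d assume ab: "a \<in> \<rat>" "b \<in> \<rat>" "0 \<le> a" "a \<le> b" "b \<le> T" and d: "d \<in> D'" "norm d \<le> real j"
      let ?Z = "moduli_functions (mbound_moduli E) (2 * j) a b :: (real \<Rightarrow> 'x) set"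
      show "(\<lambda>n. integral {a..b} (\<lambda>t. norm ((fs n - f) t (y n t, d)) ^ p)) \<longlonglongrightarrow> 0"
      proof (rule SUP_Lp_norm_tendsto[OF \<open>1 \<le> p\<close> fsLC lim', where Z = ?Z and \<zeta> = "\<lambda>i t. (i t, d)" and i = y and j = "4 * j"])
        show "(\<lambda>g. SUP i\<in>?Z. Lp_norm p {a..b} (\<lambda>t. g t (i t, d))) \<in>
          {\<lambda>f. SUP x\<in>moduli_functions (mbound_moduli E) j a b. Lp_norm p {a..b} (\<lambda>t. f t (x t, u)) | j a b u.
            a \<in> \<rat> \<and> b \<in> \<rat> \<and> a \<le> b \<and> u \<in> D'}"
          using ab d by (intro CollectI exI[of _ "2 * j"] exI[of _ a] exI[of _ b] exI[of _ d]) simp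
        show "y n \<in> ?Z" for n by (rule yK[OF ab(3,5)])
        fix i assume i: "i \<in> ?Z"
        then have "continuous_on {a..b} i" by (simp add: moduli_functions_def)
        then show "continuous_on {a..b} (\<lambda>t. (i t, d))" by (intro continuous_on_Pair continuous_on_const)
        show "(\<lambda>t. (i t, d)) ` {a..b} \<subseteq> cball 0 (real (4 * j))"
        proof (rule image_subsetI)
          fix t assume "t \<in> {a..b}"
          with i have "i t \<in> cball 0 (real (2 * j))" unfolding moduli_functions_def by blast
          then show "(i t, d) \<in> cball 0 (real (4 * j))"
            using pair_mem_cball_double[of "i t" "2 * j" d] d(2) by simp
        qed
      qed
    qed (rule m, simp_all)
    then have glim: "(\<lambda>n. integral {0..T} (\<lambda>t. norm (g n t) ^ p)) \<longlonglongrightarrow> 0" by (simp add: g_def)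
    show "dde_comparison p T (\<lambda>n t. fs n t (y n t, y n (t - 1)) - f t (x t, x (t - 1)))
        (\<lambda>n t. norm (y n t - x t) + norm (y n (t - 1) - x (t - 1)))"
    proof (rule dde_comparisonI[OF gLp glim, where L = "\<lambda>n t. l t + k n t" and C = C'])
      show "AE t in lebesgue. t \<in> {0..T} \<longrightarrow> norm (fs n t (y n t, y n (t - 1)) - f t (x t, x (t - 1))) \<le>
          norm (g n t) + (l t + k n t) * (norm (y n t - x t) + norm (y n (t - 1) - x (t - 1)))" for n
        using lip kfin[of n]
      proof eventually_elim
        case (elim t)
        show ?case
        proof
          assume "t \<in> {0..T}"
          then have jt: "norm (x t) \<le> real j" "norm (x (t - 1)) \<le> real j"
            using j[rule_format, of t] j[rule_format, of "t - 1"] by simp_all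
          let ?y = "(y n t, y n (t - 1))" and ?w = "(y n t, x (t - 1))" and ?x = "(x t, x (t - 1))"
          let ?a = "norm (y n t - x t)" and ?b = "norm (y n (t - 1) - x (t - 1))"
          \<comment> \<open>Three changes: from \<open>fs n\<close> to \<open>f\<close> at the mixed
            point \<open>?w\<close>, of the first argument in \<open>f\<close>, and of the delayed
            argument in \<open>fs n\<close>.\<close>
          have "norm (fs n t ?y - f t ?x) =
              norm (((fs n - f) t ?w + (f t ?w - f t ?x)) + (fs n t ?y - fs n t ?w))" by simp
          also have "\<dots> \<le> (g n t + norm (f t ?w - f t ?x)) + norm (fs n t ?y - fs n t ?w)"
            unfolding g_def by (intro order_trans[OF norm_triangle_ineq] add_mono norm_triangle_ineq order_refl)
          also have "norm (f t ?w - f t ?x) \<le> l t * norm (?w - ?x)"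
            using elim(1) m[OF jt(2)] pair_mem_cball_double[OF jt] by blast
          also have "norm (?w - ?x) = ?a" by simp
          also have "norm (fs n t ?y - fs n t ?w) \<le> k n t * ?b"
            unfolding k_def by (rule l2bound_lipschitz[OF elim(2) m[OF yb] m[OF jt(2)]])
          \<comment> \<open>The added cross terms are nonnegative, so the two constants merge into
            one that multiplies the total error.\<close>
          also have "g n t + l t * ?a + k n t * ?b \<le> norm (g n t) + (l t + k n t) * (?a + ?b)"
          proof -
            have "0 \<le> l t * ?b" "0 \<le> k n t * ?a" using l(2) k0 by auto
            then show ?thesis by (simp add: g_def algebra_simps)
          qed
          finally show "norm (fs n t ?y - f t ?x) \<le> norm (g n t) + (l t + k n t) * (?a + ?b)" by simp
        qed
      qed
    qed (use l(2) k0 C' in auto)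
  qed
qed

text \<open>With no common modulus for the projected solutions, \<open>fs n - f\<close> is evaluated
  along the limit curve only. The change of curve then takes place inside \<open>fs n\<close>, which
  is why its l-bounds must be uniform in \<open>n\<close>.\<close>

lemma dde_sols_converge_D:
  fixes E :: "(real \<Rightarrow> 'x \<times> 'x \<Rightarrow> 'x::euclidean_space) set"
  assumes "1 \<le> p" and E: "E \<subseteq> LC p" and bd: "Lploc_bounded_lbounds p E" and D: "closure D = UNIV"
    and \<phi>s: "\<And>n. continuous_on {-1..0} (\<phi>s n)" and \<phi>: "continuous_on {-1..0} \<phi>"
    and unif: "uniform_limit {-1..0} \<phi>s \<phi> sequentially"
    and fs: "\<And>n. fs n \<in> E"
    and lim: "limitin (T_D p D) fs f sequentially"
  shows "dde_sols_converge p fs \<phi>s f \<phi>"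
proof -
  note lim' = lim[unfolded T_D_def]
  have f: "f \<in> LC p" by (rule limitin_seminorm_topology(1)[OF lim'])
  have fsLC: "fs n \<in> LC p" for n using fs E by blast
  show ?thesis
  proof (rule dde_sols_convergeI[OF fsLC f \<open>1 \<le> p\<close> \<phi>s \<phi> unif])
    fix T j z and x :: "real \<Rightarrow> 'x" and y :: "nat \<Rightarrow> real \<Rightarrow> 'x"
    assume T: "T \<in> \<rat>" "0 < T" and cx: "continuous_on {-1..T} x"
      and j: "\<forall>t\<in>{-1..T}. norm (x t) + 1 \<le> real j"
      and y: "\<forall>n t. y n t = ball_proj j (z n t)"
    define w where "w t = (x t, x (t - 1))" for t
    define g where "g n t = norm ((fs n - f) t (w t))" for n t
    have cw: "continuous_on {0..T} w" unfolding w_def by (rule continuous_on_delay_pair[OF cx])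
    have wb: "norm (w t) + 1 \<le> real (2 * j)" if "t \<in> {0..T}" for t
    proof -
      have "norm (x t) + 1 \<le> real j" "norm (x (t - 1)) + 1 \<le> real j" using j that by auto
      then show ?thesis using norm_Pair_le[of "x t" "x (t - 1)"] by (simp add: w_def)
    qed
    define k where "k n t = enn2real (lbound (2 * j) (fs n) t)" for n t
    have k0: "0 \<le> k n t" for n t by (simp add: k_def)
    obtain C where C: "\<forall>h\<in>E. (\<lambda>t. enn2real (lbound (2 * j) h t)) \<in> Lp_on p {0..T} \<and>
      integral {0..T} (\<lambda>t. norm (enn2real (lbound (2 * j) h t)) ^ p) \<le> C \<and>
      (AE t in lebesgue. lbound (2 * j) h t = ennreal (enn2real (lbound (2 * j) h t)))"
      using uniform_bound_Lp[OF E, of "lbound (2 * j)" "2 * j"] bd lbound_measurable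
      unfolding Lploc_bounded_lbounds_def by blast
    have kLp: "k n \<in> Lp_on p {0..T}" and kC: "integral {0..T} (\<lambda>t. norm (k n t) ^ p) \<le> C"
      and kfin: "AE t in lebesgue. lbound (2 * j) (fs n) t = ennreal (enn2real (lbound (2 * j) (fs n) t))" for n
      using C[rule_format, OF fs[of n]] unfolding k_def by blast+
    have gLp: "g n \<in> Lp_on p {0..T}" for n
      unfolding g_def by (intro Lp_on_norm LC_Lp_along LC_diff fsLC f cw)
    have "(\<lambda>n. integral {0..T} (\<lambda>t. norm ((fs n - f) t (w t)) ^ p)) \<longlonglongrightarrow> 0"
    proof (rule curve_approximation_tendsto_0[OF \<open>1 \<le> p\<close> T(2,1) cw D fsLC f wb _ _ _ _ kLp k0 kC,
          where c = "\<lambda>_ _ d. d" and J = "2 * j"])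
      show "AE t in lebesgue. \<forall>d d'. norm d \<le> real (2 * j) \<longrightarrow> norm d' \<le> real (2 * j) \<longrightarrow>
          norm (fs n t d - fs n t d') \<le> k n t * norm (d - d')" for n
        using kfin[of n] unfolding k_def
        by eventually_elim (intro allI impI lbound_lipschitz; simp)
      fix a b d assume ab: "a \<in> \<rat>" "b \<in> \<rat>" "0 \<le> a" "a \<le> b" "b \<le> T" and d: "d \<in> D" "norm d \<le> real (2 * j)"
      show "(\<lambda>n. integral {a..b} (\<lambda>t. norm ((fs n - f) t d) ^ p)) \<longlonglongrightarrow> 0"
      \<comment> \<open>A supremum over one index is the value itself, which brings the seminorms of
        \<open>T_D\<close> into the common form.\<close>
      proof (rule SUP_Lp_norm_tendsto[OF \<open>1 \<le> p\<close> fsLC lim', where Z = "{()}" and \<zeta> = "\<lambda>_ _. d" and i = "\<lambda>_. ()" and j = "2 * j"])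
        show "(\<lambda>g. SUP i\<in>{()}. Lp_norm p {a..b} (\<lambda>t. g t d)) \<in>
          {\<lambda>f. Lp_norm p {a..b} (\<lambda>t. f t z) | a b z. a \<in> \<rat> \<and> b \<in> \<rat> \<and> a \<le> b \<and> z \<in> D}"
          using ab d by (intro CollectI exI[of _ a] exI[of _ b] exI[of _ d]) simp
      qed (use d in auto)
    qed (use cw in auto)
    then have glim: "(\<lambda>n. integral {0..T} (\<lambda>t. norm (g n t) ^ p)) \<longlonglongrightarrow> 0" by (simp add: g_def)
    show "dde_comparison p T (\<lambda>n t. fs n t (y n t, y n (t - 1)) - f t (x t, x (t - 1)))
        (\<lambda>n t. norm (y n t - x t) + norm (y n (t - 1) - x (t - 1)))"
    proof (rule dde_comparisonI[OF gLp glim kLp k0 kC])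
      show "AE t in lebesgue. t \<in> {0..T} \<longrightarrow> norm (fs n t (y n t, y n (t - 1)) - f t (x t, x (t - 1))) \<le>
          norm (g n t) + k n t * (norm (y n t - x t) + norm (y n (t - 1) - x (t - 1)))" for n
        using kfin[of n]
      proof eventually_elim
        case (elim t)
        show ?case
        proof
          assume t: "t \<in> {0..T}"
          let ?y = "(y n t, y n (t - 1))"
          have m: "?y \<in> cball 0 (real (2 * j))" "w t \<in> cball 0 (real (2 * j))"
            using wb[OF t] ball_proj_pair_mem[of j "z n t" "z n (t - 1)"] y by simp_all
          have "norm (fs n t ?y - f t (x t, x (t - 1))) = norm ((fs n - f) t (w t) + (fs n t ?y - fs n t (w t)))"
            by (simp add: w_def)
          also have "\<dots> \<le> g n t + norm (fs n t ?y - fs n t (w t))"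
            unfolding g_def by (rule norm_triangle_ineq)
          also have "norm (fs n t ?y - fs n t (w t)) \<le> k n t * norm (?y - w t)"
            unfolding k_def by (rule lbound_lipschitz[OF elim m])
          also have "\<dots> \<le> k n t * (norm (y n t - x t) + norm (y n (t - 1) - x (t - 1)))"
            unfolding w_def by (intro mult_left_mono norm_Pair_diff_le k0)
          finally show "norm (fs n t ?y - f t (x t, x (t - 1))) \<le>
              norm (g n t) + k n t * (norm (y n t - x t) + norm (y n (t - 1) - x (t - 1)))"
            by (simp add: g_def)
        qed
      qed
    qed
  qed
qed

theorem proposition4p4:
  fixes p :: nat
    and E :: "(real \<Rightarrow> (real ^ 'n) \<times> (real ^ 'n) \<Rightarrow> real ^ 'n) set"
    and D' :: "(real ^ 'n) set"
    and D :: "((real ^ 'n) \<times> (real ^ 'n)) set"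
    and \<phi>s :: "nat \<Rightarrow> real \<Rightarrow> real ^ 'n"
    and \<phi> :: "real \<Rightarrow> real ^ 'n"
  assumes "p > 1"
    and "E \<subseteq> LC p"
    and "countable D'" and "closure D' = UNIV"
    and "countable D" and "closure D = UNIV"
    and "\<And>n. continuous_on {- 1..0} (\<phi>s n)" and "continuous_on {- 1..0} \<phi>"
    and "uniform_limit {- 1..0} \<phi>s \<phi> sequentially"
  shows
    "(L1loc_equicontinuous_mbounds E \<longrightarrow>
        (\<forall>\<theta>0 fs f.
           modulus_of_continuity \<theta>0 \<longrightarrow>
           (\<forall>\<psi>\<in>range \<phi>s \<union> {\<phi>}. \<forall>t\<in>{- 1..0}. \<forall>s\<in>{- 1..0}. norm (\<psi> t - \<psi> s) \<le> \<theta>0 \<bar>t - s\<bar>) \<longrightarrow>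
           (\<forall>n. fs n \<in> E) \<longrightarrow>
           limitin (T_Theta_Theta p (mbound_moduli E) (max_moduli (mbound_moduli E) \<theta>0))
             fs f sequentially \<longrightarrow>
           dde_sols_converge p fs \<phi>s f \<phi>)) \<and>
     (L1loc_equicontinuous_mbounds E \<and> Lploc_bounded_l2bounds p E \<longrightarrow>
        (\<forall>fs f.
           (\<forall>n. fs n \<in> E) \<longrightarrow>
           limitin (T_Theta_D p (mbound_moduli E) D') fs f sequentially \<longrightarrow>
           dde_sols_converge p fs \<phi>s f \<phi>)) \<and>
     (Lploc_bounded_lbounds p E \<longrightarrow>
        (\<forall>fs f.
           (\<forall>n. fs n \<in> E) \<longrightarrow>
           limitin (T_D p D) fs f sequentially \<longrightarrow>
           dde_sols_converge p fs \<phi>s f \<phi>))"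
proof (intro conjI impI allI)
  have p: "1 \<le> p" using \<open>p > 1\<close> by simp
  show "dde_sols_converge p fs \<phi>s f \<phi>"
    if "L1loc_equicontinuous_mbounds E"
      "\<forall>\<psi>\<in>range \<phi>s \<union> {\<phi>}. \<forall>t\<in>{- 1..0}. \<forall>s\<in>{- 1..0}. norm (\<psi> t - \<psi> s) \<le> \<theta>0 \<bar>t - s\<bar>"
      "\<forall>n. fs n \<in> E"
      "limitin (T_Theta_Theta p (mbound_moduli E) (max_moduli (mbound_moduli E) \<theta>0)) fs f sequentially"
    for \<theta>0 fs f
    by (rule dde_sols_converge_Theta_Theta[OF p assms(2) that(1) assms(7-9) _ _ that(4)])
      (use that(2,3) in auto)
  show "dde_sols_converge p fs \<phi>s f \<phi>"
    if "L1loc_equicontinuous_mbounds E \<and> Lploc_bounded_l2bounds p E" "\<forall>n. fs n \<in> E"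
      "limitin (T_Theta_D p (mbound_moduli E) D') fs f sequentially" for fs f
    by (rule dde_sols_converge_Theta_D[OF p assms(2) _ _ assms(4,7-9) _ that(3)]) (use that(1,2) in auto)
  show "dde_sols_converge p fs \<phi>s f \<phi>"
    if "Lploc_bounded_lbounds p E" "\<forall>n. fs n \<in> E" "limitin (T_D p D) fs f sequentially" for fs f
    by (rule dde_sols_converge_D[OF p assms(2) that(1) assms(6-9) _ that(3)]) (use that(2) in auto)
qed

end
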